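(* Let $A_1$ and $A_2$ be unital $C^*$-algebras, let $p$ be a positive real number, and let $\phi\colon A_{1+}^{-1}\to A_{2+}^{-1}$ be a surjection. The following are equivalent: (i) there exists a Jordan $*$-isomorphism $J\colon A_1\to A_2$ such that $\phi=J$ on $A_{1+}^{-1}$; (ii) $\|\phi(x)\phi(y)\|=\|xy\|$ for all $x,y\in A_{1+}^{-1}$; (iii) $\|\phi(x)\phi(y)\|_S=\|xy\|_S$ for all $x,y\in A_{1+}^{-1}$; (iv) $\sigma(\phi(x)\phi(y))=\sigma(xy)$ for all $x,y\in A_{1+}^{-1}$; (v) $\|(\phi(x)^{p/2}\phi(y)^p\phi(x)^{p/2})^{1/p}\|=\|(x^{p/2}y^px^{p/2})^{1/p}\|$ for all $x,y\in A_{1+}^{-1}$.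
   Context: For a unital $C^*$-algebra $A$ (unit always denoted $e$), $A_+^{-1}$ denotes the positive definite cone of $A$, i.e. the set of all positive invertible elements of $A$; $A_{j+}^{-1}$ denotes this cone for $A=A_j$. $\sigma(a)$ is the spectrum of $a\in A$, and $\|a\|_S=\sup\{|t|\colon t\in\sigma(a)\}$ is the spectral seminorm. Real powers of positive elements are taken via continuous functional calculus. A Jordan $*$-isomorphism $J\colon A_1\to A_2$ is a complex linear bijection that preserves the Jordan product $(ab+ba)/2$ and the involution. *)

theory Defs
  imports "HOL-Analysis.Analysis"
begin

text \<open>
  Unital C*-algebras, as a type class over the real Banach algebras of the library. The axiom
  \<open>scaleC_of_real\<close> makes the complex structure extend the given real one. Since
  \<open>norm 1 = 1\<close> in \<open>real_normed_algebra_1\<close>, the algebra is nonzero.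
\<close>

class unital_cstar_algebra = banach + real_normed_algebra_1 +
  fixes scaleC :: "complex \<Rightarrow> 'a \<Rightarrow> 'a"  (infixr "*\<^sub>C" 75)
    and invol :: "'a \<Rightarrow> 'a"
  assumes scaleC_of_real: "complex_of_real r *\<^sub>C x = r *\<^sub>R x"
    and scaleC_add_right: "c *\<^sub>C (x + y) = c *\<^sub>C x + c *\<^sub>C y"
    and scaleC_add_left: "(c + d) *\<^sub>C x = c *\<^sub>C x + d *\<^sub>C x"
    and scaleC_scaleC: "c *\<^sub>C (d *\<^sub>C x) = (c * d) *\<^sub>C x"
    and mult_scaleC_left: "(c *\<^sub>C x) * y = c *\<^sub>C (x * y)"
    and mult_scaleC_right: "x * (c *\<^sub>C y) = c *\<^sub>C (x * y)"
    and norm_scaleC: "norm (c *\<^sub>C x) = cmod c * norm x"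
    and invol_invol: "invol (invol x) = x"
    and invol_add: "invol (x + y) = invol x + invol y"
    and invol_scaleC: "invol (c *\<^sub>C x) = cnj c *\<^sub>C invol x"
    and invol_mult: "invol (x * y) = invol y * invol x"
    and cstar_identity: "norm (invol x * x) = (norm x)\<^sup>2"

definition cstar_invertible :: "'a::unital_cstar_algebra \<Rightarrow> bool" where
  "cstar_invertible a \<longleftrightarrow> (\<exists>b. a * b = 1 \<and> b * a = 1)"

definition cstar_spectrum :: "'a::unital_cstar_algebra \<Rightarrow> complex set" where
  "cstar_spectrum a = {t. \<not> cstar_invertible (a - t *\<^sub>C 1)}"

definition spectral_seminorm :: "'a::unital_cstar_algebra \<Rightarrow> real" where
  "spectral_seminorm a = Sup {cmod t | t. t \<in> cstar_spectrum a}"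

definition cstar_positive :: "'a::unital_cstar_algebra \<Rightarrow> bool" where
  "cstar_positive a \<longleftrightarrow>
     invol a = a \<and> (\<forall>t \<in> cstar_spectrum a. Im t = 0 \<and> 0 \<le> Re t)"

definition pos_def_cone :: "'a::unital_cstar_algebra set" where
  "pos_def_cone = {a. cstar_positive a \<and> cstar_invertible a}"

text \<open>
  \<open>is_functional_calculus a \<Phi>\<close>: \<open>\<Phi>\<close> is a unital *-homomorphism from
  \<open>C(\<sigma>(a))\<close> into the algebra that sends the identity function to \<open>a\<close>. Elements of
  \<open>C(\<sigma>(a))\<close> are represented by total functions that are continuous on the spectrum; the
  first clause says that only the values on the spectrum matter.
\<close>

definition is_functional_calculus ::
    "'a::unital_cstar_algebra \<Rightarrow> ((complex \<Rightarrow> complex) \<Rightarrow> 'a) \<Rightarrow> bool" where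
  "is_functional_calculus a \<Phi> \<longleftrightarrow>
     (\<forall>f g. continuous_on (cstar_spectrum a) f \<longrightarrow> (\<forall>t \<in> cstar_spectrum a. f t = g t) \<longrightarrow> \<Phi> f = \<Phi> g) \<and>
     (\<forall>f g. continuous_on (cstar_spectrum a) f \<longrightarrow> continuous_on (cstar_spectrum a) g \<longrightarrow>
        \<Phi> (\<lambda>t. f t + g t) = \<Phi> f + \<Phi> g \<and> \<Phi> (\<lambda>t. f t * g t) = \<Phi> f * \<Phi> g) \<and>
     (\<forall>c f. continuous_on (cstar_spectrum a) f \<longrightarrow>
        \<Phi> (\<lambda>t. c * f t) = c *\<^sub>C \<Phi> f \<and> \<Phi> (\<lambda>t. cnj (f t)) = invol (\<Phi> f)) \<and>
     \<Phi> (\<lambda>t. 1) = 1 \<and> \<Phi> (\<lambda>t. t) = a"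

text \<open>
  For normal \<open>a\<close> and \<open>f\<close> continuous on its spectrum, the value \<open>f(a)\<close> exists and is unique;
  outside that range the description below is not meaningful.
\<close>

definition cfc :: "'a::unital_cstar_algebra \<Rightarrow> (complex \<Rightarrow> complex) \<Rightarrow> 'a" where
  "cfc a f = (THE b. \<exists>\<Phi>. is_functional_calculus a \<Phi> \<and> \<Phi> f = b)"

text \<open>
  Meant for \<open>a\<close> in the positive definite cone: its spectrum lies in the open positive half-line,
  on which \<open>Re t powr r\<close> is the continuous function \<open>t\<close> to the power \<open>r\<close>.
\<close>

definition cstar_powr :: "'a::unital_cstar_algebra \<Rightarrow> real \<Rightarrow> 'a" where
  "cstar_powr a r = cfc a (\<lambda>t. complex_of_real (Re t powr r))"

definition jordan_prod :: "'a::unital_cstar_algebra \<Rightarrow> 'a \<Rightarrow> 'a" where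
  "jordan_prod a b = (1/2) *\<^sub>C (a * b + b * a)"

definition jordan_star_iso ::
    "('a::unital_cstar_algebra \<Rightarrow> 'b::unital_cstar_algebra) \<Rightarrow> bool" where
  "jordan_star_iso J \<longleftrightarrow>
     bij J \<and>
     (\<forall>a b. J (a + b) = J a + J b) \<and>
     (\<forall>c a. J (c *\<^sub>C a) = c *\<^sub>C J a) \<and>
     (\<forall>a b. J (jordan_prod a b) = jordan_prod (J a) (J b)) \<and>
     (\<forall>a. J (invol a) = invol (J a))"

definition all_equivalent :: "bool list \<Rightarrow> bool" where
  "all_equivalent Ps \<longleftrightarrow> (\<forall>P \<in> set Ps. \<forall>Q \<in> set Ps. P \<longleftrightarrow> Q)"

end

theory Submission
  imports Defs "HOL-Computational_Algebra.Fundamental_Theorem_Algebra"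
begin

text \<open>
  For \<open>x\<close>, \<open>y\<close> in the cone, \<open>\<parallel>xy\<parallel>\<^sub>S = \<parallel>x\<^sup>1\<^sup>/\<^sup>2 y x\<^sup>1\<^sup>/\<^sup>2\<parallel>\<close>, so \<open>\<parallel>x y\<^sup>-\<^sup>1\<parallel>\<^sub>S \<le> t\<close> iff
  \<open>x \<le> t y\<close>. Hence a surjection \<open>\<phi>\<close> satisfying (iii) is a homogeneous order isomorphism of the
  cones that commutes with inversion, and an isometry for the Thompson metric. A Mazur--Ulam argument
  with the reflections \<open>x \<mapsto> c x\<^sup>-\<^sup>1 c\<close> gives \<open>\<phi> (c\<^sup>2) = \<phi> c\<^sup>2\<close>. Therefore
  \<open>D x = log (\<phi> (exp x))\<close> satisfies \<open>D (x / 2\<^sup>n) = D x / 2\<^sup>n\<close>, is the derivative of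
  \<open>\<phi>\<close> at \<open>1\<close>, and so inherits monotonicity; with \<open>D (x + s) = D x + s\<close> this makes
  \<open>D\<close> a surjective isometry of the hermitian parts, which is linear by Mazur--Ulam. Kadison's
  inequality for \<open>D\<close> and for its inverse gives \<open>D (x\<^sup>2) = (D x)\<^sup>2\<close>, and then
  \<open>\<phi> (exp x) = exp (D x) = D (exp x)\<close>.

  Condition (ii) for \<open>\<phi>\<close> is (iii) for \<open>x \<mapsto> \<phi> (x\<^sup>1\<^sup>/\<^sup>2)\<^sup>2\<close>, and (v) is (iii) for
  \<open>x \<mapsto> \<phi> (x\<^sup>1\<^sup>/\<^sup>p)\<^sup>p\<close>; Jordan *-isomorphisms commute with real powers.
\<close>

text \<open>The theory of positive elements and the functional calculus rest on one fact: a
  hermitian element has a spectral point whose modulus is its norm. This makes positivity a norm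
  inequality, so that the positive elements form a closed convex cone, and it bounds a polynomial in
  a hermitian element by its values on the spectrum, so that Stone-Weierstrass applies. The obstacle
  in the main implication is that nothing linear is known about \<open>\<phi>\<close> beyond
  homogeneity, and that logarithms do not visibly keep the order in both directions: exp is not
  monotone for the order of operators, so x \<preceq> y says nothing about exp x and exp y. To first
  order at 0, however, exp (t x) is 1 + t x, and the rule for squares, iterated downwards, says that
  \<open>\<phi>\<close> maps exp (x / 2^n) to exp (D x / 2^n). A strict gap between x and y absorbs
  the error of the first-order approximation and is removed afterwards by a limit.\<close>

interpretation cvec: vector_space "scaleC :: complex \<Rightarrow> 'a \<Rightarrow> 'a::unital_cstar_algebra"
  by unfold_locales
    (use scaleC_of_real[of 1] in \<open>simp_all add: scaleC_add_right scaleC_add_left scaleC_scaleC\<close>)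

interpretation cbil: bounded_bilinear "scaleC :: complex \<Rightarrow> 'a \<Rightarrow> 'a::unital_cstar_algebra"
proof
  fix r :: real and c :: complex and x :: 'a
  show "(r *\<^sub>R c) *\<^sub>C x = r *\<^sub>R c *\<^sub>C x"
    by (simp only: scaleC_of_real[symmetric] scaleC_scaleC scaleR_conv_of_real)
  show "c *\<^sub>C r *\<^sub>R x = r *\<^sub>R c *\<^sub>C x"
    by (simp only: scaleC_of_real[symmetric] scaleC_scaleC mult.commute)
  show "\<exists>K. \<forall>a b. norm (a *\<^sub>C b :: 'a) \<le> norm a * norm b * K"
    by (rule exI[of _ 1]) (simp add: norm_scaleC)
qed (simp_all add: scaleC_add_right scaleC_add_left)

lemma scaleC_scaleR: "c *\<^sub>C r *\<^sub>R (x::'a::unital_cstar_algebra) = r *\<^sub>R c *\<^sub>C x"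
  by (rule cbil.scaleR_right)

lemma scaleR_conv_scaleC: "r *\<^sub>R (x::'a::unital_cstar_algebra) = of_real r *\<^sub>C x"
  by (simp add: scaleC_of_real)

lemma invol_scaleR: "invol (r *\<^sub>R (x::'a::unital_cstar_algebra)) = r *\<^sub>R invol x"
  by (simp add: scaleR_conv_scaleC invol_scaleC)

lemma norm_invol: "norm (invol (x::'a::unital_cstar_algebra)) = norm x"
proof -
  have le: "norm x \<le> norm (invol x)" for x :: 'a
  proof (cases "x = 0")
    case False
    have "norm x * norm x \<le> norm (invol x) * norm x"
      using cstar_identity[of x] norm_mult_ineq[of "invol x" x] by (simp add: power2_eq_square)
    with False show ?thesis by simp
  qed simp
  show ?thesis using le[of x] le[of "invol x"] by (simp add: invol_invol)
qed

lemma bounded_linear_invol: "bounded_linear (invol :: 'a \<Rightarrow> 'a::unital_cstar_algebra)"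
  by (rule bounded_linear_intro[of _ 1]) (simp_all add: invol_add invol_scaleR norm_invol)

lemmas invol_diff = linear_diff[OF bounded_linear.linear[OF bounded_linear_invol]]
  and invol_minus = linear_neg[OF bounded_linear.linear[OF bounded_linear_invol]]
  and invol_zero [simp] = linear_0[OF bounded_linear.linear[OF bounded_linear_invol]]
  and invol_sum = linear_sum[OF bounded_linear.linear[OF bounded_linear_invol]]
  and tendsto_invol = bounded_linear.tendsto[OF bounded_linear_invol]

lemma invol_one [simp]: "invol (1::'a::unital_cstar_algebra) = 1"
  by (metis invol_invol invol_mult mult_1_left)

lemma invol_power: "invol ((x::'a::unital_cstar_algebra) ^ n) = invol x ^ n"
  by (induction n) (simp_all add: invol_mult power_commutes)

abbreviation hermitian :: "'a::unital_cstar_algebra \<Rightarrow> bool" where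
  "hermitian a \<equiv> invol a = a"

lemma hermitian_norm_square: "hermitian a \<Longrightarrow> norm (a * a) = (norm a)\<^sup>2"
  using cstar_identity[of a] by simp

text \<open>The C*-identity iterated along squarings. It keeps the elements \<open>b k\<close> of
  norm one in \<open>hermitian_norm_one_spectrum\<close>.\<close>

lemma hermitian_norm_power2: "hermitian a \<Longrightarrow> norm (a ^ (2 ^ k)) = norm a ^ (2 ^ k)"
proof (induction k)
  case (Suc k)
  have "norm (a ^ (2 ^ Suc k)) = norm (a ^ (2 ^ k) * a ^ (2 ^ k))"
    by (simp add: power_add[symmetric] mult_2)
  also have "\<dots> = (norm a ^ (2 ^ k))\<^sup>2"
    using Suc by (subst hermitian_norm_square) (simp_all add: invol_power)
  finally show ?case by (simp add: power_mult[symmetric] mult.commute)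
qed simp


subsection \<open>Invertible elements and the spectrum\<close>

definition cinv :: "'a::unital_cstar_algebra \<Rightarrow> 'a" where
  "cinv a = (THE b. a * b = 1 \<and> b * a = 1)"

lemma inverse_unique_ring:
  fixes a b c :: "'a::monoid_mult"
  assumes "a * b = 1" "c * a = 1" shows "b = c"
  by (metis assms mult.assoc mult_1_left mult_1_right)

lemma cinv_eq: "a * b = 1 \<Longrightarrow> b * a = 1 \<Longrightarrow> cinv a = b"
  unfolding cinv_def by (rule the_equality) (auto intro: inverse_unique_ring)

lemma cinv_props:
  assumes "cstar_invertible a"
  shows cinv_right: "a * cinv a = 1" and cinv_left: "cinv a * a = 1"
  using assms cinv_eq[of a] unfolding cstar_invertible_def by auto

lemma cinv_one [simp]: "cinv 1 = 1"
  by (rule cinv_eq) auto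

lemma cstar_invertibleI: "a * b = 1 \<Longrightarrow> b * a = 1 \<Longrightarrow> cstar_invertible a"
  unfolding cstar_invertible_def by blast

lemma cstar_invertible_left_right:
  assumes "a * b = 1" "c * a = 1" shows "cstar_invertible a"
  using assms inverse_unique_ring[OF assms] by (auto intro: cstar_invertibleI)

lemma cstar_invertible_one [simp]: "cstar_invertible 1"
  by (rule cstar_invertibleI[of _ 1]) auto

lemma cstar_invertible_cinv: "cstar_invertible a \<Longrightarrow> cstar_invertible (cinv a)"
  by (rule cstar_invertibleI[of _ a]) (simp_all add: cinv_props)

lemma cinv_cinv: "cstar_invertible a \<Longrightarrow> cinv (cinv a) = a"
  by (rule cinv_eq) (simp_all add: cinv_props)

lemma
  assumes "cstar_invertible a" "cstar_invertible b"
  shows cstar_invertible_mult: "cstar_invertible (a * b)"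
    and cinv_mult: "cinv (a * b) = cinv b * cinv a"
proof -
  have 1: "(a * b) * (cinv b * cinv a) = 1" "(cinv b * cinv a) * (a * b) = 1"
    using assms by (metis cinv_left cinv_right mult.assoc mult_1_left)+
  show "cstar_invertible (a * b)" by (rule cstar_invertibleI[OF 1])
  show "cinv (a * b) = cinv b * cinv a" by (rule cinv_eq[OF 1])
qed

lemma cstar_invertible_scaleC:
  assumes "c \<noteq> 0" "cstar_invertible a"
  shows "cstar_invertible (c *\<^sub>C a)"
  using assms
  by (intro cstar_invertibleI[of _ "(1/c) *\<^sub>C cinv a"])
     (simp_all add: mult_scaleC_left mult_scaleC_right cinv_props)

lemma cstar_invertible_scaleC_iff:
  assumes "c \<noteq> 0" shows "cstar_invertible (c *\<^sub>C a) \<longleftrightarrow> cstar_invertible a"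
  using cstar_invertible_scaleC[OF assms, of a] cstar_invertible_scaleC[of "1/c" "c *\<^sub>C a"] assms
  by auto

lemma not_cstar_invertible_zero [simp]: "\<not> cstar_invertible 0"
  unfolding cstar_invertible_def by simp

text \<open>Commutation turns the inverse of the product into inverses of \<open>a\<close> on both
  sides. This is the step behind spectral mapping for polynomials, where the factors
  commute.\<close>

lemma cstar_invertible_commuting_factor:
  assumes "a * b = b * a" "cstar_invertible (a * b)" shows "cstar_invertible a"
proof (rule cstar_invertible_left_right)
  show "a * (b * cinv (a * b)) = 1"
    using assms by (metis cinv_right mult.assoc)
  show "(cinv (a * b) * b) * a = 1"
    using assms by (metis cinv_left mult.assoc)
qed

lemma cstar_invertible_similar:
  assumes "s * t = 1" "t * s = 1"
  shows "cstar_invertible (s * a * t) \<longleftrightarrow> cstar_invertible a"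
proof
  assume "cstar_invertible a"
  with assms show "cstar_invertible (s * a * t)"
    by (intro cstar_invertible_mult) (auto intro: cstar_invertibleI)
next
  assume "cstar_invertible (s * a * t)"
  moreover have "cstar_invertible t" "cstar_invertible s" using assms by (auto intro: cstar_invertibleI)
  ultimately have "cstar_invertible (t * (s * a * t) * s)" by (simp only: cstar_invertible_mult)
  also have "t * (s * a * t) * s = (t * s) * a * (t * s)" by (simp only: mult.assoc)
  also have "\<dots> = a" using assms by simp
  finally show "cstar_invertible a" .
qed

lemma invol_cinv:
  assumes "cstar_invertible a"
  shows "cstar_invertible (invol a)" "cinv (invol a) = invol (cinv a)"
proof -
  have 1: "invol a * invol (cinv a) = 1" "invol (cinv a) * invol a = 1"
    using assms by (simp_all add: invol_mult[symmetric] cinv_props)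
  show "cstar_invertible (invol a)" by (rule cstar_invertibleI[OF 1])
  show "cinv (invol a) = invol (cinv a)" by (rule cinv_eq[OF 1])
qed

lemma cstar_invertible_Neumann:
  fixes x :: "'a::unital_cstar_algebra"
  assumes "norm x < 1" shows "cstar_invertible (1 - x)"
proof -
  have s: "summable (\<lambda>n. x ^ n)" by (rule complete_algebra_summable_geometric[OF assms])
  have h: "(\<Sum>n. x ^ Suc n) = (\<Sum>n. x ^ n) - 1"
    using suminf_split_head[OF s] by simp
  have "x * (\<Sum>n. x ^ n) = (\<Sum>n. x ^ n) - 1"
    using suminf_mult[OF s, of x] h by simp
  moreover have "(\<Sum>n. x ^ n) * x = (\<Sum>n. x ^ n) - 1"
    using suminf_mult2[OF s, of x] h by (simp add: power_commutes)
  ultimately show ?thesis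
    by (intro cstar_invertibleI[of _ "\<Sum>n. x ^ n"]) (simp_all add: algebra_simps)
qed

text \<open>The explicit radius \<open>1 / norm (cinv a)\<close> matters: it gives the openness of
  the resolvent set, the distance of the spectrum from 0 in \<open>pos_def_cone_iff\<close>, and the
  passage to limits in \<open>fc_spectrumI\<close>.\<close>

lemma cstar_invertible_near:
  assumes "cstar_invertible a" "norm (b - a) * norm (cinv a) < 1"
  shows "cstar_invertible b"
proof -
  have "norm (cinv a * (a - b)) < 1"
    using assms(2) norm_mult_ineq[of "cinv a" "a - b"]
    by (simp add: norm_minus_commute mult.commute)
  then have "cstar_invertible (1 - cinv a * (a - b))" by (rule cstar_invertible_Neumann)
  then have "cstar_invertible (a * (1 - cinv a * (a - b)))"
    using assms(1) by (simp add: cstar_invertible_mult)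
  also have "a * (1 - cinv a * (a - b)) = b"
    using assms(1) by (simp add: right_diff_distrib mult.assoc[symmetric] cinv_props)
  finally show ?thesis .
qed

lemma continuous_on_cinv: "continuous_on {a. cstar_invertible a} cinv"
  unfolding continuous_on_iff
proof (intro ballI allI impI)
  fix a :: 'a and e :: real assume "a \<in> {a. cstar_invertible a}" and e: "0 < e"
  then have a: "cstar_invertible a" by simp
  let ?c = "cinv a"
  have c0: "norm ?c > 0" using cinv_right[OF a] by auto
  \<comment> \<open>The first bound keeps the norm of the nearby inverse below twice that of
    \<open>?c\<close>; the second then makes the difference of the inverses at most
    \<open>e / 2\<close>.\<close>
  define d where "d = min (1 / (2 * norm ?c)) (e / (4 * (norm ?c)\<^sup>2))"
  have d: "d > 0" using c0 e unfolding d_def by simp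
  show "\<exists>d>0. \<forall>x'\<in>{a. cstar_invertible a}. dist x' a < d \<longrightarrow> dist (cinv x') ?c < e"
  proof (intro exI[of _ d] conjI d ballI impI)
    fix b assume "b \<in> {a. cstar_invertible a}" and "dist b a < d"
    then have b: "cstar_invertible b" and ba: "norm (a - b) < d"
      by (auto simp: dist_norm norm_minus_commute)
    have h: "norm (a - b) * norm ?c \<le> 1/2"
    proof -
      have "norm (a - b) * norm ?c \<le> (1 / (2 * norm ?c)) * norm ?c"
        using ba c0 unfolding d_def by (intro mult_right_mono) auto
      then show ?thesis using c0 by simp
    qed
    have eq: "cinv b - ?c = cinv b * (a - b) * ?c"
      using a b by (simp add: algebra_simps cinv_props)
    have n: "norm (cinv b - ?c) \<le> norm (cinv b) * (norm (a - b) * norm ?c)"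
      unfolding eq mult.assoc
      by (rule order_trans[OF norm_mult_ineq mult_left_mono[OF norm_mult_ineq norm_ge_zero]])
    also have "\<dots> \<le> norm (cinv b) * (1/2)" by (rule mult_left_mono[OF h]) simp
    finally have "norm (cinv b) \<le> 2 * norm ?c"
      using norm_triangle_sub[of "cinv b" ?c] by simp
    then have "norm (cinv b - ?c) \<le> (2 * norm ?c) * (norm (a - b) * norm ?c)"
      using n by (meson mult_right_mono norm_ge_zero mult_nonneg_nonneg order_trans)
    also have "\<dots> \<le> (2 * norm ?c) * (e / (4 * (norm ?c)\<^sup>2) * norm ?c)"
      using ba c0 unfolding d_def by (intro mult_left_mono mult_right_mono) auto
    also have "\<dots> < e" using c0 e by (simp add: power2_eq_square)
    finally show "dist (cinv b) ?c < e" by (simp add: dist_norm)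
  qed
qed

section \<open>Elementary properties of the spectrum\<close>

lemma spectrum_iff: "t \<in> cstar_spectrum a \<longleftrightarrow> \<not> cstar_invertible (a - t *\<^sub>C 1)"
  unfolding cstar_spectrum_def by simp

lemma spectrum_norm_bound:
  assumes "t \<in> cstar_spectrum a" shows "cmod t \<le> norm a"
proof (rule ccontr)
  assume *: "\<not> cmod t \<le> norm a"
  then have t: "t \<noteq> 0" by auto
  have "norm ((1/t) *\<^sub>C a) < 1" using * t by (simp add: norm_scaleC norm_divide divide_simps)
  then have "cstar_invertible ((- t) *\<^sub>C (1 - (1/t) *\<^sub>C a))"
    using t by (simp add: cstar_invertible_scaleC_iff cstar_invertible_Neumann del: cvec.scale_minus_left)
  also have "(- t) *\<^sub>C (1 - (1/t) *\<^sub>C a) = a - t *\<^sub>C 1"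
    using t by (simp add: cvec.scale_right_diff_distrib)
  finally show False using assms by (simp add: spectrum_iff)
qed

lemma compact_spectrum: "compact (cstar_spectrum a)"
  unfolding compact_eq_bounded_closed
proof
  show "bounded (cstar_spectrum a)"
    unfolding bounded_iff using spectrum_norm_bound by blast
  have "open (- cstar_spectrum a)"
    unfolding open_dist
  proof
    fix t assume "t \<in> - cstar_spectrum a"
    then have i: "cstar_invertible (a - t *\<^sub>C 1)" by (simp add: spectrum_iff)
    let ?n = "norm (cinv (a - t *\<^sub>C 1))"
    have n0: "?n > 0" using cinv_right[OF i] by auto
    show "\<exists>e>0. \<forall>y. dist y t < e \<longrightarrow> y \<in> - cstar_spectrum a"
    proof (intro exI[of _ "1 / ?n"] conjI allI impI)
      fix y assume "dist y t < 1 / ?n"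
      then have "norm ((a - y *\<^sub>C 1) - (a - t *\<^sub>C 1)) * ?n < 1"
        using n0 by (simp add: cvec.scale_left_diff_distrib[symmetric] norm_scaleC dist_norm
            norm_minus_commute pos_less_divide_eq)
      from cstar_invertible_near[OF i this] show "y \<in> - cstar_spectrum a"
        by (simp add: spectrum_iff)
    qed (use n0 in simp)
  qed
  then show "closed (cstar_spectrum a)" by (simp add: closed_def)
qed

lemma spectrum_shift: "t \<in> cstar_spectrum (a + c *\<^sub>C 1) \<longleftrightarrow> t - c \<in> cstar_spectrum a"
  unfolding spectrum_iff by (simp add: cvec.scale_left_diff_distrib algebra_simps)

lemma spectrum_scaleC:
  assumes "c \<noteq> 0" shows "t \<in> cstar_spectrum (c *\<^sub>C a) \<longleftrightarrow> t / c \<in> cstar_spectrum a"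
proof -
  have "c *\<^sub>C a - t *\<^sub>C 1 = c *\<^sub>C (a - (t / c) *\<^sub>C 1)"
    using assms by (simp add: cvec.scale_right_diff_distrib)
  then show ?thesis using assms by (simp add: spectrum_iff cstar_invertible_scaleC_iff)
qed

lemma spectrum_minus: "t \<in> cstar_spectrum (- a) \<longleftrightarrow> - t \<in> cstar_spectrum a"
  using spectrum_scaleC[of "- 1" t a] by simp

lemma spectrum_similar:
  assumes "s * t = 1" "t * s = 1"
  shows "cstar_spectrum (s * a * t) = cstar_spectrum a"
proof -
  have "s * a * t - z *\<^sub>C 1 = s * (a - z *\<^sub>C 1) * t" for z
    using assms by (simp add: algebra_simps mult_scaleC_left mult_scaleC_right)
  then show ?thesis
    unfolding cstar_spectrum_def by (simp add: cstar_invertible_similar[OF assms])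
qed

lemma spectrum_cinv:
  assumes "cstar_invertible a" "t \<in> cstar_spectrum (cinv a)"
  shows "t \<noteq> 0" "1 / t \<in> cstar_spectrum a"
proof -
  show t: "t \<noteq> 0" using assms cstar_invertible_cinv[OF assms(1)] by (auto simp: spectrum_iff)
  show "1 / t \<in> cstar_spectrum a"
  proof (rule ccontr)
    assume "1 / t \<notin> cstar_spectrum a"
    then have "cstar_invertible (cinv a * ((- t) *\<^sub>C (a - (1 / t) *\<^sub>C 1)))"
      using assms(1) t
      by (intro cstar_invertible_mult cstar_invertible_scaleC cstar_invertible_cinv)
         (auto simp: spectrum_iff)
    also have "cinv a * ((- t) *\<^sub>C (a - (1 / t) *\<^sub>C 1)) = cinv a - t *\<^sub>C 1"
      using t assms(1)
      by (simp add: algebra_simps mult_scaleC_right cinv_props cvec.scale_right_diff_distrib)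
    finally show False using assms(2) by (simp add: spectrum_iff)
  qed
qed

text \<open>Arens' trick: after translation by \<open>\<i> * s\<close>, both the squared modulus of
  the spectral point and the bound for the squared norm contain \<open>s * s\<close>, but the former
  also contains the cross term \<open>2 * Im t * s\<close>. The choice of \<open>s\<close> makes
  that term equal to \<open>(norm a)\<^sup>2 + 1\<close>.\<close>

lemma hermitian_spectrum_real:
  assumes "hermitian a" "t \<in> cstar_spectrum a" shows "Im t = 0"
proof (rule ccontr)
  assume nz: "Im t \<noteq> 0"
  define s where "s = ((norm a)\<^sup>2 + 1) / (2 * Im t)"
  have "t + \<i> * s \<in> cstar_spectrum (a + (\<i> * s) *\<^sub>C 1)"
    using assms(2) by (simp add: spectrum_shift)
  then have "(cmod (t + \<i> * s))\<^sup>2 \<le> (norm (a + (\<i> * s) *\<^sub>C 1))\<^sup>2"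
    by (intro power_mono spectrum_norm_bound) auto
  also have "\<dots> = norm (invol (a + (\<i> * s) *\<^sub>C 1) * (a + (\<i> * s) *\<^sub>C 1))"
    by (simp add: cstar_identity)
  also have "invol (a + (\<i> * s) *\<^sub>C 1) * (a + (\<i> * s) *\<^sub>C 1) = a * a + (of_real (s * s)) *\<^sub>C 1"
    using assms(1) by (simp add: invol_add invol_scaleC algebra_simps mult_scaleC_left
        mult_scaleC_right)
  also have "norm (a * a + (of_real (s * s)) *\<^sub>C 1) \<le> norm a * norm a + s * s"
    by (rule order_trans[OF norm_triangle_ineq] add_mono norm_mult_ineq)+
       (simp add: norm_scaleC norm_mult)
  finally have "(Re t)\<^sup>2 + (Im t)\<^sup>2 + 2 * Im t * s \<le> (norm a)\<^sup>2"
    unfolding cmod_power2 by (simp add: power2_eq_square algebra_simps)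
  moreover have "2 * Im t * s = (norm a)\<^sup>2 + 1" using nz by (simp add: s_def)
  moreover have "0 \<le> (Re t)\<^sup>2 + (Im t)\<^sup>2" by simp
  ultimately show False by linarith
qed

text \<open>The resolvents \<open>F k z = (1 - z a\<^bsup>2^k\<^esup>)\<^sup>-\<^sup>1\<close> satisfy
  \<open>F (k+1) (z\<^sup>2) = (F k z + F k (- z)) / 2\<close>. If \<open>F 0\<close> existed on the whole closed unit disc, its
  uniform continuity would pass to all \<open>F k\<close> and force \<open>a\<^bsup>2^k\<^esup> \<longlonglongrightarrow> 0\<close>.\<close>

lemma hermitian_norm_one_spectrum:
  fixes a :: "'a::unital_cstar_algebra"
  assumes herm: "hermitian a" and n1: "norm a = 1"
  shows "1 \<in> cstar_spectrum a \<or> - 1 \<in> cstar_spectrum a"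
proof (rule ccontr)
  assume *: "\<not> (1 \<in> cstar_spectrum a \<or> - 1 \<in> cstar_spectrum a)"
  define b where "b k = a ^ (2 ^ k)" for k :: nat
  define F where "F k z = cinv (1 - z *\<^sub>C b k)" for k z
  have bS: "b (Suc k) = b k * b k" for k
    by (simp add: b_def power_add[symmetric] mult_2)
  have nb: "norm (b k) = 1" for k
    by (simp add: b_def hermitian_norm_power2[OF herm] n1)
  have inv: "cstar_invertible (1 - z *\<^sub>C b k)" if "cmod z \<le> 1" for z k
    using that
  proof (induction k arbitrary: z)
    case 0
    show ?case
    proof (cases "z = 0")
      case False
      have "1 / z \<notin> cstar_spectrum a"
      proof
        assume s: "1 / z \<in> cstar_spectrum a"
        \<comment> \<open>A spectral point of \<open>a\<close> has modulus at most 1, while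
          \<open>1 / z\<close> has modulus at least 1; being real as well, it can only be 1 or
          -1.\<close>
        have "cmod (1 / z) = 1"
          using spectrum_norm_bound[OF s] n1 False 0 by (auto simp: norm_divide divide_simps)
        moreover have "Im (1 / z) = 0" by (rule hermitian_spectrum_real[OF herm s])
        ultimately have "1 / z = 1 \<or> 1 / z = - 1"
          by (auto simp: cmod_def complex_eq_iff abs_if split: if_splits)
        with s * show False by auto
      qed
      then have "cstar_invertible ((- z) *\<^sub>C (a - (1 / z) *\<^sub>C 1))"
        using False by (intro cstar_invertible_scaleC) (auto simp: spectrum_iff)
      also have "(- z) *\<^sub>C (a - (1 / z) *\<^sub>C 1) = 1 - z *\<^sub>C b 0"
        using False by (simp add: cvec.scale_right_diff_distrib b_def)
      finally show ?thesis .
    qed simp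
  next
    case (Suc k)
    \<comment> \<open>With a square root of z, the element for \<open>Suc k\<close> splits as a
      difference of squares into two elements for \<open>k\<close>.\<close>
    define w where "w = csqrt z"
    have w: "z = w * w" "cmod w \<le> 1"
      using Suc.prems by (simp_all add: w_def power2_eq_square[symmetric])
    have "cstar_invertible ((1 - w *\<^sub>C b k) * (1 - (- w) *\<^sub>C b k))"
      using Suc.IH[of w] Suc.IH[of "- w"] w by (intro cstar_invertible_mult) auto
    also have "(1 - w *\<^sub>C b k) * (1 - (- w) *\<^sub>C b k) = 1 - z *\<^sub>C b (Suc k)"
      by (simp add: w bS algebra_simps mult_scaleC_left mult_scaleC_right)
    finally show ?case .
  qed
  have FS: "F (Suc k) (w * w) = (1/2) *\<^sub>R (F k w + F k (- w))" if w: "cmod w \<le> 1" for w k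
  proof -
    let ?p = "1 - w *\<^sub>C b k" and ?q = "1 - (- w) *\<^sub>C b k"
    have i: "cstar_invertible ?p" "cstar_invertible ?q"
      using inv[of w] inv[of "- w"] w by auto
    have "1 - (w * w) *\<^sub>C b (Suc k) = ?q * ?p"
      by (simp add: bS algebra_simps mult_scaleC_left mult_scaleC_right)
    then have "F (Suc k) (w * w) = cinv ?p * cinv ?q"
      unfolding F_def using i by (simp only: cinv_mult)
    moreover have "cinv ?p + cinv ?q = cinv ?p * (?q + ?p) * cinv ?q"
      unfolding distrib_left distrib_right using i
      by (simp add: cinv_left mult.assoc cinv_right del: cvec.scale_minus_left)
    moreover have "?q + ?p = 2 *\<^sub>R 1" by (simp add: scaleR_2)
    ultimately show ?thesis unfolding F_def by (simp only: mult_scaleR_left mult_scaleR_right) simp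
  qed
  have "continuous_on (cball 0 1) (\<lambda>z. F 0 z)"
    unfolding F_def
    by (rule continuous_on_compose2[OF continuous_on_cinv])
       (auto intro!: continuous_intros cbil.continuous_on inv)
  then have "uniformly_continuous_on (cball 0 1) (F 0)"
    by (rule compact_uniformly_continuous) simp
  then obtain d where d: "d > 0"
    "\<And>z w. z \<in> cball 0 1 \<Longrightarrow> w \<in> cball 0 1 \<Longrightarrow> dist w z < d \<Longrightarrow> dist (F 0 w) (F 0 z) < 1/8"
    unfolding uniformly_continuous_on_def by (metis zero_less_divide_1_iff zero_less_numeral)
  \<comment> \<open>A radius below 1 that is within \<open>d\<close> of the unit circle; the maximum
    with 0 takes care of large \<open>d\<close>.\<close>
  define s where "s = max 0 (1 - d/2)"
  have s: "0 \<le> s" "s < 1" "1 - s < d" using d(1) by (auto simp: s_def)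
  \<comment> \<open>The constant 1/8 does not grow with \<open>k\<close>: squaring carries the
    radius for \<open>k\<close> to the one for \<open>Suc k\<close>, and the doubling rule
    \<open>FS\<close> averages two differences that already obey the bound.\<close>
  have U: "norm (F k u - F k (of_real (s ^ (2 ^ k)) * u)) \<le> 1/8" if "cmod u = 1" for u k
    using that
  proof (induction k arbitrary: u)
    case 0
    have "dist u (s * u) = cmod ((1 - of_real s) * u)" by (simp add: dist_norm algebra_simps)
    also have "\<dots> = 1 - s"
      using s 0 by (simp add: norm_mult) (metis abs_of_pos diff_gt_0_iff_gt norm_of_real of_real_1 of_real_diff)
    finally have "dist (F 0 u) (F 0 (s * u)) < 1/8"
      using s 0 by (intro d(2)) (auto simp: norm_mult)
    then show ?case by (simp add: dist_norm)
  next
    case (Suc k)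
    define w where "w = csqrt u"
    have w: "u = w * w" "cmod w = 1"
      using Suc.prems by (simp_all add: w_def power2_eq_square[symmetric])
    let ?s = "complex_of_real (s ^ (2 ^ k))"
    have s1: "cmod (?s * w) \<le> 1" using s w by (simp add: norm_mult norm_power power_le_one)
    have e: "of_real (s ^ (2 ^ Suc k)) * u = (?s * w) * (?s * w)"
      unfolding w by (simp add: power_add[symmetric] mult_2 mult_ac)
    have "F (Suc k) u - F (Suc k) (of_real (s ^ (2 ^ Suc k)) * u)
        = (1/2) *\<^sub>R ((F k w - F k (?s * w)) + (F k (- w) - F k (?s * (- w))))"
      unfolding e unfolding w(1) using FS[of w k] FS[of "?s * w" k] w(2) s1
      by (simp add: algebra_simps)
    then have "norm (F (Suc k) u - F (Suc k) (of_real (s ^ (2 ^ Suc k)) * u))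
        \<le> (1/2) * (norm (F k w - F k (?s * w)) + norm (F k (- w) - F k (?s * (- w))))"
      using norm_triangle_ineq by simp
    also have "\<dots> \<le> (1/2) * (1/8 + 1/8)"
      using Suc.IH[of w] Suc.IH[of "- w"] w by (intro mult_left_mono add_mono) auto
    finally show ?case by simp
  qed
  have "(\<lambda>k. s ^ (2 ^ k)) \<longlonglongrightarrow> 0"
  proof (rule filterlim_compose[OF LIMSEQ_realpow_zero[OF s(1,2)]])
    show "filterlim (\<lambda>k. 2 ^ k :: nat) sequentially sequentially"
      by (rule filterlim_subseq) (simp add: strict_mono_def)
  qed
  \<comment> \<open>The radii tend to 0 and every \<open>b k\<close> has norm 1, so the inner
    resolvents tend to 1; by \<open>U\<close> the resolvents at the point 1 then come close to 1
    too.\<close>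
  then have "(\<lambda>k. norm (complex_of_real (s ^ (2 ^ k)) *\<^sub>C b k)) \<longlonglongrightarrow> 0"
    using s(1) by (simp add: norm_scaleC nb norm_power)
  then have "(\<lambda>k. complex_of_real (s ^ (2 ^ k)) *\<^sub>C b k) \<longlonglongrightarrow> 0"
    by (rule tendsto_norm_zero_cancel)
  from tendsto_diff[OF tendsto_const[of 1] this]
  have "(\<lambda>k. 1 - complex_of_real (s ^ (2 ^ k)) *\<^sub>C b k) \<longlonglongrightarrow> 1" by simp
  then have "(\<lambda>k. cinv (1 - complex_of_real (s ^ (2 ^ k)) *\<^sub>C b k)) \<longlonglongrightarrow> cinv 1"
  proof (rule continuous_on_tendsto_compose[OF continuous_on_cinv])
    show "\<forall>\<^sub>F k in sequentially. 1 - complex_of_real (s ^ (2 ^ k)) *\<^sub>C b k \<in> {a. cstar_invertible a}"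
      using s by (intro always_eventually) (auto intro!: inv simp: norm_power power_le_one)
  qed simp
  then have "\<forall>\<^sub>F k in sequentially. dist (F k (of_real (s ^ (2 ^ k)))) 1 < 1/8"
    unfolding F_def cinv_one by (rule tendstoD) simp
  then obtain k where k: "norm (F k (of_real (s ^ (2 ^ k))) - 1) < 1/8"
    unfolding dist_norm by (meson eventually_happens trivial_limit_sequentially)
  define G where "G = F k 1"
  have "norm (G - 1) \<le> norm (F k 1 - F k (of_real (s ^ (2 ^ k)))) + norm (F k (of_real (s ^ (2 ^ k))) - 1)"
    unfolding G_def by (rule norm_diff_triangle_le[OF order_refl order_refl])
  also have "\<dots> < 1/4" using k U[of 1 k] by simp
  finally have G1: "norm (G - 1) < 1/4" .
  have "G * (1 - b k) = 1" unfolding G_def F_def using inv[of 1 k] by (simp add: cinv_left)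
  \<comment> \<open>Since \<open>b k\<close> has norm 1, this identity bounds its norm by twice that
    of \<open>G - 1\<close>, hence by less than 1/2.\<close>
  then have "b k = (G - 1) - (G - 1) * b k" by (simp add: algebra_simps)
  then have "norm (b k) \<le> norm (G - 1) + norm ((G - 1) * b k)"
    by (metis norm_triangle_ineq4)
  also have "\<dots> \<le> norm (G - 1) + norm (G - 1)" using norm_mult_ineq[of "G - 1" "b k"] nb by simp
  finally show False using G1 nb[of k] by simp
qed

lemma hermitian_norm_in_spectrum:
  assumes "hermitian a"
  obtains r where "of_real r \<in> cstar_spectrum a" "\<bar>r\<bar> = norm a"
proof (cases "a = 0")
  case True
  then show ?thesis using that[of 0] by (simp add: spectrum_iff)
next
  case False
  let ?c = "1 / norm a"
  have "1 \<in> cstar_spectrum (of_real ?c *\<^sub>C a) \<or> - 1 \<in> cstar_spectrum (of_real ?c *\<^sub>C a)"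
    using False assms by (intro hermitian_norm_one_spectrum) (auto simp: norm_scaleC invol_scaleC norm_divide)
  then have "of_real (norm a) \<in> cstar_spectrum a \<or> of_real (- norm a) \<in> cstar_spectrum a"
    using False by (simp add: spectrum_scaleC)
  then show ?thesis using that[of "norm a"] that[of "- norm a"] by auto
qed


subsection \<open>Positive elements\<close>

definition cstar_le :: "'a::unital_cstar_algebra \<Rightarrow> 'a \<Rightarrow> bool"  (infix "\<preceq>" 50) where
  "x \<preceq> y \<longleftrightarrow> cstar_positive (y - x)"

lemma positive_hermitian: "cstar_positive a \<Longrightarrow> hermitian a"
  by (simp add: cstar_positive_def)

lemma spectrum_real_diff: "t \<in> cstar_spectrum (r *\<^sub>R 1 - a) \<longleftrightarrow> of_real r - t \<in> cstar_spectrum a"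
  using spectrum_shift[of t "- a" "of_real r"] spectrum_minus[of "t - of_real r" a]
  by (simp add: scaleR_conv_scaleC)

lemma spectrum_real_add: "t \<in> cstar_spectrum (r *\<^sub>R 1 + a) \<longleftrightarrow> t - of_real r \<in> cstar_spectrum a"
  using spectrum_shift[of t a "of_real r"] by (simp add: scaleR_conv_scaleC add.commute)

lemma positiveI:
  assumes "hermitian a" "\<And>r. of_real r \<in> cstar_spectrum a \<Longrightarrow> 0 \<le> r"
  shows "cstar_positive a"
  unfolding cstar_positive_def
proof (intro conjI ballI)
  fix t assume t: "t \<in> cstar_spectrum a"
  show im: "Im t = 0" by (rule hermitian_spectrum_real[OF assms(1) t])
  then have "t = of_real (Re t)" by (simp add: complex_eq_iff)
  with t show "0 \<le> Re t" using assms(2)[of "Re t"] by simp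
qed (rule assms(1))

lemma positive_spectrum: "cstar_positive a \<Longrightarrow> of_real r \<in> cstar_spectrum a \<Longrightarrow> 0 \<le> r"
  unfolding cstar_positive_def by force

lemma hermitian_norm_le_iff:
  assumes "hermitian a"
  shows "norm a \<le> s \<longleftrightarrow> cstar_positive (s *\<^sub>R 1 - a) \<and> cstar_positive (s *\<^sub>R 1 + a)"
proof
  assume n: "norm a \<le> s"
  show "cstar_positive (s *\<^sub>R 1 - a) \<and> cstar_positive (s *\<^sub>R 1 + a)"
  proof (intro conjI positiveI)
    fix r assume "of_real r \<in> cstar_spectrum (s *\<^sub>R 1 - a)"
    then have "of_real (s - r) \<in> cstar_spectrum a" by (simp add: spectrum_real_diff)
    from spectrum_norm_bound[OF this] n show "0 \<le> r" unfolding norm_of_real by linarith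
  next
    fix r assume "of_real r \<in> cstar_spectrum (s *\<^sub>R 1 + a)"
    then have "of_real (r - s) \<in> cstar_spectrum a" by (simp add: spectrum_real_add)
    from spectrum_norm_bound[OF this] n show "0 \<le> r" unfolding norm_of_real by linarith
  qed (simp_all add: invol_diff invol_add invol_scaleR assms)
next
  assume *: "cstar_positive (s *\<^sub>R 1 - a) \<and> cstar_positive (s *\<^sub>R 1 + a)"
  obtain r where r: "of_real r \<in> cstar_spectrum a" "\<bar>r\<bar> = norm a"
    by (rule hermitian_norm_in_spectrum[OF assms])
  have "of_real (s - r) \<in> cstar_spectrum (s *\<^sub>R 1 - a)" "of_real (s + r) \<in> cstar_spectrum (s *\<^sub>R 1 + a)"
    using r by (simp_all add: spectrum_real_diff spectrum_real_add)
  then have "0 \<le> s - r" "0 \<le> s + r" using * positive_spectrum by blast+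
  then show "norm a \<le> s" using r by linarith
qed

text \<open>Real spectral points \<open>r\<close> of \<open>a\<close> lie between \<open>- t\<close>
  and \<open>t\<close>, those of \<open>t *\<^sub>R 1 - a\<close> are the numbers
  \<open>t - r\<close>, and \<open>\<bar>t - r\<bar> \<le> t\<close> then means
  \<open>0 \<le> r\<close>. In this form positivity passes to sums by the triangle inequality and to
  limits by continuity of the norm.\<close>

lemma positive_iff_norm:
  assumes "hermitian a" "norm a \<le> t"
  shows "cstar_positive a \<longleftrightarrow> norm (t *\<^sub>R 1 - a) \<le> t"
proof -
  have h: "hermitian (t *\<^sub>R 1 - a)" by (simp add: invol_diff invol_scaleR assms)
  have eq: "t *\<^sub>R 1 - (t *\<^sub>R 1 - a) = a" "t *\<^sub>R 1 + (t *\<^sub>R 1 - a) = t *\<^sub>R 1 + (t *\<^sub>R 1 - a)" by auto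
  show ?thesis
  proof
    assume p: "cstar_positive a"
    obtain r where r: "of_real r \<in> cstar_spectrum (t *\<^sub>R 1 - a)" "\<bar>r\<bar> = norm (t *\<^sub>R 1 - a)"
      by (rule hermitian_norm_in_spectrum[OF h])
    have s: "of_real (t - r) \<in> cstar_spectrum a" using r(1) by (simp add: spectrum_real_diff)
    have "0 \<le> t - r" by (rule positive_spectrum[OF p s])
    moreover have "\<bar>t - r\<bar> \<le> t" using spectrum_norm_bound[OF s] assms(2) unfolding norm_of_real by linarith
    ultimately show "norm (t *\<^sub>R 1 - a) \<le> t" using r(2) by linarith
  next
    assume "norm (t *\<^sub>R 1 - a) \<le> t"
    then show "cstar_positive a" unfolding hermitian_norm_le_iff[OF h] eq(1) by simp
  qed
qed

lemma positive_zero [simp]: "cstar_positive 0"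
  by (subst positive_iff_norm[of _ 0]) auto

lemma positive_add:
  assumes "cstar_positive a" "cstar_positive b" shows "cstar_positive (a + b)"
proof -
  have h: "hermitian a" "hermitian b" using assms positive_hermitian by auto
  have "norm (norm a *\<^sub>R 1 - a) \<le> norm a" "norm (norm b *\<^sub>R 1 - b) \<le> norm b"
    using assms h positive_iff_norm by blast+
  then have "norm ((norm a *\<^sub>R 1 - a) + (norm b *\<^sub>R 1 - b)) \<le> norm a + norm b"
    by (rule norm_triangle_mono)
  also have "(norm a *\<^sub>R 1 - a) + (norm b *\<^sub>R 1 - b) = (norm a + norm b) *\<^sub>R 1 - (a + b)"
    by (simp add: algebra_simps)
  finally show ?thesis
    by (subst positive_iff_norm[of _ "norm a + norm b"]) (simp_all add: invol_add h norm_triangle_ineq)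
qed

lemma positive_scaleR: 
  assumes "cstar_positive a" "0 \<le> r" shows "cstar_positive (r *\<^sub>R a)"
proof (cases "r = 0")
  case False
  then have r: "0 < r" using assms by simp
  show ?thesis
  proof (rule positiveI)
    show "hermitian (r *\<^sub>R a)" by (simp add: invol_scaleR positive_hermitian assms)
    fix t assume "complex_of_real t \<in> cstar_spectrum (r *\<^sub>R a)"
    then have "of_real (t / r) \<in> cstar_spectrum a"
      using r by (simp add: scaleR_conv_scaleC spectrum_scaleC)
    from positive_spectrum[OF assms(1) this] r show "0 \<le> t" by (simp add: zero_le_divide_iff)
  qed
qed simp

lemma positive_sum: "(\<And>i. i \<in> I \<Longrightarrow> cstar_positive (f i)) \<Longrightarrow> cstar_positive (sum f I)"
  by (induction I rule: infinite_finite_induct) (simp_all add: positive_add)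

lemma positive_of_real: "0 \<le> r \<Longrightarrow> cstar_positive (r *\<^sub>R 1)"
  by (subst positive_iff_norm[of _ r]) (auto simp: invol_scaleR)

lemma positive_one: "cstar_positive 1"
  using positive_of_real[of 1] by simp

lemma positive_closed:
  assumes lim: "f \<longlonglongrightarrow> a" and pos: "\<And>n. cstar_positive (f n)"
  shows "cstar_positive a"
proof -
  have h: "hermitian (f n)" for n using pos positive_hermitian by blast
  have ha: "hermitian a"
    using tendsto_invol[OF lim] lim unfolding h by (rule LIMSEQ_unique)
  have 1: "(\<lambda>n. norm (norm (f n) *\<^sub>R 1 - f n)) \<longlonglongrightarrow> norm (norm a *\<^sub>R 1 - a)"
    by (intro tendsto_intros lim)
  have 2: "(\<lambda>n. norm (f n)) \<longlonglongrightarrow> norm a" by (intro tendsto_intros lim)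
  have "norm (norm (f n) *\<^sub>R 1 - f n) \<le> norm (f n)" for n
    using positive_iff_norm[OF h order_refl] pos by blast
  then have "norm (norm a *\<^sub>R 1 - a) \<le> norm a" by (intro LIMSEQ_le[OF 1 2]) auto
  then show ?thesis using positive_iff_norm[OF ha order_refl] by blast
qed

lemma positive_antisym:
  assumes "cstar_positive a" "cstar_positive (- a)" shows "a = 0"
  using hermitian_norm_le_iff[of a 0] assms positive_hermitian by auto

section \<open>The order and the positive definite cone\<close>

lemma positive_norm_le_iff:
  assumes "cstar_positive a" "0 \<le> s" shows "norm a \<le> s \<longleftrightarrow> a \<preceq> s *\<^sub>R 1"
  unfolding hermitian_norm_le_iff[OF positive_hermitian[OF assms(1)]] cstar_le_def
  using assms by (simp add: positive_add positive_of_real)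

lemma cstar_le_refl [simp]: "x \<preceq> x"
  by (simp add: cstar_le_def)

lemma cstar_le_trans: "x \<preceq> y \<Longrightarrow> y \<preceq> z \<Longrightarrow> x \<preceq> z"
  unfolding cstar_le_def using positive_add[of "z - y" "y - x"] by simp

lemma cstar_le_antisym: "x \<preceq> y \<Longrightarrow> y \<preceq> x \<Longrightarrow> x = y"
  unfolding cstar_le_def using positive_antisym[of "y - x"] by simp

lemma cstar_le_scaleR: "x \<preceq> y \<Longrightarrow> 0 \<le> r \<Longrightarrow> r *\<^sub>R x \<preceq> r *\<^sub>R y"
  unfolding cstar_le_def using positive_scaleR[of "y - x" r] by (simp add: scaleR_diff_right)

lemma hermitian_norm_dist_le_iff:
  assumes "hermitian a" "hermitian b"
  shows "norm (a - b) \<le> s \<longleftrightarrow> a \<preceq> b + s *\<^sub>R 1 \<and> b \<preceq> a + s *\<^sub>R 1"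
  using hermitian_norm_le_iff[of "a - b" s] assms
  by (simp add: invol_diff cstar_le_def algebra_simps)

text \<open>No point of modulus less than \<open>1 / norm (cinv a)\<close> lies in the spectrum of
  \<open>a\<close>, by \<open>cstar_invertible_near\<close>; this is the witness \<open>d\<close>.
  The characterization makes the cone visibly upward closed.\<close>

lemma pos_def_cone_iff:
  "a \<in> pos_def_cone \<longleftrightarrow> (\<exists>d>0. d *\<^sub>R 1 \<preceq> a)"
proof
  assume a: "a \<in> pos_def_cone"
  then have p: "cstar_positive a" and i: "cstar_invertible a" by (auto simp: pos_def_cone_def)
  have n0: "norm (cinv a) > 0" using cinv_right[OF i] by auto
  define d where "d = 1 / norm (cinv a)"
  have "cstar_positive (a - d *\<^sub>R 1)"
  proof (rule positiveI)
    show "hermitian (a - d *\<^sub>R 1)" by (simp add: invol_diff invol_scaleR positive_hermitian[OF p])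
    fix r assume "of_real r \<in> cstar_spectrum (a - d *\<^sub>R 1)"
    then have s: "of_real (r + d) \<in> cstar_spectrum a"
      using spectrum_real_add[of "of_real r" "- d" a] by simp
    show "0 \<le> r"
    proof (rule ccontr)
      assume "\<not> 0 \<le> r"
      then have "\<bar>r + d\<bar> < d" using positive_spectrum[OF p s] by linarith
      then have "norm ((a - of_real (r + d) *\<^sub>C 1) - a) * norm (cinv a) < 1"
        using n0 by (simp add: norm_scaleC d_def pos_less_divide_eq del: of_real_add)
      from cstar_invertible_near[OF i this] s show False by (simp add: spectrum_iff)
    qed
  qed
  moreover have "d > 0" using n0 by (simp add: d_def)
  ultimately show "\<exists>d>0. d *\<^sub>R 1 \<preceq> a" unfolding cstar_le_def by blast
next
  assume "\<exists>d>0. d *\<^sub>R 1 \<preceq> a"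
  then obtain d where d: "d > 0" and p: "cstar_positive (a - d *\<^sub>R 1)" unfolding cstar_le_def by blast
  have "cstar_positive a" using positive_add[OF p positive_of_real[of d]] d by simp
  moreover have "cstar_invertible a"
  proof (rule ccontr)
    assume "\<not> cstar_invertible a"
    then have "of_real (- d) \<in> cstar_spectrum (a - d *\<^sub>R 1)" by (simp add: spectrum_iff scaleR_conv_scaleC)
    from positive_spectrum[OF p this] d show False by simp
  qed
  ultimately show "a \<in> pos_def_cone" by (simp add: pos_def_cone_def)
qed

lemma cone_positive: "a \<in> pos_def_cone \<Longrightarrow> cstar_positive a"
  and cone_invertible: "a \<in> pos_def_cone \<Longrightarrow> cstar_invertible a"
  and cone_hermitian: "a \<in> pos_def_cone \<Longrightarrow> hermitian a"
  and coneI: "cstar_positive a \<Longrightarrow> cstar_invertible a \<Longrightarrow> a \<in> pos_def_cone"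
  by (simp_all add: pos_def_cone_def cstar_positive_def)

lemma cone_mono: "a \<in> pos_def_cone \<Longrightarrow> a \<preceq> b \<Longrightarrow> b \<in> pos_def_cone"
  unfolding pos_def_cone_iff using cstar_le_trans by blast

lemma cone_add_positive:
  "cstar_positive a \<Longrightarrow> b \<in> pos_def_cone \<Longrightarrow> a + b \<in> pos_def_cone"
  by (rule cone_mono[of b "a + b"]) (simp_all add: cstar_le_def)

lemma cone_one [simp]: "1 \<in> pos_def_cone"
  by (simp add: coneI positive_one)

lemma cone_scaleR:
  assumes "a \<in> pos_def_cone" "0 < r" shows "r *\<^sub>R a \<in> pos_def_cone"
  using assms by (intro coneI positive_scaleR)
    (simp_all add: cone_positive cone_invertible scaleR_conv_scaleC cstar_invertible_scaleC)

lemma cone_cinv: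
  assumes "a \<in> pos_def_cone" shows "cinv a \<in> pos_def_cone"
proof (intro coneI positiveI)
  show "hermitian (cinv a)"
    using invol_cinv(2)[of a] assms by (simp add: cone_invertible cone_hermitian)
  fix r assume r: "complex_of_real r \<in> cstar_spectrum (cinv a)"
  have "of_real (1 / r) \<in> cstar_spectrum a"
    using spectrum_cinv(2)[OF cone_invertible[OF assms] r] by simp
  from positive_spectrum[OF cone_positive[OF assms] this] show "0 \<le> r" by simp
qed (simp add: assms cone_invertible cstar_invertible_cinv)

lemma hermitian_plus_imaginary_invertible:
  assumes "hermitian c" "m \<noteq> 0" shows "cstar_invertible (c + (\<i> * of_real m) *\<^sub>C 1)"
proof (rule ccontr)
  assume "\<not> ?thesis"
  then have "- (\<i> * of_real m) \<in> cstar_spectrum c" by (simp add: spectrum_iff)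
  from hermitian_spectrum_real[OF assms(1) this] assms(2) show False by simp
qed

text \<open>For a negative \<open>r = - m * m\<close>, the element \<open>c * c - r\<close> factors
  into \<open>c + \<i> m\<close> and \<open>c - \<i> m\<close>, both invertible because the spectrum
  of \<open>c\<close> is real.\<close>

lemma positive_square:
  assumes "hermitian c" shows "cstar_positive (c * c)"
proof (rule positiveI)
  fix r assume r: "complex_of_real r \<in> cstar_spectrum (c * c)"
  show "0 \<le> r"
  proof (rule ccontr)
    assume "\<not> 0 \<le> r"
    define m where "m = sqrt (- r)"
    have m: "m * m = - r" "m \<noteq> 0" using \<open>\<not> 0 \<le> r\<close> by (auto simp: m_def)
    have "cstar_invertible ((c + (\<i> * of_real m) *\<^sub>C 1) * (c + (\<i> * of_real (- m)) *\<^sub>C 1))"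
      using assms m by (intro cstar_invertible_mult hermitian_plus_imaginary_invertible) auto
    also have "(c + (\<i> * of_real m) *\<^sub>C 1) * (c + (\<i> * of_real (- m)) *\<^sub>C 1)
        = c * c + of_real (m * m) *\<^sub>C 1"
      by (simp add: algebra_simps mult_scaleC_left mult_scaleC_right)
    finally show False using r m(1) by (simp add: spectrum_iff)
  qed
qed (simp add: assms invol_mult)

text \<open>The perturbation \<open>c + i\<epsilon>\<close> of \<open>c\<close> is invertible, so no general theorem on
  the positivity of \<open>x\<^sup>* x\<close> is required.\<close>

lemma positive_congruence:
  assumes c: "hermitian c" and P: "cstar_positive P" shows "cstar_positive (c * P * c)"
proof (rule positive_closed)
  define C where "C e = c + (\<i> * complex_of_real e) *\<^sub>C 1" for e
  let ?f = "\<lambda>n. C (1 / real (Suc n)) * P * C (- (1 / real (Suc n)))"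
  have 0: "(\<lambda>n. 1 / real (Suc n)) \<longlonglongrightarrow> 0" by (rule LIMSEQ_Suc) (rule lim_1_over_n)
  have "?f \<longlonglongrightarrow> (c + (\<i> * complex_of_real 0) *\<^sub>C 1) * P * (c + (\<i> * complex_of_real (- 0)) *\<^sub>C 1)"
    unfolding C_def by (intro tendsto_intros cbil.tendsto 0)
  then show "?f \<longlonglongrightarrow> c * P * c" by simp
  fix n
  define e where "e = 1 / real (Suc n)"
  have e: "e > 0" by (simp add: e_def)
  have i: "cstar_invertible (C e)" "cstar_invertible (C (- e))"
    using e hermitian_plus_imaginary_invertible[OF c, of e] hermitian_plus_imaginary_invertible[OF c, of "- e"]
    by (simp_all add: C_def)
  have inv: "invol (C r) = C (- r)" for r by (simp add: C_def invol_add invol_scaleC c)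
  have "C (- e) * C e = c * c + (e * e) *\<^sub>R 1"
    by (simp add: C_def algebra_simps mult_scaleC_left mult_scaleC_right scaleR_conv_scaleC)
  then have "C (- e) * C e \<in> pos_def_cone"
    using cone_add_positive[OF positive_square[OF c] cone_scaleR[OF cone_one]] e by simp
  then have N: "cinv (C (- e) * C e) \<in> pos_def_cone" by (rule cone_cinv)
  show "cstar_positive (?f n)"
    unfolding e_def[symmetric]
  proof (rule positiveI)
    show "hermitian (C e * P * C (- e))"
      by (simp add: invol_mult inv positive_hermitian[OF P] mult.assoc)
    fix r assume r: "complex_of_real r \<in> cstar_spectrum (C e * P * C (- e))"
    show "0 \<le> r"
    proof (rule ccontr)
      assume "\<not> 0 \<le> r"
      \<comment> \<open>Under the congruence with \<open>C e\<close> and \<open>C (- e)\<close>, the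
        inverse of \<open>C (- e) * C e\<close> becomes 1. Hence \<open>- r\<close> can be moved
        inside, where it makes \<open>P\<close> positive definite and so invertible.\<close>
      then have "P + (- r) *\<^sub>R cinv (C (- e) * C e) \<in> pos_def_cone"
        by (intro cone_add_positive P cone_scaleR N) simp
      then have "cstar_invertible (C e * (P + (- r) *\<^sub>R cinv (C (- e) * C e)) * C (- e))"
        using i by (simp add: cstar_invertible_mult cone_invertible)
      also have "C e * (P + (- r) *\<^sub>R cinv (C (- e) * C e)) * C (- e) = C e * P * C (- e) - r *\<^sub>R 1"
      proof -
        have "C e * (cinv (C e) * cinv (C (- e))) * C (- e) = 1"
          using i by (simp add: mult.assoc[symmetric] cinv_right) (simp add: cinv_left)
        then show ?thesis using i
          by (simp add: cinv_mult right_diff_distrib left_diff_distrib)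
      qed
      finally show False using r by (simp add: spectrum_iff scaleR_conv_scaleC)
    qed
  qed
qed

lemma cstar_le_congruence: "x \<preceq> y \<Longrightarrow> hermitian c \<Longrightarrow> c * x * c \<preceq> c * y * c"
  unfolding cstar_le_def using positive_congruence[of c "y - x"] by (simp add: algebra_simps)

lemma cone_congruence:
  "x \<in> pos_def_cone \<Longrightarrow> hermitian c \<Longrightarrow> cstar_invertible c \<Longrightarrow> c * x * c \<in> pos_def_cone"
  by (intro coneI positive_congruence cstar_invertible_mult) (simp_all add: cone_positive cone_invertible)


subsection \<open>Polynomials in an algebra element\<close>

definition apoly :: "complex poly \<Rightarrow> 'a::unital_cstar_algebra \<Rightarrow> 'a" where
  "apoly p a = fold_coeffs (\<lambda>c r. c *\<^sub>C 1 + a * r) p 0"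

lemma apoly_0 [simp]: "apoly 0 a = 0"
  by (simp add: apoly_def)

lemma apoly_pCons [simp]: "apoly (pCons c p) a = c *\<^sub>C 1 + a * apoly p a"
  by (cases "p = 0 \<and> c = 0") (auto simp: apoly_def)

lemma apoly_add: "apoly (p + q) a = apoly p a + apoly q a"
  by (induction p q rule: poly_induct2) (simp_all add: scaleC_add_left algebra_simps)

lemma apoly_smult: "apoly (smult c p) a = c *\<^sub>C apoly p a"
  by (induction p) (simp_all add: scaleC_add_right mult_scaleC_right)

lemma apoly_diff: "apoly (p - q) a = apoly p a - apoly q a"
  using apoly_add[of p "smult (-1) q" a] apoly_smult[of "-1" q a] by simp

lemma apoly_mult: "apoly (p * q) a = apoly p a * apoly q a"
  by (induction p) (simp_all add: apoly_add apoly_smult algebra_simps mult_scaleC_left)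

lemma apoly_commute: "apoly p a * apoly q a = apoly q a * apoly p a"
  by (simp add: apoly_mult[symmetric] mult.commute)

lemma invol_apoly:
  assumes "hermitian a" shows "invol (apoly p a) = apoly (map_poly cnj p) a"
proof (induction p)
  case (pCons c p)
  have "invol (apoly (pCons c p) a) = cnj c *\<^sub>C 1 + apoly (map_poly cnj p) a * apoly [:0, 1:] a"
    by (simp add: invol_add invol_scaleC invol_mult assms pCons.IH)
  also have "\<dots> = cnj c *\<^sub>C 1 + a * apoly (map_poly cnj p) a"
    by (subst apoly_commute) simp
  finally show ?case by (simp add: map_poly_pCons)
qed simp

text \<open>Over the complex numbers \<open>p\<close> splits into linear factors, and a product of
  invertible elements is invertible; so some factor \<open>a - z *\<^sub>C 1\<close> with
  \<open>z\<close> a root of \<open>p\<close> fails to be invertible.\<close>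

lemma apoly_not_invertible:
  assumes "p \<noteq> 0" "\<not> cstar_invertible (apoly p a)"
  shows "\<exists>z \<in> cstar_spectrum a. poly p z = 0"
  using assms
proof (induction "degree p" arbitrary: p rule: less_induct)
  case less
  have "degree p \<noteq> 0"
  proof
    assume "degree p = 0"
    then obtain c where p: "p = [:c:]" by (rule degree_eq_zeroE)
    with less.prems show False by (simp add: cstar_invertible_scaleC)
  qed
  then have "\<not> constant (poly p)" by (simp add: constant_degree)
  then obtain z where z: "poly p z = 0" using fundamental_theorem_of_algebra by blast
  then obtain q where q: "p = [:- z, 1:] * q" by (auto simp: poly_eq_0_iff_dvd elim: dvdE)
  have q0: "q \<noteq> 0" using q less.prems by auto
  have "apoly p a = (a - z *\<^sub>C 1) * apoly q a"
    unfolding q apoly_mult by simp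
  then consider "\<not> cstar_invertible (a - z *\<^sub>C 1)" | "\<not> cstar_invertible (apoly q a)"
    using less.prems cstar_invertible_mult by metis
  then show ?case
  proof cases
    case 1
    then show ?thesis using z by (auto simp: spectrum_iff)
  next
    case 2
    have "degree q < degree p" unfolding q by (subst degree_mult_eq) (use q0 in auto)
    from less.hyps[OF this q0 2] show ?thesis unfolding q by auto
  qed
qed

lemma hermitian_spectrum_nonempty: "hermitian a \<Longrightarrow> cstar_spectrum a \<noteq> {}"
  using hermitian_norm_in_spectrum[of a] by blast

lemma spectrum_apoly_D:
  assumes "hermitian a" "t \<in> cstar_spectrum (apoly p a)"
  shows "\<exists>z \<in> cstar_spectrum a. poly p z = t"
proof (cases "p = [:t:]")
  \<comment> \<open>Here \<open>p - [:t:]\<close> is the zero polynomial, which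
    \<open>apoly_not_invertible\<close> excludes; the claim reduces to the spectrum being
    nonempty.\<close>
  case True
  then show ?thesis using hermitian_spectrum_nonempty[OF assms(1)] by auto
next
  case False
  then have "\<exists>z \<in> cstar_spectrum a. poly (p - [:t:]) z = 0"
    using assms(2) by (intro apoly_not_invertible) (auto simp: spectrum_iff apoly_diff)
  then show ?thesis by auto
qed

lemma spectrum_apoly_I:
  assumes "z \<in> cstar_spectrum a" shows "poly p z \<in> cstar_spectrum (apoly p a)"
proof -
  have "poly (p - [:poly p z:]) z = 0" by simp
  then obtain q where q: "p - [:poly p z:] = [:- z, 1:] * q"
    unfolding poly_eq_0_iff_dvd by (elim dvdE)
  have e: "apoly p a - poly p z *\<^sub>C 1 = apoly [:- z, 1:] a * apoly q a"
    using arg_cong[OF q, of "\<lambda>p. apoly p a"] by (simp only: apoly_mult) (simp add: apoly_diff)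
  have "\<not> cstar_invertible (apoly [:- z, 1:] a)" using assms by (simp add: spectrum_iff)
  then have "\<not> cstar_invertible (apoly p a - poly p z *\<^sub>C 1)"
    unfolding e using cstar_invertible_commuting_factor[OF apoly_commute] by blast
  then show ?thesis by (simp add: spectrum_iff)
qed

text \<open>The C*-identity replaces \<open>apoly p a\<close> by the hermitian element
  \<open>apoly ?q a\<close>, whose norm is attained on the spectrum; on the real spectrum of
  \<open>a\<close> the polynomial \<open>?q\<close> is the squared modulus of
  \<open>p\<close>.\<close>

lemma norm_apoly:
  assumes "hermitian a"
  obtains z where "z \<in> cstar_spectrum a" "norm (apoly p a) = cmod (poly p z)"
proof -
  let ?q = "map_poly cnj p * p"
  have e: "invol (apoly p a) * apoly p a = apoly ?q a" by (simp add: invol_apoly assms apoly_mult)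
  have h: "hermitian (apoly ?q a)" unfolding e[symmetric] by (simp add: invol_mult invol_invol)
  obtain r where r: "of_real r \<in> cstar_spectrum (apoly ?q a)" "\<bar>r\<bar> = norm (apoly ?q a)"
    by (rule hermitian_norm_in_spectrum[OF h])
  obtain z where z: "z \<in> cstar_spectrum a" "poly ?q z = of_real r"
    using spectrum_apoly_D[OF assms r(1)] by blast
  have "cnj z = z" using hermitian_spectrum_real[OF assms z(1)] by (simp add: complex_eq_iff)
  then have "poly ?q z = cnj (poly p z) * poly p z" using poly_cnj[of p z] by simp
  then have "\<bar>r\<bar> = (cmod (poly p z))\<^sup>2"
    using z(2) by (metis complex_mod_cnj norm_mult norm_of_real power2_eq_square)
  also have "\<bar>r\<bar> = (norm (apoly p a))\<^sup>2" by (simp add: r(2) e[symmetric] cstar_identity)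
  finally show ?thesis using that[OF z(1)] by (simp add: power2_eq_iff_nonneg)
qed

text \<open>As \<open>K\<close> lies on the real axis, the real Stone-Weierstrass theorem applies to
  the real and the imaginary part of \<open>f\<close>, each within \<open>e / 2\<close>.\<close>

lemma complex_poly_approx:
  fixes f :: "complex \<Rightarrow> complex"
  assumes K: "compact K" "\<And>t. t \<in> K \<Longrightarrow> Im t = 0" and f: "continuous_on K f" and e: "e > 0"
  shows "\<exists>p. \<forall>t\<in>K. cmod (poly p t - f t) \<le> e"
proof -
  have key: "\<exists>p. \<forall>t\<in>K. cmod (poly p t - of_real (g t)) \<le> e / 2"
    if g: "continuous_on K g" for g :: "complex \<Rightarrow> real"
  proof -
    have rt: "t \<in> K \<Longrightarrow> of_real (Re t) = t" for t using K(2) by (simp add: complex_eq_iff)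
    have c: "compact (Re ` K)" by (rule compact_continuous_image[OF _ K(1)]) (intro continuous_intros)
    have sub: "complex_of_real ` (Re ` K) \<subseteq> K" using rt by auto
    have "continuous_on (Re ` K) (\<lambda>s. g (of_real s))"
      by (rule continuous_on_compose2[OF g _ sub]) (intro continuous_intros)
    then obtain h where h: "real_polynomial_function h"
      "\<And>x. x \<in> Re ` K \<Longrightarrow> \<bar>g (of_real x) - h x\<bar> < e / 2"
      using Stone_Weierstrass_real_polynomial_function[OF c] e by (metis half_gt_zero)
    obtain a n where hs: "h = (\<lambda>x. \<Sum>i\<le>n. a i * x ^ i)"
      using h(1) real_polynomial_function_iff_sum by blast
    let ?p = "\<Sum>i\<le>n. monom (complex_of_real (a i)) i"
    have "cmod (poly ?p t - of_real (g t)) \<le> e / 2" if t: "t \<in> K" for t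
    proof -
      have "poly ?p t = of_real (h (Re t))"
        by (subst rt[OF t, symmetric]) (simp add: hs poly_sum poly_monom)
      then have "cmod (poly ?p t - of_real (g t)) = \<bar>h (Re t) - g t\<bar>"
        by (metis norm_of_real of_real_diff)
      then show ?thesis using h(2)[of "Re t"] t rt[OF t] by (simp add: abs_minus_commute)
    qed
    then show ?thesis by blast
  qed
  obtain p where p: "\<forall>t\<in>K. cmod (poly p t - of_real (Re (f t))) \<le> e / 2"
    using key[of "\<lambda>t. Re (f t)"] f by (auto intro: continuous_intros)
  obtain q where q: "\<forall>t\<in>K. cmod (poly q t - of_real (Im (f t))) \<le> e / 2"
    using key[of "\<lambda>t. Im (f t)"] f by (auto intro: continuous_intros)
  show ?thesis
  proof (intro exI[of _ "p + smult \<i> q"] ballI)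
    fix t assume t: "t \<in> K"
    have "poly (p + smult \<i> q) t - f t
        = (poly p t - of_real (Re (f t))) + \<i> * (poly q t - of_real (Im (f t)))"
      by (subst complex_eq[of "f t"]) (simp add: algebra_simps)
    also have "cmod \<dots> \<le> e / 2 + e / 2"
      using p q t by (intro norm_triangle_mono) (simp_all add: norm_mult)
    finally show "cmod (poly (p + smult \<i> q) t - f t) \<le> e" by simp
  qed
qed


subsection \<open>Functional calculus of a hermitian element\<close>

text \<open>The graph of the functional calculus. As a relation it allows sums, products and
  adjoints to be formed by limits of polynomials, separately from existence and uniqueness of the
  value.\<close>

definition fc_value :: "'a::unital_cstar_algebra \<Rightarrow> (complex \<Rightarrow> complex) \<Rightarrow> 'a \<Rightarrow> bool" where
  "fc_value a f b \<longleftrightarrow> (\<exists>P. uniform_limit (cstar_spectrum a) (\<lambda>n. poly (P n)) f sequentially \<and>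
     (\<lambda>n. apoly (P n) a) \<longlonglongrightarrow> b)"

text \<open>By \<open>norm_apoly\<close>, the approximating polynomials differ in the algebra by no
  more than on the spectrum. With \<open>m = 0\<close> this is uniqueness of the value.\<close>

lemma fc_value_norm_diff:
  assumes a: "hermitian a" and V: "fc_value a f b" "fc_value a g c"
    and m: "\<And>t. t \<in> cstar_spectrum a \<Longrightarrow> cmod (f t - g t) \<le> m"
  shows "norm (b - c) \<le> m"
proof (rule field_le_epsilon)
  fix e :: real assume e: "0 < e"
  from V obtain P Q where
    P: "uniform_limit (cstar_spectrum a) (\<lambda>n. poly (P n)) f sequentially" "(\<lambda>n. apoly (P n) a) \<longlonglongrightarrow> b" and
    Q: "uniform_limit (cstar_spectrum a) (\<lambda>n. poly (Q n)) g sequentially" "(\<lambda>n. apoly (Q n) a) \<longlonglongrightarrow> c"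
    unfolding fc_value_def by auto
  have lim: "(\<lambda>n. norm (apoly (P n - Q n) a)) \<longlonglongrightarrow> norm (b - c)"
    unfolding apoly_diff by (intro tendsto_intros P Q)
  have "\<forall>\<^sub>F n in sequentially. norm (apoly (P n - Q n) a) \<le> m + e"
    using uniform_limitD[OF P(1) half_gt_zero[OF e]] uniform_limitD[OF Q(1) half_gt_zero[OF e]]
  proof eventually_elim
    case (elim n)
    obtain z where z: "z \<in> cstar_spectrum a" "norm (apoly (P n - Q n) a) = cmod (poly (P n - Q n) z)"
      by (rule norm_apoly[OF a])
    have "poly (P n - Q n) z = (poly (P n) z - f z) + (f z - g z) + (g z - poly (Q n) z)" by simp
    also have "cmod \<dots> \<le> e / 2 + m + e / 2"
      using elim z(1) m by (intro norm_triangle_mono)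
        (auto simp: dist_norm norm_minus_commute intro: less_imp_le)
    finally show ?case using z(2) by simp
  qed
  from tendsto_upperbound[OF lim this] show "norm (b - c) \<le> m + e" by simp
qed

lemma fc_value_exists:
  assumes a: "hermitian a" and f: "continuous_on (cstar_spectrum a) f"
  shows "\<exists>b. fc_value a f b"
proof -
  have "\<exists>p. \<forall>t\<in>cstar_spectrum a. cmod (poly p t - f t) \<le> 1 / real (Suc n)" for n
    by (rule complex_poly_approx[OF compact_spectrum hermitian_spectrum_real[OF a] f]) simp_all
  then obtain P where P: "\<And>n t. t \<in> cstar_spectrum a \<Longrightarrow> cmod (poly (P n) t - f t) \<le> 1 / real (Suc n)"
    by metis
  have 0: "(\<lambda>n. 1 / real (Suc n)) \<longlonglongrightarrow> 0" by (rule LIMSEQ_Suc) (rule lim_1_over_n)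
  have u: "uniform_limit (cstar_spectrum a) (\<lambda>n. poly (P n)) f sequentially"
  proof (rule uniform_limitI)
    fix e :: real assume "e > 0"
    then have "\<forall>\<^sub>F n in sequentially. 1 / real (Suc n) < e" by (rule order_tendstoD(2)[OF 0])
    then show "\<forall>\<^sub>F n in sequentially. \<forall>t\<in>cstar_spectrum a. dist (poly (P n) t) (f t) < e"
      by eventually_elim (use P in \<open>auto simp: dist_norm intro: le_less_trans\<close>)
  qed
  have "Cauchy (\<lambda>n. apoly (P n) a)"
  proof (rule metric_CauchyI)
    fix e :: real assume e: "e > 0"
    then have "\<forall>\<^sub>F n in sequentially. 1 / real (Suc n) < e / 2" by (intro order_tendstoD(2)[OF 0]) simp
    then obtain N where N: "\<And>n. n \<ge> N \<Longrightarrow> 1 / real (Suc n) < e / 2"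
      unfolding eventually_sequentially by blast
    show "\<exists>M. \<forall>m\<ge>M. \<forall>n\<ge>M. dist (apoly (P m) a) (apoly (P n) a) < e"
    proof (intro exI[of _ N] allI impI)
      fix m n assume mn: "m \<ge> N" "n \<ge> N"
      obtain z where z: "z \<in> cstar_spectrum a" "norm (apoly (P m - P n) a) = cmod (poly (P m - P n) z)"
        by (rule norm_apoly[OF a])
      have "poly (P m - P n) z = (poly (P m) z - f z) - (poly (P n) z - f z)" by simp
      also have "cmod \<dots> \<le> 1 / real (Suc m) + 1 / real (Suc n)"
        using norm_triangle_ineq4 P[OF z(1)] by (meson add_mono order_trans)
      also have "\<dots> < e" using N[OF mn(1)] N[OF mn(2)] by linarith
      finally show "dist (apoly (P m) a) (apoly (P n) a) < e"
        using z(2) by (simp add: dist_norm apoly_diff)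
    qed
  qed
  then show ?thesis using u unfolding fc_value_def by (auto simp: Cauchy_convergent_iff convergent_def)
qed

lemma fc_value_unique: "hermitian a \<Longrightarrow> fc_value a f b \<Longrightarrow> fc_value a f c \<Longrightarrow> b = c"
  using fc_value_norm_diff[of a f b f c 0] by simp

lemma fc_value_cong:
  "(\<And>t. t \<in> cstar_spectrum a \<Longrightarrow> f t = g t) \<Longrightarrow> fc_value a f b \<longleftrightarrow> fc_value a g b"
  unfolding fc_value_def by (simp cong: uniform_limit_cong')

lemma fc_value_apoly: "fc_value a (poly p) (apoly p a)"
  unfolding fc_value_def by (intro exI[of _ "\<lambda>_. p"]) (simp add: uniform_limit_const)

lemma fc_value_add:
  "fc_value a f b \<Longrightarrow> fc_value a g c \<Longrightarrow> fc_value a (\<lambda>t. f t + g t) (b + c)"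
  unfolding fc_value_def
  by (elim exE conjE, rule_tac x = "\<lambda>n. P n + Pa n" in exI)
     (auto simp: apoly_add poly_add[abs_def] intro!: tendsto_intros uniform_limit_intros)

lemma fc_value_scaleC: "fc_value a f b \<Longrightarrow> fc_value a (\<lambda>t. c * f t) (c *\<^sub>C b)"
  unfolding fc_value_def
  by (elim exE conjE, rule_tac x = "\<lambda>n. smult c (P n)" in exI)
     (auto simp: apoly_smult poly_smult[abs_def] intro!: cbil.tendsto[OF tendsto_const] uniform_limit_intros)

lemma fc_value_mult:
  assumes "continuous_on (cstar_spectrum a) f" "continuous_on (cstar_spectrum a) g"
    and "fc_value a f b" "fc_value a g c"
  shows "fc_value a (\<lambda>t. f t * g t) (b * c)"
proof -
  have b: "bounded (f ` cstar_spectrum a)" "bounded (g ` cstar_spectrum a)"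
    using assms(1,2) compact_spectrum by (auto intro: compact_imp_bounded compact_continuous_image)
  from assms obtain P Q where
    P: "uniform_limit (cstar_spectrum a) (\<lambda>n. poly (P n)) f sequentially" "(\<lambda>n. apoly (P n) a) \<longlonglongrightarrow> b" and
    Q: "uniform_limit (cstar_spectrum a) (\<lambda>n. poly (Q n)) g sequentially" "(\<lambda>n. apoly (Q n) a) \<longlonglongrightarrow> c"
    unfolding fc_value_def by auto
  have "uniform_limit (cstar_spectrum a) (\<lambda>n. poly (P n * Q n)) (\<lambda>t. f t * g t) sequentially"
    using uniform_lim_mult[OF P(1) Q(1) b] by (simp add: poly_mult[abs_def])
  moreover have "(\<lambda>n. apoly (P n * Q n) a) \<longlonglongrightarrow> b * c"
    unfolding apoly_mult by (intro tendsto_intros P Q)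
  ultimately show ?thesis unfolding fc_value_def by (intro exI[of _ "\<lambda>n. P n * Q n"]) simp
qed

lemma fc_value_cnj:
  assumes a: "hermitian a" and "fc_value a f b"
  shows "fc_value a (\<lambda>t. cnj (f t)) (invol b)"
proof -
  from assms(2) obtain P where
    P: "uniform_limit (cstar_spectrum a) (\<lambda>n. poly (P n)) f sequentially" "(\<lambda>n. apoly (P n) a) \<longlonglongrightarrow> b"
    unfolding fc_value_def by auto
  have e: "poly (map_poly cnj (P n)) t = cnj (poly (P n) t)" if "t \<in> cstar_spectrum a" for n t
  proof -
    have "cnj t = t" using hermitian_spectrum_real[OF a that] by (simp add: complex_eq_iff)
    then show ?thesis using poly_cnj[of "P n" t] by simp
  qed
  have "uniform_limit (cstar_spectrum a) (\<lambda>n. poly (map_poly cnj (P n))) (\<lambda>t. cnj (f t)) sequentially"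
  proof (rule uniform_limitI)
    fix r :: real assume "r > 0"
    from uniform_limitD[OF P(1) this]
    show "\<forall>\<^sub>F n in sequentially. \<forall>t\<in>cstar_spectrum a. dist (poly (map_poly cnj (P n)) t) (cnj (f t)) < r"
      by eventually_elim (auto simp only: e dist_norm complex_cnj_diff[symmetric] complex_mod_cnj)
  qed
  moreover have "(\<lambda>n. apoly (map_poly cnj (P n)) a) \<longlonglongrightarrow> invol b"
    unfolding invol_apoly[OF a, symmetric] by (intro tendsto_invol P)
  ultimately show ?thesis unfolding fc_value_def by (intro exI[of _ "\<lambda>n. map_poly cnj (P n)"]) simp
qed

lemma functional_calculus_exists:
  assumes a: "hermitian a" shows "\<exists>\<Phi>. is_functional_calculus a \<Phi>"
proof (intro exI)
  let ?K = "cstar_spectrum a"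
  define \<Phi> where "\<Phi> f = (THE b. fc_value a f b)" for f
  have eq: "\<Phi> f = b" if "fc_value a f b" for f b
    unfolding \<Phi>_def using that fc_value_unique[OF a] by blast
  have V: "fc_value a f (\<Phi> f)" if "continuous_on ?K f" for f
    using fc_value_exists[OF a that] eq by auto
  show "is_functional_calculus a \<Phi>"
    unfolding is_functional_calculus_def
  proof (intro conjI allI impI)
    fix f g :: "complex \<Rightarrow> complex" assume f: "continuous_on ?K f" and "\<forall>t\<in>?K. f t = g t"
    then show "\<Phi> f = \<Phi> g" using V[OF f] fc_value_cong[of a f g] eq by metis
  next
    fix f g :: "complex \<Rightarrow> complex" assume fg: "continuous_on ?K f" "continuous_on ?K g"
    show "\<Phi> (\<lambda>t. f t + g t) = \<Phi> f + \<Phi> g" by (intro eq fc_value_add V fg)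
    show "\<Phi> (\<lambda>t. f t * g t) = \<Phi> f * \<Phi> g" by (intro eq fc_value_mult V fg)
  next
    fix c and f :: "complex \<Rightarrow> complex" assume f: "continuous_on ?K f"
    show "\<Phi> (\<lambda>t. c * f t) = c *\<^sub>C \<Phi> f" by (intro eq fc_value_scaleC V f)
    show "\<Phi> (\<lambda>t. cnj (f t)) = invol (\<Phi> f)" by (intro eq fc_value_cnj V f a)
  next
    show "\<Phi> (\<lambda>t. 1) = 1" using eq[OF fc_value_apoly[of a "[:1:]"]] by (simp add: poly_pCons[abs_def])
    show "\<Phi> (\<lambda>t. t) = a" using eq[OF fc_value_apoly[of a "[:0, 1:]"]] by (simp add: poly_pCons[abs_def])
  qed
qed

context
  fixes a :: "'a::unital_cstar_algebra" and \<Phi>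
  assumes a: "hermitian a" and fc: "is_functional_calculus a \<Phi>"
begin

lemma fc_cong:
  "continuous_on (cstar_spectrum a) f \<Longrightarrow> (\<And>t. t \<in> cstar_spectrum a \<Longrightarrow> f t = g t) \<Longrightarrow> \<Phi> f = \<Phi> g"
  and fc_add: "continuous_on (cstar_spectrum a) f \<Longrightarrow> continuous_on (cstar_spectrum a) g \<Longrightarrow>
    \<Phi> (\<lambda>t. f t + g t) = \<Phi> f + \<Phi> g"
  and fc_mult: "continuous_on (cstar_spectrum a) f \<Longrightarrow> continuous_on (cstar_spectrum a) g \<Longrightarrow>
    \<Phi> (\<lambda>t. f t * g t) = \<Phi> f * \<Phi> g"
  and fc_scaleC: "continuous_on (cstar_spectrum a) f \<Longrightarrow> \<Phi> (\<lambda>t. c * f t) = c *\<^sub>C \<Phi> f"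
  and fc_cnj: "continuous_on (cstar_spectrum a) f \<Longrightarrow> \<Phi> (\<lambda>t. cnj (f t)) = invol (\<Phi> f)"
  and fc_one: "\<Phi> (\<lambda>t. 1) = 1"
  and fc_id: "\<Phi> (\<lambda>t. t) = a"
  using fc unfolding is_functional_calculus_def by blast+

lemma fc_const: "\<Phi> (\<lambda>t. c) = c *\<^sub>C 1"
  using fc_scaleC[of "\<lambda>t. 1" c] fc_one by simp

lemma fc_diff:
  assumes "continuous_on (cstar_spectrum a) f" "continuous_on (cstar_spectrum a) g"
  shows "\<Phi> (\<lambda>t. f t - g t) = \<Phi> f - \<Phi> g"
  using fc_add[of f "\<lambda>t. (-1) * g t"] fc_scaleC[of g "-1"] assms
  by (simp add: continuous_intros)

lemma fc_sum:
  assumes "finite I" "\<And>i. i \<in> I \<Longrightarrow> continuous_on (cstar_spectrum a) (f i)"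
  shows "\<Phi> (\<lambda>t. \<Sum>i\<in>I. f i t) = (\<Sum>i\<in>I. \<Phi> (f i))"
  using assms
proof (induction I rule: finite_induct)
  case empty
  show ?case using fc_const[of 0] by simp
next
  case (insert i I)
  then show ?case using fc_add[of "f i" "\<lambda>t. \<Sum>i\<in>I. f i t"] by (simp add: continuous_intros)
qed

lemma fc_power: "continuous_on (cstar_spectrum a) f \<Longrightarrow> \<Phi> (\<lambda>t. f t ^ n) = \<Phi> f ^ n"
proof (induction n)
  case (Suc n)
  then show ?case using fc_mult[of f "\<lambda>t. f t ^ n"] by (simp add: continuous_intros)
qed (simp add: fc_one)

lemma fc_poly: "\<Phi> (poly p) = apoly p a"
proof (induction p)
  case 0
  show ?case using fc_const[of 0] by (simp add: poly_0[abs_def])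
next
  case (pCons c p)
  have "poly (pCons c p) = (\<lambda>t. c + t * poly p t)" by auto
  then show ?case
    using fc_add[of "\<lambda>t. c" "\<lambda>t. t * poly p t"] fc_mult[of "\<lambda>t. t" "poly p"] fc_const[of c] fc_id pCons.IH
    by (simp add: continuous_intros)
qed

text \<open>If \<open>g\<close> misses the value \<open>m\<close>, then \<open>1 / (g t - m)\<close>
  is continuous on the spectrum, and its image inverts
  \<open>\<Phi> g - m *\<^sub>C 1\<close>.\<close>

lemma fc_spectrumD:
  assumes g: "continuous_on (cstar_spectrum a) g" and m: "m \<in> cstar_spectrum (\<Phi> g)"
  shows "\<exists>t \<in> cstar_spectrum a. g t = m"
proof (rule ccontr)
  assume *: "\<not> ?thesis"
  then have h: "continuous_on (cstar_spectrum a) (\<lambda>t. 1 / (g t - m))"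
    by (intro continuous_intros g) auto
  have gm: "continuous_on (cstar_spectrum a) (\<lambda>t. g t - m)" by (intro continuous_intros g)
  have e: "\<Phi> (\<lambda>t. g t - m) = \<Phi> g - m *\<^sub>C 1"
    using fc_diff[OF g continuous_on_const[of _ m]] by (simp add: fc_const)
  have "(\<Phi> g - m *\<^sub>C 1) * \<Phi> (\<lambda>t. 1 / (g t - m)) = \<Phi> (\<lambda>t. (g t - m) * (1 / (g t - m)))"
    using fc_mult[OF gm h] e by simp
  also have "\<dots> = \<Phi> (\<lambda>t. 1)" using * by (intro fc_cong continuous_on_mult gm h) auto
  finally have 1: "(\<Phi> g - m *\<^sub>C 1) * \<Phi> (\<lambda>t. 1 / (g t - m)) = 1" by (simp add: fc_one)
  have "\<Phi> (\<lambda>t. 1 / (g t - m)) * (\<Phi> g - m *\<^sub>C 1) = \<Phi> (\<lambda>t. (1 / (g t - m)) * (g t - m))"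
    using fc_mult[OF h gm] e by simp
  also have "\<dots> = \<Phi> (\<lambda>t. 1)" using * by (intro fc_cong continuous_on_mult gm h) auto
  finally have "\<Phi> (\<lambda>t. 1 / (g t - m)) * (\<Phi> g - m *\<^sub>C 1) = 1" by (simp add: fc_one)
  with 1 m show False by (auto simp: spectrum_iff intro: cstar_invertibleI)
qed

lemma fc_hermitian:
  assumes "continuous_on (cstar_spectrum a) g" "\<And>t. t \<in> cstar_spectrum a \<Longrightarrow> Im (g t) = 0"
  shows "hermitian (\<Phi> g)"
  using fc_cnj[OF assms(1)] fc_cong[of "\<lambda>t. cnj (g t)" g] assms
  by (simp add: continuous_intros complex_eq_iff)

text \<open>Boundedness is automatic for a unital *-homomorphism: by the C*-identity the squared
  norm is that of a hermitian element, which is attained at a spectral point, and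
  \<open>fc_spectrumD\<close> makes this point a value of the squared modulus of
  \<open>h\<close>.\<close>

lemma fc_norm_le:
  assumes h: "continuous_on (cstar_spectrum a) h"
    and m: "\<And>t. t \<in> cstar_spectrum a \<Longrightarrow> cmod (h t) \<le> m" "0 \<le> m"
  shows "norm (\<Phi> h) \<le> m"
proof -
  let ?g = "\<lambda>t. cnj (h t) * h t"
  have g: "continuous_on (cstar_spectrum a) ?g" by (intro continuous_intros h)
  have e: "\<Phi> ?g = invol (\<Phi> h) * \<Phi> h"
    using fc_mult[of "\<lambda>t. cnj (h t)" h] h by (simp add: fc_cnj continuous_intros)
  have "hermitian (\<Phi> ?g)" by (simp add: e invol_mult invol_invol)
  then obtain r where r: "of_real r \<in> cstar_spectrum (\<Phi> ?g)" "\<bar>r\<bar> = norm (\<Phi> ?g)"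
    by (rule hermitian_norm_in_spectrum)
  obtain t where t: "t \<in> cstar_spectrum a" "cnj (h t) * h t = of_real r"
    using fc_spectrumD[OF g r(1)] by blast
  have "(norm (\<Phi> h))\<^sup>2 = \<bar>r\<bar>" by (simp add: r(2) e cstar_identity)
  also have "\<dots> = (cmod (h t))\<^sup>2"
    using t(2) by (metis complex_mod_cnj norm_mult norm_of_real power2_eq_square)
  also have "\<dots> \<le> m\<^sup>2" using m(1)[OF t(1)] by (intro power_mono) auto
  finally show ?thesis using m(2) by (simp add: power2_le_iff_abs_le)
qed

lemma fc_unif_limit:
  assumes f: "\<And>n. continuous_on (cstar_spectrum a) (f n)" and g: "continuous_on (cstar_spectrum a) g"
    and u: "uniform_limit (cstar_spectrum a) f g sequentially"
  shows "(\<lambda>n. \<Phi> (f n)) \<longlonglongrightarrow> \<Phi> g"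
proof (rule tendstoI)
  fix e :: real assume e: "e > 0"
  from uniform_limitD[OF u half_gt_zero[OF e]]
  show "\<forall>\<^sub>F n in sequentially. dist (\<Phi> (f n)) (\<Phi> g) < e"
  proof eventually_elim
    case (elim n)
    have "norm (\<Phi> (\<lambda>t. f n t - g t)) \<le> e / 2"
      using elim e by (intro fc_norm_le continuous_on_diff f g) (auto simp: dist_norm intro: less_imp_le)
    then show ?case using fc_diff[OF f[of n] g] e by (simp add: dist_norm)
  qed
qed

text \<open>Any two functional calculi agree on polynomials and are continuous for uniform
  convergence, so they agree everywhere. This gives the definite description in \<open>cfc\<close>
  its meaning.\<close>

lemma fc_fc_value:
  assumes f: "continuous_on (cstar_spectrum a) f" shows "fc_value a f (\<Phi> f)"
proof -
  obtain b where "fc_value a f b" using fc_value_exists[OF a f] by blast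
  then obtain P where
    P: "uniform_limit (cstar_spectrum a) (\<lambda>n. poly (P n)) f sequentially"
    unfolding fc_value_def by auto
  have "(\<lambda>n. \<Phi> (poly (P n))) \<longlonglongrightarrow> \<Phi> f" 
    by (rule fc_unif_limit[OF _ f P]) (intro continuous_intros)
  then show ?thesis using P unfolding fc_value_def fc_poly by blast
qed

text \<open>For the approximating polynomials the corresponding differences are not invertible, by
  spectral mapping; invertibility is an open condition, so the limit is not invertible
  either.\<close>

lemma fc_spectrumI:
  assumes f: "continuous_on (cstar_spectrum a) f" and t: "t \<in> cstar_spectrum a"
  shows "f t \<in> cstar_spectrum (\<Phi> f)"
proof (rule ccontr)
  assume "f t \<notin> cstar_spectrum (\<Phi> f)"
  then have i: "cstar_invertible (\<Phi> f - f t *\<^sub>C 1)" by (simp add: spectrum_iff)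
  obtain P where
    P: "uniform_limit (cstar_spectrum a) (\<lambda>n. poly (P n)) f sequentially" "(\<lambda>n. apoly (P n) a) \<longlonglongrightarrow> \<Phi> f"
    using fc_fc_value[OF f] unfolding fc_value_def by auto
  have "(\<lambda>n. norm ((apoly (P n) a - poly (P n) t *\<^sub>C 1) - (\<Phi> f - f t *\<^sub>C 1)) * norm (cinv (\<Phi> f - f t *\<^sub>C 1)))
      \<longlonglongrightarrow> norm ((\<Phi> f - f t *\<^sub>C 1) - (\<Phi> f - f t *\<^sub>C 1)) * norm (cinv (\<Phi> f - f t *\<^sub>C 1))"
    by (intro tendsto_intros cbil.tendsto P(2) tendsto_uniform_limitI[OF P(1) t])
  then have "\<forall>\<^sub>F n in sequentially. norm ((apoly (P n) a - poly (P n) t *\<^sub>C 1) - (\<Phi> f - f t *\<^sub>C 1))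
      * norm (cinv (\<Phi> f - f t *\<^sub>C 1)) < 1"
    by (rule order_tendstoD) simp
  then obtain n where "norm ((apoly (P n) a - poly (P n) t *\<^sub>C 1) - (\<Phi> f - f t *\<^sub>C 1))
      * norm (cinv (\<Phi> f - f t *\<^sub>C 1)) < 1"
    by (meson eventually_happens trivial_limit_sequentially)
  from cstar_invertible_near[OF i this] spectrum_apoly_I[OF t] show False by (simp add: spectrum_iff)
qed

lemma fc_exp:
  assumes g: "continuous_on (cstar_spectrum a) g" shows "\<Phi> (\<lambda>t. exp (g t)) = exp (\<Phi> g)"
proof -
  obtain B where B: "\<And>t. t \<in> cstar_spectrum a \<Longrightarrow> cmod (g t) \<le> B"
    using compact_imp_bounded[OF compact_continuous_image[OF g compact_spectrum]]
    unfolding bounded_iff by auto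
  have "uniform_limit (cstar_spectrum a) (\<lambda>n t. \<Sum>i<n. g t ^ i /\<^sub>R fact i) (\<lambda>t. suminf (\<lambda>i. g t ^ i /\<^sub>R fact i)) sequentially"
  proof (rule Weierstrass_m_test)
    fix n t assume "t \<in> cstar_spectrum a"
    then show "norm (g t ^ n /\<^sub>R fact n) \<le> B ^ n /\<^sub>R fact n"
      using B by (auto simp: norm_power intro!: mult_left_mono power_mono)
  qed (rule summable_exp_generic)
  then have u: "uniform_limit (cstar_spectrum a) (\<lambda>n t. \<Sum>i<n. g t ^ i /\<^sub>R fact i) (\<lambda>t. exp (g t)) sequentially"
    by (simp add: exp_def)
  have "(\<lambda>n. \<Phi> (\<lambda>t. \<Sum>i<n. g t ^ i /\<^sub>R fact i)) \<longlonglongrightarrow> \<Phi> (\<lambda>t. exp (g t))"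
    by (rule fc_unif_limit[OF _ _ u]) (intro continuous_intros g)+
  moreover have "\<Phi> (\<lambda>t. \<Sum>i<n. g t ^ i /\<^sub>R fact i) = (\<Sum>i<n. \<Phi> g ^ i /\<^sub>R fact i)" for n
  proof -
    have "\<Phi> (\<lambda>t. \<Sum>i<n. g t ^ i /\<^sub>R fact i) = (\<Sum>i<n. \<Phi> (\<lambda>t. g t ^ i /\<^sub>R fact i))"
      by (intro fc_sum continuous_intros g) auto
    also have "\<dots> = (\<Sum>i<n. \<Phi> g ^ i /\<^sub>R fact i)"
    proof (rule sum.cong[OF refl])
      fix i
      have "\<Phi> (\<lambda>t. g t ^ i /\<^sub>R fact i) = \<Phi> (\<lambda>t. of_real (inverse (fact i)) * g t ^ i)"
        by (simp add: scaleR_conv_of_real)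
      also have "\<dots> = of_real (inverse (fact i)) *\<^sub>C \<Phi> g ^ i"
        by (subst fc_scaleC) (auto simp: fc_power g intro!: continuous_intros)
      finally show "\<Phi> (\<lambda>t. g t ^ i /\<^sub>R fact i) = \<Phi> g ^ i /\<^sub>R fact i"
        by (simp only: scaleC_of_real)
    qed
    finally show ?thesis .
  qed
  moreover have "(\<lambda>n. \<Sum>i<n. \<Phi> g ^ i /\<^sub>R fact i) \<longlonglongrightarrow> exp (\<Phi> g)"
    unfolding exp_def by (intro summable_LIMSEQ summable_exp_generic)
  ultimately show ?thesis using LIMSEQ_unique by auto
qed

end

lemma cfc_eq:
  assumes a: "hermitian a" and fc: "is_functional_calculus a \<Phi>"
    and f: "continuous_on (cstar_spectrum a) f"
  shows "cfc a f = \<Phi> f"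
  unfolding cfc_def
proof (rule the_equality)
  show "\<exists>\<Phi>'. is_functional_calculus a \<Phi>' \<and> \<Phi>' f = \<Phi> f" using fc by blast
  fix b assume "\<exists>\<Phi>'. is_functional_calculus a \<Phi>' \<and> \<Phi>' f = b"
  then show "b = \<Phi> f"
    using fc_value_unique[OF a fc_fc_value[OF a _ f] fc_fc_value[OF a fc f]] by blast
qed


subsection \<open>Exponentials, logarithms and real powers\<close>

text \<open>Phrased through powers of \<open>x\<close> so as to cover the antimultiplicative
  involution and Jordan maps alike.\<close>

lemma bounded_linear_exp:
  fixes T :: "'a::{real_normed_algebra_1,banach} \<Rightarrow> 'b::{real_normed_algebra_1,banach}"
  assumes T: "bounded_linear T" and pow: "\<And>n. T (x ^ n) = T x ^ n"
  shows "T (exp x) = exp (T x)"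
proof -
  have "T (exp x) = (\<Sum>n. T (x ^ n /\<^sub>R fact n))"
    unfolding exp_def by (rule bounded_linear.suminf[OF T summable_exp_generic])
  then show ?thesis
    by (simp add: exp_def linear_scale[OF bounded_linear.linear[OF T]] pow)
qed

lemma hermitian_exp: "hermitian x \<Longrightarrow> hermitian (exp x)"
  using bounded_linear_exp[OF bounded_linear_invol, of x] by (simp add: invol_power)

lemma exp_scaleR_add:
  fixes x :: "'a::unital_cstar_algebra"
  shows "exp (r *\<^sub>R x) * exp (s *\<^sub>R x) = exp ((r + s) *\<^sub>R x)"
  by (subst exp_add_commuting[symmetric]) (simp_all add: scaleR_add_left)

lemma invertible_exp: "cstar_invertible (exp (x::'a::unital_cstar_algebra))"
  and cinv_exp: "cinv (exp (x::'a::unital_cstar_algebra)) = exp (- x)"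
  using exp_minus_inverse[of x] exp_minus_inverse[of "- x"]
  by (auto intro: cinv_eq cstar_invertibleI)

lemma hermitian_scaleR: "hermitian x \<Longrightarrow> hermitian (r *\<^sub>R x)"
  by (simp add: invol_scaleR)

lemma fc_exp_id:
  assumes "hermitian x" "is_functional_calculus x \<Phi>" shows "\<Phi> exp = exp x"
  using fc_exp[OF assms continuous_on_id] fc_id[OF assms] by simp

lemma spectrum_exp:
  assumes x: "hermitian x" shows "cstar_spectrum (exp x) = exp ` cstar_spectrum x"
proof -
  obtain \<Phi> where fc: "is_functional_calculus x \<Phi>" using functional_calculus_exists[OF x] by blast
  have c: "continuous_on (cstar_spectrum x) exp" by (intro continuous_intros)
  show ?thesis
    using fc_spectrumD[OF x fc c] fc_spectrumI[OF x fc c] unfolding fc_exp_id[OF x fc] by blast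
qed

lemma exp_cone:
  assumes x: "hermitian x" shows "exp x \<in> pos_def_cone"
proof (intro coneI positiveI hermitian_exp x invertible_exp)
  fix r assume "complex_of_real r \<in> cstar_spectrum (exp x)"
  then obtain t where t: "t \<in> cstar_spectrum x" "complex_of_real r = exp t"
    unfolding spectrum_exp[OF x] by blast
  have "t = of_real (Re t)" using hermitian_spectrum_real[OF x t(1)] by (simp add: complex_eq_iff)
  then have "complex_of_real r = of_real (exp (Re t))" using t(2) by (metis exp_of_real)
  then have "r = exp (Re t)" by (simp only: of_real_eq_iff)
  then show "0 \<le> r" by simp
qed

lemma cone_spectrum:
  assumes "x \<in> pos_def_cone" "t \<in> cstar_spectrum x" shows "Im t = 0" "0 < Re t"
proof -
  show im: "Im t = 0" by (rule hermitian_spectrum_real[OF cone_hermitian[OF assms(1)] assms(2)])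
  have "t \<noteq> 0" using assms(2) cone_invertible[OF assms(1)] by (auto simp: spectrum_iff)
  moreover have "0 \<le> Re t" using assms by (auto simp: pos_def_cone_def cstar_positive_def)
  ultimately show "0 < Re t" using im by (simp add: complex_eq_iff)
qed

lemma cone_exp_ex:
  assumes x: "x \<in> pos_def_cone" shows "\<exists>y. hermitian y \<and> exp y = x"
proof -
  have h: "hermitian x" by (rule cone_hermitian[OF x])
  obtain \<Phi> where fc: "is_functional_calculus x \<Phi>" using functional_calculus_exists[OF h] by blast
  let ?g = "\<lambda>t. complex_of_real (ln (Re t))"
  have g: "continuous_on (cstar_spectrum x) ?g"
    by (intro continuous_intros) (use cone_spectrum(2)[OF x] in fastforce)
  have "exp (\<Phi> ?g) = \<Phi> (\<lambda>t. exp (?g t))" by (simp add: fc_exp[OF h fc g])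
  also have "\<dots> = \<Phi> (\<lambda>t. t)"
  proof (rule fc_cong[OF h fc])
    fix t assume "t \<in> cstar_spectrum x"
    from cone_spectrum[OF x this] show "exp (?g t) = t"
      by (simp add: exp_of_real complex_eq_iff)
  qed (intro continuous_intros g)
  finally have "exp (\<Phi> ?g) = x" by (simp add: fc_id[OF h fc])
  moreover have "hermitian (\<Phi> ?g)" by (rule fc_hermitian[OF h fc g]) simp
  ultimately show ?thesis by blast
qed

text \<open>Composing functions with exp turns a functional calculus of \<open>x\<close> into one of
  \<open>exp x\<close>; since values are unique, powers of \<open>exp x\<close> can be computed in
  the calculus of \<open>x\<close>. All laws of real powers on the cone reduce to exponentials in
  this way.\<close>

lemma cstar_powr_exp:
  assumes x: "hermitian x" shows "cstar_powr (exp x) r = exp (r *\<^sub>R x)"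
proof -
  let ?K = "cstar_spectrum x" and ?L = "cstar_spectrum (exp x)"
  obtain \<Phi> where fc: "is_functional_calculus x \<Phi>" using functional_calculus_exists[OF x] by blast
  define \<Psi> where "\<Psi> f = \<Phi> (\<lambda>t. f (exp t))" for f
  have ex: "t \<in> ?K \<Longrightarrow> exp t \<in> ?L" for t by (simp add: spectrum_exp[OF x])
  have c: "continuous_on ?K (\<lambda>t. f (exp t))" if "continuous_on ?L f" for f :: "complex \<Rightarrow> complex"
    by (rule continuous_on_compose2[OF that]) (auto intro: continuous_intros ex)
  have fc': "is_functional_calculus (exp x) \<Psi>"
    unfolding is_functional_calculus_def \<Psi>_def
  proof (intro conjI allI impI)
    fix f g :: "complex \<Rightarrow> complex" assume "continuous_on ?L f" and "\<forall>t\<in>?L. f t = g t"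
    then show "\<Phi> (\<lambda>t. f (exp t)) = \<Phi> (\<lambda>t. g (exp t))" by (intro fc_cong[OF x fc] c) (auto simp: ex)
  qed (simp_all add: c fc_add[OF x fc] fc_mult[OF x fc] fc_scaleC[OF x fc] fc_cnj[OF x fc]
      fc_const[OF x fc] mult_scaleC_left fc_one[OF x fc] fc_exp_id[OF x fc])
  let ?f = "\<lambda>t. complex_of_real (Re t powr r)"
  have pos: "t \<in> ?L \<Longrightarrow> 0 < Re t" for t by (rule cone_spectrum(2)[OF exp_cone[OF x]])
  have f: "continuous_on ?L ?f"
    by (intro continuous_intros) (use pos in force)
  have "cstar_powr (exp x) r = \<Psi> ?f"
    unfolding cstar_powr_def by (rule cfc_eq[OF hermitian_exp[OF x] fc' f])
  also have "\<dots> = \<Phi> (\<lambda>t. exp (of_real r * t))"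
    unfolding \<Psi>_def
  proof (rule fc_cong[OF x fc c[OF f]])
    fix t assume "t \<in> ?K"
    then have t: "t = of_real (Re t)" using hermitian_spectrum_real[OF x] by (simp add: complex_eq_iff)
    have "?f (exp t) = of_real (exp (Re t) powr r)" by (subst t) (simp add: exp_of_real)
    also have "\<dots> = exp (of_real r * t)" by (subst (2) t) (simp add: powr_def exp_of_real[symmetric])
    finally show "?f (exp t) = exp (of_real r * t)" .
  qed
  also have "\<dots> = exp (\<Phi> (\<lambda>t. of_real r * t))" by (rule fc_exp[OF x fc]) (intro continuous_intros)
  also have "\<Phi> (\<lambda>t. of_real r * t) = r *\<^sub>R x"
    using fc_scaleC[OF x fc, of "\<lambda>t. t" "of_real r"] by (simp add: fc_id[OF x fc] scaleC_of_real)
  finally show ?thesis .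
qed

lemma exp_scaleR_difference_quotient:
  fixes x :: "'a::{real_normed_algebra_1,banach}"
  shows "((\<lambda>t. (exp (t *\<^sub>R x) - 1) /\<^sub>R t) \<longlongrightarrow> x) (at_right 0)"
proof -
  have "((\<lambda>t. (exp (t *\<^sub>R x) - (1 + t *\<^sub>R x)) /\<^sub>R norm t) \<longlongrightarrow> 0) (at_right 0)"
    using exp_scaleR_has_vector_derivative_right[of x 0 "{0<..}"]
    by (simp add: has_vector_derivative_def has_derivative_within inverse_eq_divide)
  then have "((\<lambda>t. (exp (t *\<^sub>R x) - 1) /\<^sub>R t - x) \<longlongrightarrow> 0) (at_right 0)"
  proof (rule Lim_transform_eventually)
    show "\<forall>\<^sub>F t in at_right 0. (exp (t *\<^sub>R x) - (1 + t *\<^sub>R x)) /\<^sub>R norm t = (exp (t *\<^sub>R x) - 1) /\<^sub>R t - x"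
      using eventually_at_right_less[of 0]
      by eventually_elim (simp add: scaleR_diff_right scaleR_add_right)
  qed
  then show ?thesis by (simp only: LIM_zero_iff)
qed

text \<open>Real powers recover the whole curve \<open>exp (t *\<^sub>R x)\<close> from
  \<open>exp x\<close>, and its right derivative at 0 is \<open>x\<close>.\<close>

lemma hermitian_exp_inj:
  assumes "hermitian x" "hermitian y" "exp x = exp y" shows "x = y"
proof -
  have "exp (t *\<^sub>R x) = exp (t *\<^sub>R y)" for t
    using assms cstar_powr_exp[of x t] cstar_powr_exp[of y t] by simp
  then have "((\<lambda>t. (exp (t *\<^sub>R x) - 1) /\<^sub>R t) \<longlongrightarrow> y) (at_right 0)"
    using exp_scaleR_difference_quotient[of y] by simp
  with exp_scaleR_difference_quotient[of x] show ?thesis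
    by (rule tendsto_unique[rotated]) simp
qed

definition clog :: "'a::unital_cstar_algebra \<Rightarrow> 'a" where
  "clog x = (THE y. hermitian y \<and> exp y = x)"

lemma clog_exp: "hermitian x \<Longrightarrow> clog (exp x) = x"
  unfolding clog_def by (rule the_equality) (auto intro: hermitian_exp_inj)

lemma
  assumes "x \<in> pos_def_cone"
  shows exp_clog: "exp (clog x) = x" and hermitian_clog: "hermitian (clog x)"
  using cone_exp_ex[OF assms] clog_exp by metis+

lemma cone_powr_exp: "x \<in> pos_def_cone \<Longrightarrow> cstar_powr x r = exp (r *\<^sub>R clog x)"
  using cstar_powr_exp[OF hermitian_clog, of x r] by (simp add: exp_clog)

lemma powr_cone: "x \<in> pos_def_cone \<Longrightarrow> cstar_powr x r \<in> pos_def_cone"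
  by (simp add: cone_powr_exp exp_cone hermitian_scaleR hermitian_clog)

lemma powr_mult: "x \<in> pos_def_cone \<Longrightarrow> cstar_powr x r * cstar_powr x s = cstar_powr x (r + s)"
  by (simp add: cone_powr_exp exp_scaleR_add)

lemma powr_powr_cone: "x \<in> pos_def_cone \<Longrightarrow> cstar_powr (cstar_powr x r) s = cstar_powr x (s * r)"
  by (simp add: cone_powr_exp cstar_powr_exp hermitian_scaleR hermitian_clog)

lemma powr_one_cone: "x \<in> pos_def_cone \<Longrightarrow> cstar_powr x 1 = x"
  by (simp add: cone_powr_exp exp_clog)

lemma powr_zero_cone: "x \<in> pos_def_cone \<Longrightarrow> cstar_powr x 0 = 1"
  by (simp add: cone_powr_exp)

lemma powr_two_cone: "x \<in> pos_def_cone \<Longrightarrow> cstar_powr x 2 = x * x"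
  using powr_mult[of x 1 1] by (simp add: powr_one_cone)

lemma cinv_cone: "x \<in> pos_def_cone \<Longrightarrow> cinv x = cstar_powr x (- 1)"
  using cinv_exp[of "clog x"] by (simp add: cone_powr_exp exp_clog)

abbreviation csqrt_cone :: "'a::unital_cstar_algebra \<Rightarrow> 'a" where
  "csqrt_cone x \<equiv> cstar_powr x (1/2)"

lemma csqrt_cone_square: "x \<in> pos_def_cone \<Longrightarrow> csqrt_cone x * csqrt_cone x = x"
  by (simp add: powr_mult powr_one_cone)

text \<open>For nonnegative \<open>s\<close>, the norm of \<open>exp (s *\<^sub>R ?y)\<close> is the
  exponential of \<open>s\<close> times the largest spectral point of the logarithm
  \<open>?y\<close>, and that point does not depend on \<open>s\<close>.\<close>

lemma norm_powr_cone:
  assumes x: "x \<in> pos_def_cone" and r: "0 \<le> r"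
  shows "norm (cstar_powr x r) = norm x powr r"
proof -
  let ?y = "clog x"
  have y: "hermitian ?y" by (rule hermitian_clog[OF x])
  obtain \<Phi> where fc: "is_functional_calculus ?y \<Phi>" using functional_calculus_exists[OF y] by blast
  obtain t where t: "t \<in> cstar_spectrum ?y" "\<And>z. z \<in> cstar_spectrum ?y \<Longrightarrow> Re z \<le> Re t"
    using continuous_attains_sup[OF compact_spectrum hermitian_spectrum_nonempty[OF y]
        continuous_on_Re[OF continuous_on_id]] by auto
  have main: "norm (exp (s *\<^sub>R ?y)) = exp (s * Re t)" if s: "0 \<le> s" for s
  proof -
    have c: "continuous_on (cstar_spectrum ?y) (\<lambda>z. of_real s * z)"
      "continuous_on (cstar_spectrum ?y) (\<lambda>z. exp (of_real s * z))" by (intro continuous_intros)+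
    have "\<Phi> (\<lambda>z. exp (of_real s * z)) = exp (\<Phi> (\<lambda>z. of_real s * z))" by (rule fc_exp[OF y fc c(1)])
    also have "\<Phi> (\<lambda>z. of_real s * z) = s *\<^sub>R ?y"
      using fc_scaleC[OF y fc, of "\<lambda>t. t" "of_real s"] by (simp add: fc_id[OF y fc] scaleC_of_real)
    finally have e: "\<Phi> (\<lambda>z. exp (of_real s * z)) = exp (s *\<^sub>R ?y)" .
    show ?thesis
    proof (rule antisym)
      show "norm (exp (s *\<^sub>R ?y)) \<le> exp (s * Re t)"
        unfolding e[symmetric] by (rule fc_norm_le[OF y fc c(2)]) (auto intro: mult_left_mono t s)
      have "exp (of_real s * t) \<in> cstar_spectrum (exp (s *\<^sub>R ?y))"
        using fc_spectrumI[OF y fc c(2) t(1)] e by simp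
      from spectrum_norm_bound[OF this] show "exp (s * Re t) \<le> norm (exp (s *\<^sub>R ?y))" by simp
    qed
  qed
  show ?thesis
    using main[OF r] main[of 1] by (simp add: cone_powr_exp[OF x] exp_clog[OF x] powr_def)
qed


subsection \<open>The spectral seminorm of a product of two elements of the cone\<close>

lemma spectral_seminorm_positive:
  assumes "cstar_positive a" shows "spectral_seminorm a = norm a"
  unfolding spectral_seminorm_def
proof (rule cSup_eq_maximum)
  obtain r where "of_real r \<in> cstar_spectrum a" "\<bar>r\<bar> = norm a"
    by (rule hermitian_norm_in_spectrum[OF positive_hermitian[OF assms]])
  then show "norm a \<in> {cmod t |t. t \<in> cstar_spectrum a}" by (metis (mono_tags, lifting) CollectI norm_of_real)
qed (auto intro: spectrum_norm_bound)

lemma spectral_seminorm_similar: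
  "s * t = 1 \<Longrightarrow> t * s = 1 \<Longrightarrow> spectral_seminorm (s * a * t) = spectral_seminorm a"
  unfolding spectral_seminorm_def by (simp add: spectrum_similar)

lemma csqrt_cone_cinv:
  assumes "x \<in> pos_def_cone"
  shows "csqrt_cone x * cstar_powr x (-1/2) = 1" "cstar_powr x (-1/2) * csqrt_cone x = 1"
  using assms by (simp_all add: powr_mult powr_zero_cone)

text \<open>\<open>x * y\<close> is the conjugate of the right-hand product by the invertible
  element \<open>csqrt_cone x\<close>. For \<open>y\<close> in the cone this replaces an element
  that is usually not hermitian by a positive one.\<close>

lemma spectrum_mult_cone:
  assumes x: "x \<in> pos_def_cone"
  shows "cstar_spectrum (x * y) = cstar_spectrum (csqrt_cone x * y * csqrt_cone x)"
proof -
  let ?s = "csqrt_cone x" and ?t = "cstar_powr x (-1/2)"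
  have "?s * (?s * y * ?s) * ?t = (?s * ?s) * y * (?s * ?t)" by (simp only: mult.assoc)
  also have "\<dots> = x * y" by (simp only: csqrt_cone_square[OF x] csqrt_cone_cinv[OF x] mult_1_right)
  finally show ?thesis using spectrum_similar[OF csqrt_cone_cinv[OF x]] by metis
qed

lemma spectral_seminorm_mult_cone:
  assumes "x \<in> pos_def_cone" "y \<in> pos_def_cone"
  shows "spectral_seminorm (x * y) = norm (csqrt_cone x * y * csqrt_cone x)"
proof -
  have "cstar_positive (csqrt_cone x * y * csqrt_cone x)"
    using assms by (intro positive_congruence cone_hermitian powr_cone cone_positive)
  from spectral_seminorm_positive[OF this] show ?thesis
    unfolding spectral_seminorm_def spectrum_mult_cone[OF assms(1)] .
qed

lemma spectral_seminorm_commute: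
  assumes "x \<in> pos_def_cone" shows "spectral_seminorm (x * y) = spectral_seminorm (y * x)"
  using spectral_seminorm_similar[of x "cinv x" "y * x"] assms
  by (simp add: cinv_props cone_invertible mult.assoc)

lemma spectral_seminorm_scaleR:
  assumes "x \<in> pos_def_cone" "y \<in> pos_def_cone" "0 < t"
  shows "spectral_seminorm (x * (t *\<^sub>R y)) = t * spectral_seminorm (x * y)"
  using assms by (simp add: spectral_seminorm_mult_cone cone_scaleR del: mult_scaleR_right)
    (simp add: spectral_seminorm_mult_cone)

lemma spectral_seminorm_mono:
  assumes "x \<in> pos_def_cone" "y \<in> pos_def_cone" "z \<in> pos_def_cone" "x \<preceq> y"
  shows "spectral_seminorm (z * x) \<le> spectral_seminorm (z * y)"
proof -
  let ?s = "csqrt_cone z"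
  have s: "hermitian ?s" using assms(3) by (intro cone_hermitian powr_cone)
  have p: "cstar_positive (?s * x * ?s)" "cstar_positive (?s * y * ?s)"
    using assms s by (auto intro: positive_congruence cone_positive)
  have "?s * x * ?s \<preceq> ?s * y * ?s" using cstar_le_congruence[OF assms(4) s] .
  also have "?s * y * ?s \<preceq> norm (?s * y * ?s) *\<^sub>R 1"
    using positive_norm_le_iff[OF p(2), of "norm (?s * y * ?s)"] by simp
  finally (cstar_le_trans) show ?thesis
    using assms positive_norm_le_iff[OF p(1)] by (simp add: spectral_seminorm_mult_cone)
qed

text \<open>Congruence with the inverse root of \<open>y\<close> turns a bound by
  \<open>t *\<^sub>R y\<close> into a bound by \<open>t *\<^sub>R 1\<close>, which is a norm bound;
  congruence with the root of \<open>y\<close> goes back.\<close>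

lemma spectral_seminorm_mult_cinv_le_iff:
  assumes x: "x \<in> pos_def_cone" and y: "y \<in> pos_def_cone" and t: "0 \<le> t"
  shows "spectral_seminorm (x * cinv y) \<le> t \<longleftrightarrow> x \<preceq> t *\<^sub>R y"
proof -
  let ?s = "csqrt_cone y" and ?u = "csqrt_cone (cinv y)"
  have u: "?u = cstar_powr y (-1/2)" using y by (simp add: cinv_cone powr_powr_cone)
  have h: "hermitian ?s" "hermitian ?u"
    using y by (auto intro: cone_hermitian powr_cone cone_cinv)
  have us: "?u * ?s = 1" "?s * ?u = 1" unfolding u by (rule csqrt_cone_cinv[OF y])+
  have p: "cstar_positive (?u * x * ?u)" using x h by (auto intro: positive_congruence cone_positive)
  have "spectral_seminorm (x * cinv y) = norm (?u * x * ?u)"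
    using x y by (simp add: spectral_seminorm_commute[OF x] spectral_seminorm_mult_cone cone_cinv)
  then have "spectral_seminorm (x * cinv y) \<le> t \<longleftrightarrow> ?u * x * ?u \<preceq> t *\<^sub>R 1"
    using positive_norm_le_iff[OF p t] by simp
  also have "\<dots> \<longleftrightarrow> x \<preceq> t *\<^sub>R y"
  proof
    assume "?u * x * ?u \<preceq> t *\<^sub>R 1"
    from cstar_le_congruence[OF this h(1)]
    have "(?s * ?u) * x * (?u * ?s) \<preceq> t *\<^sub>R (?s * ?s)" by (simp add: mult.assoc)
    then show "x \<preceq> t *\<^sub>R y" by (simp only: us mult_1_left mult_1_right csqrt_cone_square[OF y])
  next
    assume "x \<preceq> t *\<^sub>R y"
    from cstar_le_congruence[OF this h(2)] have "?u * x * ?u \<preceq> t *\<^sub>R (?u * y * ?u)" by simp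
    also have "?u * y * ?u = (?u * ?s) * (?s * ?u)"
      by (subst csqrt_cone_square[OF y, symmetric]) (simp only: mult.assoc)
    also have "\<dots> = 1" by (simp only: us mult_1_left)
    finally show "?u * x * ?u \<preceq> t *\<^sub>R 1" .
  qed
  finally show ?thesis .
qed

lemma spectral_seminorm_nonneg:
  "x \<in> pos_def_cone \<Longrightarrow> y \<in> pos_def_cone \<Longrightarrow> 0 \<le> spectral_seminorm (x * y)"
  by (simp add: spectral_seminorm_mult_cone)

lemma spectral_seminorm_one [simp]: "spectral_seminorm (1 :: 'a::unital_cstar_algebra) = 1"
  by (simp add: spectral_seminorm_positive positive_one)

text \<open>The choice \<open>z = y\<^sup>-\<^sup>1\<close> shows that the seminorms determine the order.\<close>

lemma cstar_le_iff_seminorm: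
  assumes x: "x \<in> pos_def_cone" and y: "y \<in> pos_def_cone"
  shows "x \<preceq> y \<longleftrightarrow> (\<forall>z \<in> pos_def_cone. spectral_seminorm (z * x) \<le> spectral_seminorm (z * y))"
proof
  assume "\<forall>z \<in> pos_def_cone. spectral_seminorm (z * x) \<le> spectral_seminorm (z * y)"
  then have "spectral_seminorm (cinv y * x) \<le> spectral_seminorm (cinv y * y)" using y cone_cinv by blast
  then have "spectral_seminorm (x * cinv y) \<le> 1"
    using y by (simp add: cinv_props cone_invertible spectral_seminorm_commute[OF x])
  then show "x \<preceq> y" using spectral_seminorm_mult_cinv_le_iff[OF x y, of 1] by simp
qed (use spectral_seminorm_mono[OF x y] in blast)

lemma cone_eqI_seminorm:
  assumes "x \<in> pos_def_cone" "y \<in> pos_def_cone"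
    and "\<And>z. z \<in> pos_def_cone \<Longrightarrow> spectral_seminorm (z * x) = spectral_seminorm (z * y)"
  shows "x = y"
  using assms by (intro cstar_le_antisym) (simp_all add: cstar_le_iff_seminorm)

text \<open>The square of \<open>x * y\<close> is similar to the square of a hermitian element,
  where the C*-identity applies. In the Thompson metric this becomes the doubling of distances by
  reflections.\<close>

lemma spectral_seminorm_mult_square:
  assumes x: "x \<in> pos_def_cone" and y: "y \<in> pos_def_cone"
  shows "spectral_seminorm (x * y * (x * y)) = (spectral_seminorm (x * y))\<^sup>2"
proof -
  let ?s = "csqrt_cone x" and ?t = "cstar_powr x (-1/2)"
  let ?w = "?s * y * ?s"
  have w: "hermitian ?w" using x y by (intro positive_hermitian positive_congruence cone_hermitian powr_cone cone_positive)
  have "?s * (?w * ?w) * ?t = (?s * ?s) * y * (?s * ?s) * y * (?s * ?t)" by (simp only: mult.assoc)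
  also have "\<dots> = x * y * (x * y)"
    by (simp only: csqrt_cone_square[OF x] csqrt_cone_cinv[OF x] mult_1_right mult.assoc)
  finally have "spectral_seminorm (x * y * (x * y)) = spectral_seminorm (?w * ?w)"
    using spectral_seminorm_similar[OF csqrt_cone_cinv[OF x]] by metis
  also have "\<dots> = (norm ?w)\<^sup>2"
    using w by (simp only: spectral_seminorm_positive positive_square hermitian_norm_square)
  finally show ?thesis by (simp add: spectral_seminorm_mult_cone x y)
qed


subsection \<open>Reflections of metric spaces\<close>

text \<open>Isolates what Vaisala's argument uses of a point reflection, so that it serves both
  \<open>c * cinv x * c\<close> in the Thompson metric and \<open>x + y - z\<close> in the norm
  metric. In a metric space the doubling clause makes \<open>c\<close> the only fixed point of
  \<open>\<tau>\<close>.\<close>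

definition reflection :: "'x set \<Rightarrow> ('x \<Rightarrow> 'x \<Rightarrow> real) \<Rightarrow> ('x \<Rightarrow> 'x) \<Rightarrow> 'x \<Rightarrow> bool" where
  "reflection S d \<tau> c \<longleftrightarrow> c \<in> S \<and>
     (\<forall>x\<in>S. \<tau> x \<in> S \<and> \<tau> (\<tau> x) = x \<and> d (\<tau> x) x = 2 * d x c) \<and>
     (\<forall>x\<in>S. \<forall>y\<in>S. d (\<tau> x) (\<tau> y) = d x y)"

definition isometry_between ::
    "'x set \<Rightarrow> ('x \<Rightarrow> 'x \<Rightarrow> real) \<Rightarrow> 'y set \<Rightarrow> ('y \<Rightarrow> 'y \<Rightarrow> real) \<Rightarrow> ('x \<Rightarrow> 'y) \<Rightarrow> bool" where
  "isometry_between S d S' d' g \<longleftrightarrow> bij_betw g S S' \<and> (\<forall>x\<in>S. \<forall>y\<in>S. d' (g x) (g y) = d x y)"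

lemma isometry_between_compose:
  "isometry_between S d S' d' g \<Longrightarrow> isometry_between S' d' S'' d'' h \<Longrightarrow>
    isometry_between S d S'' d'' (h \<circ> g)"
  unfolding isometry_between_def by (auto intro: bij_betw_trans dest: bij_betwE)

lemma isometry_between_inv_into:
  assumes "isometry_between S d S' d' g" shows "isometry_between S' d' S d (inv_into S g)"
proof -
  from assms have b: "bij_betw g S S'" and i: "\<forall>x\<in>S. \<forall>y\<in>S. d' (g x) (g y) = d x y"
    by (auto simp: isometry_between_def)
  have "d (inv_into S g x) (inv_into S g y) = d' x y" if "x \<in> S'" "y \<in> S'" for x y
    using i that b bij_betw_inv_into_right[OF b] bij_betwE[OF bij_betw_inv_into[OF b]] by metis
  then show ?thesis using bij_betw_inv_into[OF b] by (simp add: isometry_between_def)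
qed

lemma isometry_between_reflection:
  assumes "reflection S d \<tau> c" shows "isometry_between S d S d \<tau>"
proof -
  have "bij_betw \<tau> S S"
    using assms by (intro bij_betw_byWitness[of _ \<tau>]) (auto simp: reflection_def)
  with assms show ?thesis by (auto simp: isometry_between_def reflection_def)
qed

text \<open>Vaisala's argument for the Mazur--Ulam theorem: passing from \<open>g\<close> to
  \<open>\<tau> g\<^sup>-\<^sup>1 \<tau> g\<close> doubles the distance by which the centre is moved, but this
  distance is at most \<open>2 d a c\<close>.\<close>

lemma (in Metric_space) isometry_fixes_center:
  assumes \<tau>: "reflection M d \<tau> c" and a: "a \<in> M" and g: "isometry_between M d M d g"
    and fixed: "g a = a" "g (\<tau> a) = \<tau> a"
  shows "g c = c"
proof -
  have c: "c \<in> M" and \<tau>M: "\<And>x. x \<in> M \<Longrightarrow> \<tau> x \<in> M" and \<tau>\<tau>: "\<And>x. x \<in> M \<Longrightarrow> \<tau> (\<tau> x) = x"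
    and \<tau>2: "\<And>x. x \<in> M \<Longrightarrow> d (\<tau> x) x = 2 * d x c"
    and \<tau>d: "\<And>x y. x \<in> M \<Longrightarrow> y \<in> M \<Longrightarrow> d (\<tau> x) (\<tau> y) = d x y"
    using \<tau> by (auto simp: reflection_def)
  have \<tau>c: "\<tau> c = c" using \<tau>2[OF c] c \<tau>M zero[of "\<tau> c" c] by simp
  have main: "2 ^ n * d (g c) c \<le> 2 * d a c"
    if "isometry_between M d M d g" "g a = a" "g (\<tau> a) = \<tau> a" for n g
    using that
  proof (induction n arbitrary: g)
    case 0
    have gc: "g c \<in> M" using 0 c by (auto simp: isometry_between_def dest: bij_betwE)
    have "d (g c) c \<le> d (g c) (g a) + d a c" using triangle[OF gc a c] 0 by simp
    also have "d (g c) (g a) = d a c" using 0(1) a c by (simp add: isometry_between_def commute)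
    finally show ?case by simp
  next
    case (Suc n)
    let ?h = "inv_into M g" and ?g = "\<tau> \<circ> (inv_into M g \<circ> (\<tau> \<circ> g))"
    have b: "bij_betw g M M" and gd: "\<And>x y. x \<in> M \<Longrightarrow> y \<in> M \<Longrightarrow> d (g x) (g y) = d x y"
      using Suc.prems by (auto simp: isometry_between_def)
    have gM: "x \<in> M \<Longrightarrow> g x \<in> M" and hM: "x \<in> M \<Longrightarrow> ?h x \<in> M" for x
      using bij_betwE[OF b] bij_betwE[OF bij_betw_inv_into[OF b]] by auto
    have gh: "x \<in> M \<Longrightarrow> g (?h x) = x" and hg: "x \<in> M \<Longrightarrow> ?h (g x) = x" for x
      using b by (auto simp: bij_betw_inv_into_left bij_betw_inv_into_right)
    have "isometry_between M d M d ?g"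
      by (intro isometry_between_compose[of M d M d] isometry_between_inv_into
          isometry_between_reflection[OF \<tau>] Suc.prems(1))
    moreover have h: "?h a = a" "?h (\<tau> a) = \<tau> a"
      using hg[OF a] hg[OF \<tau>M[OF a]] Suc.prems by auto
    then have "?g a = a" "?g (\<tau> a) = \<tau> a" using Suc.prems by (auto simp: \<tau>\<tau> a)
    ultimately have "2 ^ n * d (?g c) c \<le> 2 * d a c" by (rule Suc.IH)
    moreover have "d (?g c) c = 2 * d (g c) c"
    proof -
      have "d (?g c) c = d (\<tau> (?h (\<tau> (g c)))) (\<tau> c)" by (simp add: \<tau>c)
      also have "\<dots> = d (?h (\<tau> (g c))) c" using c gM hM \<tau>M by (intro \<tau>d) auto
      also have "\<dots> = d (g (?h (\<tau> (g c)))) (g c)" using c gM hM \<tau>M by (intro gd[symmetric]) auto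
      also have "\<dots> = d (\<tau> (g c)) (g c)" using c gM \<tau>M by (simp add: gh)
      also have "\<dots> = 2 * d (g c) c" using c gM by (intro \<tau>2) auto
      finally show ?thesis .
    qed
    ultimately show ?case by simp
  qed
  have gc: "g c \<in> M" using g c by (auto simp: isometry_between_def dest: bij_betwE)
  have "d (g c) c = 0"
  proof (rule ccontr)
    assume "d (g c) c \<noteq> 0"
    then have pos: "0 < d (g c) c" using nonneg[of "g c" c] by linarith
    obtain n where "2 * d a c / d (g c) c < 2 ^ n" using real_arch_pow[of 2] by force
    then have "2 * d a c < 2 ^ n * d (g c) c" using pos by (simp add: divide_less_eq)
    with main[OF g fixed, of n] show False by simp
  qed
  then show ?thesis using zero[OF gc c] by simp
qed

text \<open>The composite \<open>?g\<close> of the two reflections, transported by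
  \<open>\<psi>\<close>, fixes \<open>a\<close> and \<open>\<tau> a\<close>, because
  \<open>\<tau>'\<close> exchanges their images. Hence it fixes \<open>c\<close>, so
  \<open>\<tau>'\<close> fixes \<open>\<psi> c\<close>, and \<open>c'\<close> is its only fixed
  point.\<close>

lemma isometry_maps_center:
  assumes M: "Metric_space S d" and M': "Metric_space S' d'"
    and \<psi>: "isometry_between S d S' d' \<psi>"
    and \<tau>: "reflection S d \<tau> c" and \<tau>': "reflection S' d' \<tau>' c'"
    and a: "a \<in> S" "\<tau>' (\<psi> a) = \<psi> (\<tau> a)"
  shows "\<psi> c = c'"
proof -
  let ?h = "inv_into S \<psi>"
  let ?g = "?h \<circ> (\<tau>' \<circ> (\<psi> \<circ> \<tau>))"
  have b: "bij_betw \<psi> S S'" using \<psi> by (simp add: isometry_between_def)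
  have c: "c \<in> S" "c' \<in> S'" "\<tau> a \<in> S" "\<tau> (\<tau> a) = a" using \<tau> \<tau>' a by (auto simp: reflection_def)
  have \<psi>S: "x \<in> S \<Longrightarrow> \<psi> x \<in> S'" for x using bij_betwE[OF b] by blast
  have "isometry_between S d S d ?g"
    by (intro isometry_between_compose[OF _ isometry_between_inv_into[OF \<psi>]]
        isometry_between_compose[OF _ isometry_between_reflection[OF \<tau>']]
        isometry_between_compose[OF isometry_between_reflection[OF \<tau>] \<psi>])
  moreover have "?g a = a" using a c \<tau>' \<psi>S bij_betw_inv_into_left[OF b]
    by (auto simp: reflection_def simp flip: a(2))
  moreover have "?g (\<tau> a) = \<tau> a" using a c bij_betw_inv_into_left[OF b] by simp
  ultimately have "?g c = c" by (rule Metric_space.isometry_fixes_center[OF M \<tau> a(1)])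
  moreover have "\<tau> c = c"
    using Metric_space.zero[OF M, of "\<tau> c" c] Metric_space.zero[OF M, of c c] \<tau> by (auto simp: reflection_def)
  ultimately have "?h (\<tau>' (\<psi> c)) = c" by simp
  then have "\<tau>' (\<psi> c) = \<psi> c"
    using bij_betw_inv_into_right[OF b, of "\<tau>' (\<psi> c)"] \<tau>' \<psi>S[OF c(1)] by (auto simp: reflection_def)
  then have "d' (\<psi> c) c' = 0"
    using Metric_space.zero[OF M', of "\<psi> c" "\<psi> c"] \<tau>' \<psi>S[OF c(1)] by (auto simp: reflection_def)
  then show ?thesis using Metric_space.zero[OF M' \<psi>S[OF c(1)] c(2)] by simp
qed


subsection \<open>The Thompson metric\<close>

text \<open>On the cone this is the gauge M(x/y), the least \<open>t\<close> with
  \<open>x \<preceq> t *\<^sub>R y\<close>.\<close>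

definition thompson_ratio :: "'a::unital_cstar_algebra \<Rightarrow> 'a \<Rightarrow> real" where
  "thompson_ratio x y = spectral_seminorm (x * cinv y)"

text \<open>The absolute value only matters off the cone.\<close>

definition thompson_dist :: "'a::unital_cstar_algebra \<Rightarrow> 'a \<Rightarrow> real" where
  "thompson_dist x y = \<bar>ln (max (thompson_ratio x y) (thompson_ratio y x))\<bar>"

lemma thompson_ratio_le_iff:
  "x \<in> pos_def_cone \<Longrightarrow> y \<in> pos_def_cone \<Longrightarrow> 0 \<le> t \<Longrightarrow> thompson_ratio x y \<le> t \<longleftrightarrow> x \<preceq> t *\<^sub>R y"
  unfolding thompson_ratio_def by (rule spectral_seminorm_mult_cinv_le_iff)

lemma thompson_ratio_nonneg: "x \<in> pos_def_cone \<Longrightarrow> y \<in> pos_def_cone \<Longrightarrow> 0 \<le> thompson_ratio x y"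
  unfolding thompson_ratio_def by (intro spectral_seminorm_nonneg cone_cinv)

lemma thompson_ratio_self: "x \<in> pos_def_cone \<Longrightarrow> thompson_ratio x x = 1"
  unfolding thompson_ratio_def by (simp add: cinv_props cone_invertible)

lemma thompson_ratio_triangle:
  assumes "x \<in> pos_def_cone" "y \<in> pos_def_cone" "z \<in> pos_def_cone"
  shows "thompson_ratio x z \<le> thompson_ratio x y * thompson_ratio y z"
proof -
  have "x \<preceq> thompson_ratio x y *\<^sub>R y" "y \<preceq> thompson_ratio y z *\<^sub>R z"
    using assms thompson_ratio_le_iff thompson_ratio_nonneg by blast+
  then have "x \<preceq> thompson_ratio x y *\<^sub>R (thompson_ratio y z *\<^sub>R z)"
    using assms by (meson cstar_le_trans cstar_le_scaleR thompson_ratio_nonneg)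
  then show ?thesis
    using assms by (simp add: thompson_ratio_le_iff thompson_ratio_nonneg)
qed

lemma thompson_ratio_pos:
  assumes "x \<in> pos_def_cone" "y \<in> pos_def_cone" shows "0 < thompson_ratio x y"
  using thompson_ratio_triangle[OF assms assms(1)] thompson_ratio_self[OF assms(1)]
    thompson_ratio_nonneg[OF assms] by (cases "thompson_ratio x y = 0") auto

text \<open>The ratio of \<open>x\<close> to itself is 1, so the product of the two ratios is at
  least 1. On the cone the logarithm in \<open>thompson_dist\<close> is therefore
  nonnegative.\<close>

lemma max_thompson_ratio_ge_1:
  assumes "x \<in> pos_def_cone" "y \<in> pos_def_cone"
  shows "1 \<le> max (thompson_ratio x y) (thompson_ratio y x)" (is "1 \<le> ?m")
proof -
  have "1 \<le> thompson_ratio x y * thompson_ratio y x"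
    using thompson_ratio_triangle[of x y x] assms by (simp add: thompson_ratio_self)
  also have "\<dots> \<le> ?m * ?m"
    using assms by (intro mult_mono) (auto simp: thompson_ratio_nonneg le_max_iff_disj)
  finally show ?thesis
    using assms thompson_ratio_nonneg[of x y] by (metis abs_le_square_iff abs_of_nonneg abs_one le_max_iff_disj mult_1 power2_eq_square)
qed

lemma Metric_space_thompson: "Metric_space pos_def_cone (thompson_dist :: 'a::unital_cstar_algebra \<Rightarrow> _)"
proof
  fix x y z :: 'a
  show "0 \<le> thompson_dist x y" by (simp add: thompson_dist_def)
  show "thompson_dist x y = thompson_dist y x" by (simp add: thompson_dist_def max.commute)
  let ?m = "\<lambda>x y :: 'a. max (thompson_ratio x y) (thompson_ratio y x)"
  assume x: "x \<in> pos_def_cone" and y: "y \<in> pos_def_cone"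
  show "thompson_dist x y = 0 \<longleftrightarrow> x = y"
  proof
    assume "thompson_dist x y = 0"
    then have "?m x y = 1" using max_thompson_ratio_ge_1[OF x y] by (simp add: thompson_dist_def)
    then have "thompson_ratio x y \<le> 1" "thompson_ratio y x \<le> 1" by linarith+
    then show "x = y" using x y by (auto simp: thompson_ratio_le_iff intro: cstar_le_antisym)
  qed (simp add: thompson_dist_def thompson_ratio_self[OF y])
  assume z: "z \<in> pos_def_cone"
  note ge = max_thompson_ratio_ge_1[OF x y] max_thompson_ratio_ge_1[OF y z] max_thompson_ratio_ge_1[OF x z]
  have "?m x z \<le> ?m x y * ?m y z"
  proof (rule max.boundedI)
    have "thompson_ratio x y * thompson_ratio y z \<le> ?m x y * ?m y z"
      using x y z ge by (intro mult_mono) (auto simp: thompson_ratio_nonneg)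
    then show "thompson_ratio x z \<le> ?m x y * ?m y z" using thompson_ratio_triangle[OF x y z] by linarith
    have "thompson_ratio y x * thompson_ratio z y \<le> ?m x y * ?m y z"
      using x y z ge by (intro mult_mono) (auto simp: thompson_ratio_nonneg)
    then show "thompson_ratio z x \<le> ?m x y * ?m y z"
      using thompson_ratio_triangle[OF z y x] by (simp add: mult.commute)
  qed
  then have "ln (?m x z) \<le> ln (?m x y * ?m y z)" using ge by (subst ln_le_cancel_iff) auto
  also have "\<dots> = ln (?m x y) + ln (?m y z)" using ge by (intro ln_mult_pos) auto
  finally show "thompson_dist x z \<le> thompson_dist x y + thompson_dist y z"
    using ge by (simp add: thompson_dist_def)
qed

text \<open>The product \<open>c * cinv x * c * cinv x\<close> is the square of
  \<open>c * cinv x\<close>, so the ratios between a point and its reflection are squares, and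
  logarithms double. Inverting exchanges the two ratios of a pair, which their maximum
  ignores.\<close>

lemma thompson_reflection:
  assumes c: "c \<in> pos_def_cone"
  shows "reflection pos_def_cone thompson_dist (\<lambda>x. c * cinv x * c) c"
proof -
  have ci: "cstar_invertible c" "hermitian c" using c by (auto intro: cone_invertible cone_hermitian)
  have ratio: "thompson_ratio (c * cinv x * c) (c * cinv y * c) = thompson_ratio y x"
    if "x \<in> pos_def_cone" "y \<in> pos_def_cone" for x y
  proof -
    have i: "cstar_invertible x" "cstar_invertible y" using that by (auto intro: cone_invertible)
    have "c * cinv x * c * cinv (c * cinv y * c) = c * cinv x * (c * cinv c) * y * cinv c"
      using i ci by (simp add: cinv_mult cstar_invertible_mult cstar_invertible_cinv cinv_cinv mult.assoc)
    also have "\<dots> = c * (cinv x * y) * cinv c" using ci by (simp add: cinv_props mult.assoc)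
    finally have "c * cinv x * c * cinv (c * cinv y * c) = c * (cinv x * y) * cinv c" .
    then have "thompson_ratio (c * cinv x * c) (c * cinv y * c) = spectral_seminorm (cinv x * y)"
      using ci by (simp add: thompson_ratio_def spectral_seminorm_similar cinv_props)
    also have "\<dots> = thompson_ratio y x"
      using that by (simp add: thompson_ratio_def spectral_seminorm_commute[OF that(2)])
    finally show ?thesis .
  qed
  have r1: "thompson_ratio (c * cinv x * c) x = (thompson_ratio c x)\<^sup>2" if "x \<in> pos_def_cone" for x
    using spectral_seminorm_mult_square[OF c cone_cinv[OF that]] by (simp add: thompson_ratio_def mult.assoc)
  have r2: "thompson_ratio x (c * cinv x * c) = (thompson_ratio x c)\<^sup>2" if "x \<in> pos_def_cone" for x
    using spectral_seminorm_mult_square[OF that cone_cinv[OF c]] that ci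
    by (simp add: thompson_ratio_def mult.assoc cinv_mult cstar_invertible_mult cstar_invertible_cinv
        cinv_cinv cone_invertible)
  show ?thesis
    unfolding reflection_def
  proof (intro conjI ballI)
    fix x :: 'a assume x: "x \<in> pos_def_cone"
    show "c * cinv x * c \<in> pos_def_cone" using x ci by (intro cone_congruence cone_cinv)
    show "c * cinv (c * cinv x * c) * c = x"
    proof -
      have "c * cinv (c * cinv x * c) * c = (c * cinv c) * x * (cinv c * c)"
        using x ci by (simp add: cinv_mult cstar_invertible_mult cstar_invertible_cinv cinv_cinv
            cone_invertible mult.assoc)
      then show ?thesis using ci by (simp add: cinv_props)
    qed
    have ge: "1 \<le> max (thompson_ratio x c) (thompson_ratio c x)" by (rule max_thompson_ratio_ge_1[OF x c])
    have "max ((thompson_ratio c x)\<^sup>2) ((thompson_ratio x c)\<^sup>2) = (max (thompson_ratio x c) (thompson_ratio c x))\<^sup>2"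
      using thompson_ratio_nonneg[OF x c] thompson_ratio_nonneg[OF c x]
      by (auto simp: max_def power2_le_iff_abs_le intro: antisym)
    then show "thompson_dist (c * cinv x * c) x = 2 * thompson_dist x c"
      using ge by (simp add: thompson_dist_def r1[OF x] r2[OF x] ln_realpow)
    fix y :: 'a assume y: "y \<in> pos_def_cone"
    show "thompson_dist (c * cinv x * c) (c * cinv y * c) = thompson_dist x y"
      by (simp add: thompson_dist_def ratio x y max.commute)
  qed (rule c)
qed


subsection \<open>Maps preserving the spectral seminorm of products\<close>

locale seminorm_preserver =
  fixes \<phi> :: "'a::unital_cstar_algebra \<Rightarrow> 'b::unital_cstar_algebra"
  assumes image_cone: "\<phi> ` pos_def_cone = pos_def_cone"
    and preserves: "x \<in> pos_def_cone \<Longrightarrow> y \<in> pos_def_cone \<Longrightarrow>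
      spectral_seminorm (\<phi> x * \<phi> y) = spectral_seminorm (x * y)"
begin

lemma maps_cone: "x \<in> pos_def_cone \<Longrightarrow> \<phi> x \<in> pos_def_cone"
  using image_cone by blast

text \<open>The order is tested by seminorms against all elements of the cone; by surjectivity these
  are the elements \<open>\<phi> z\<close>, for which the seminorms are preserved.\<close>

lemma le_iff:
  assumes "x \<in> pos_def_cone" "y \<in> pos_def_cone" shows "\<phi> x \<preceq> \<phi> y \<longleftrightarrow> x \<preceq> y"
proof -
  have "\<phi> x \<preceq> \<phi> y \<longleftrightarrow>
      (\<forall>z \<in> \<phi> ` pos_def_cone. spectral_seminorm (z * \<phi> x) \<le> spectral_seminorm (z * \<phi> y))"
    unfolding image_cone by (rule cstar_le_iff_seminorm) (use assms maps_cone in auto)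
  also have "\<dots> \<longleftrightarrow> x \<preceq> y"
    using assms by (simp add: preserves cstar_le_iff_seminorm)
  finally show ?thesis .
qed

lemma eqI_preserver:
  assumes "u \<in> pos_def_cone" "v \<in> pos_def_cone"
    and "\<And>z. z \<in> pos_def_cone \<Longrightarrow> spectral_seminorm (\<phi> z * u) = spectral_seminorm (\<phi> z * v)"
  shows "u = v"
proof (rule cone_eqI_seminorm[OF assms(1,2)])
  fix z :: 'b assume "z \<in> pos_def_cone"
  then have "z \<in> \<phi> ` pos_def_cone" by (simp only: image_cone)
  then obtain w where "z = \<phi> w" "w \<in> pos_def_cone" by (rule imageE)
  then show "spectral_seminorm (z * u) = spectral_seminorm (z * v)" using assms(3) by simp
qed

lemma inj_on_cone: "inj_on \<phi> pos_def_cone"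
  using le_iff by (intro inj_onI cstar_le_antisym) (metis cstar_le_refl)+

lemma bij_cone: "bij_betw \<phi> pos_def_cone pos_def_cone"
  using inj_on_cone image_cone by (simp add: bij_betw_def)

lemma inverse_preserver: "seminorm_preserver (inv_into pos_def_cone \<phi>)"
proof
  note b = bij_cone
  show "inv_into pos_def_cone \<phi> ` pos_def_cone = pos_def_cone"
    using bij_betw_inv_into[OF b] by (simp add: bij_betw_def)
  fix x y :: 'b assume xy: "x \<in> pos_def_cone" "y \<in> pos_def_cone"
  then have "inv_into pos_def_cone \<phi> x \<in> pos_def_cone" "inv_into pos_def_cone \<phi> y \<in> pos_def_cone"
    using bij_betwE[OF bij_betw_inv_into[OF b]] by auto
  from preserves[OF this] show "spectral_seminorm (inv_into pos_def_cone \<phi> x * inv_into pos_def_cone \<phi> y)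
      = spectral_seminorm (x * y)"
    using xy by (simp add: bij_betw_inv_into_right[OF b])
qed

lemma scaleR: 
  assumes x: "x \<in> pos_def_cone" and t: "0 < t" shows "\<phi> (t *\<^sub>R x) = t *\<^sub>R \<phi> x"
proof (rule eqI_preserver)
  fix z :: 'a assume z: "z \<in> pos_def_cone"
  show "spectral_seminorm (\<phi> z * \<phi> (t *\<^sub>R x)) = spectral_seminorm (\<phi> z * t *\<^sub>R \<phi> x)"
    using x t z by (simp add: preserves cone_scaleR spectral_seminorm_scaleR maps_cone del: mult_scaleR_right)
qed (use x t in \<open>auto intro: maps_cone cone_scaleR\<close>)

text \<open>The ratio of the images contains \<open>cinv (\<phi> y)\<close>, whose relation to
  \<open>\<phi> (cinv y)\<close> is still open. It is therefore compared through order and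
  homogeneity, and the rule for inverses is read off from it afterwards.\<close>

lemma ratio:
  assumes x: "x \<in> pos_def_cone" and y: "y \<in> pos_def_cone"
  shows "thompson_ratio (\<phi> x) (\<phi> y) = thompson_ratio x y"
proof -
  have iff: "thompson_ratio (\<phi> x) (\<phi> y) \<le> t \<longleftrightarrow> thompson_ratio x y \<le> t" if "0 < t" for t
    using x y that by (simp add: thompson_ratio_le_iff maps_cone scaleR[symmetric] le_iff cone_scaleR)
  show ?thesis
    using iff[OF thompson_ratio_pos[OF x y]]
      iff[OF thompson_ratio_pos[OF maps_cone[OF x] maps_cone[OF y]]] by simp
qed

lemma map_cinv: 
  assumes y: "y \<in> pos_def_cone" shows "\<phi> (cinv y) = cinv (\<phi> y)"
proof (rule eqI_preserver)
  fix z :: 'a assume z: "z \<in> pos_def_cone"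
  show "spectral_seminorm (\<phi> z * \<phi> (cinv y)) = spectral_seminorm (\<phi> z * cinv (\<phi> y))"
    using ratio[OF z y] by (simp add: thompson_ratio_def preserves z y cone_cinv)
qed (use y in \<open>auto intro: maps_cone cone_cinv\<close>)

text \<open>The image u of 1 is its own inverse, so the seminorm of u squared is 1, hence so is that
  of u. Both Thompson ratios between u and 1 are then 1, which puts u below and above 1.\<close>

lemma map_one: "\<phi> 1 = 1"
proof -
  have u: "\<phi> 1 \<in> pos_def_cone" by (rule maps_cone) simp
  have "\<phi> 1 = cinv (\<phi> 1)" using map_cinv[of 1] by simp
  then have "thompson_ratio (\<phi> 1) 1 = thompson_ratio 1 (\<phi> 1)" by (simp add: thompson_ratio_def)
  moreover have "thompson_ratio (\<phi> 1) (\<phi> 1) = spectral_seminorm (\<phi> 1 * 1 * (\<phi> 1 * 1))"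
    using \<open>\<phi> 1 = cinv (\<phi> 1)\<close> by (simp add: thompson_ratio_def)
  then have "(thompson_ratio (\<phi> 1) 1)\<^sup>2 = 1"
    using spectral_seminorm_mult_square[OF u cone_one] u
    by (simp add: thompson_ratio_self) (simp add: thompson_ratio_def)
  then have "thompson_ratio (\<phi> 1) 1 = 1"
    using thompson_ratio_nonneg[OF u cone_one] by (simp add: power2_eq_1_iff)
  ultimately show ?thesis
    using thompson_ratio_le_iff[OF u cone_one, of 1] thompson_ratio_le_iff[OF cone_one u, of 1]
    by (auto intro: cstar_le_antisym)
qed

text \<open>The reflection at \<open>c\<close> exchanges 1 and \<open>c * c\<close>, and the one at
  \<open>?c'\<close> exchanges 1 and \<open>\<phi> (c * c)\<close>; so both centers are midpoints of
  corresponding pairs.\<close>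

lemma map_square:
  assumes c: "c \<in> pos_def_cone" shows "\<phi> (c * c) = \<phi> c * \<phi> c"
proof -
  let ?c' = "csqrt_cone (\<phi> (c * c))"
  have cc: "c * c \<in> pos_def_cone" using cone_congruence[of 1 c] c by (simp add: cone_hermitian cone_invertible)
  have c': "?c' \<in> pos_def_cone" by (intro powr_cone maps_cone cc)
  have iso: "isometry_between pos_def_cone thompson_dist pos_def_cone thompson_dist \<phi>"
    using bij_cone by (simp add: isometry_between_def thompson_dist_def ratio)
  have "\<phi> c = ?c'"
    by (rule isometry_maps_center[OF Metric_space_thompson Metric_space_thompson iso
          thompson_reflection[OF c] thompson_reflection[OF c'], of 1])
       (simp_all add: map_one csqrt_cone_square maps_cone cc)
  then show ?thesis using csqrt_cone_square[OF maps_cone[OF cc]] by simp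
qed

end


subsection \<open>Kadison's inequality\<close>

text \<open>The assumptions concern hermitian elements only, since the intended instance is a
  logarithm of \<open>\<phi> (exp x)\<close>, which is meaningful there.\<close>

locale unital_positive_map =
  fixes D :: "'a::unital_cstar_algebra \<Rightarrow> 'b::unital_cstar_algebra"
  assumes map_hermitian: "hermitian x \<Longrightarrow> hermitian (D x)"
    and map_add: "hermitian x \<Longrightarrow> hermitian y \<Longrightarrow> D (x + y) = D x + D y"
    and map_scaleR: "hermitian x \<Longrightarrow> D (r *\<^sub>R x) = r *\<^sub>R D x"
    and map_one: "D 1 = 1"
    and map_positive: "cstar_positive x \<Longrightarrow> cstar_positive (D x)"
begin

lemma map_diff: "hermitian x \<Longrightarrow> hermitian y \<Longrightarrow> D (x - y) = D x - D y"
  using map_add[of x "(- 1) *\<^sub>R y"] map_scaleR[of y "- 1"] by (simp add: invol_minus)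

lemma map_zero: "D 0 = 0"
  using map_scaleR[of 0 0] by simp

lemma map_mono: "hermitian x \<Longrightarrow> hermitian y \<Longrightarrow> x \<preceq> y \<Longrightarrow> D x \<preceq> D y"
  unfolding cstar_le_def using map_positive[of "y - x"] by (simp add: map_diff)

lemma map_sum:
  assumes "\<And>i. i \<in> I \<Longrightarrow> hermitian (f i)"
  shows "D (sum f I) = (\<Sum>i\<in>I. D (f i))"
  using assms
proof (induction I rule: infinite_finite_induct)
  case (insert i I)
  then show ?case by (simp add: map_add invol_sum)
qed (simp_all add: map_zero)

text \<open>A discretization by Bernstein polynomials \<open>P k\<close> in \<open>y\<close>: with
  \<open>T = (\<Sum>k. k D (P k)) = n D y\<close>, the sum of the positive elements
  \<open>(k - T) D (P k) (k - T)\<close> is \<open>(\<Sum>k. k\<^sup>2 D (P k)) - T\<^sup>2\<close>.\<close>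

lemma Kadison_unit_interval_approx:
  assumes y: "cstar_positive y" "y \<preceq> 1"
  shows "(real n)\<^sup>2 *\<^sub>R (D y * D y) \<preceq> (real n * (real n - 1)) *\<^sub>R D (y * y) + real n *\<^sub>R D y"
proof -
  have h: "hermitian y" by (rule positive_hermitian[OF y(1)])
  have h2: "hermitian (y * y)" by (simp add: invol_mult h)
  obtain \<Phi> where fc: "is_functional_calculus y \<Phi>" using functional_calculus_exists[OF h] by blast
  have real: "of_real (Re t) = t" and ge: "0 \<le> Re t" and le: "Re t \<le> 1" if t: "t \<in> cstar_spectrum y" for t
  proof -
    show r: "of_real (Re t) = t" using hermitian_spectrum_real[OF h t] by (simp add: complex_eq_iff)
    show "0 \<le> Re t" by (rule positive_spectrum[OF y(1)]) (simp add: r t)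
    have "of_real (1 - Re t) \<in> cstar_spectrum (1 *\<^sub>R 1 - y)"
      unfolding spectrum_real_diff by (simp add: r t)
    then show "Re t \<le> 1" using y(2) positive_spectrum[of "1 - y" "1 - Re t"] by (simp add: cstar_le_def)
  qed
  define P where "P k = \<Phi> (\<lambda>t. of_real (Bernstein n k (Re t)))" for k
  have cB: "continuous_on (cstar_spectrum y) (\<lambda>t. complex_of_real (Bernstein n k (Re t)))" for k
    unfolding Bernstein_def by (intro continuous_intros)
  have P: "cstar_positive (P k)" for k
  proof (rule positiveI)
    show "hermitian (P k)" unfolding P_def by (rule fc_hermitian[OF h fc cB]) simp
    fix r assume "complex_of_real r \<in> cstar_spectrum (P k)"
    then obtain t where t: "t \<in> cstar_spectrum y" "complex_of_real (Bernstein n k (Re t)) = of_real r"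
      unfolding P_def using fc_spectrumD[OF h fc cB] by blast
    then show "0 \<le> r" using Bernstein_nonneg[OF ge[OF t(1)] le[OF t(1)], of n k] by simp
  qed
  have sum: "(\<Sum>k\<le>n. c k *\<^sub>R P k) = \<Phi> (\<lambda>t. of_real (f (Re t)))"
    if f: "\<And>x. (\<Sum>k\<le>n. c k * Bernstein n k x) = f x" for c f
  proof -
    have "(\<Sum>k\<le>n. c k *\<^sub>R P k) = (\<Sum>k\<le>n. \<Phi> (\<lambda>t. of_real (c k) * of_real (Bernstein n k (Re t))))"
      unfolding P_def by (simp add: fc_scaleC[OF h fc cB] scaleC_of_real)
    also have "\<dots> = \<Phi> (\<lambda>t. \<Sum>k\<le>n. of_real (c k) * of_real (Bernstein n k (Re t)))"
      by (intro fc_sum[OF h fc, symmetric] continuous_intros cB) simp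
    also have "\<dots> = \<Phi> (\<lambda>t. of_real (f (Re t)))" by (simp add: f[symmetric])
    finally show ?thesis .
  qed
  have s0: "(\<Sum>k\<le>n. P k) = 1"
    using sum[of "\<lambda>_. 1" "\<lambda>_. 1"] by (simp add: fc_one[OF h fc])
  have s1: "(\<Sum>k\<le>n. real k *\<^sub>R P k) = real n *\<^sub>R y"
  proof -
    have "(\<Sum>k\<le>n. real k *\<^sub>R P k) = \<Phi> (\<lambda>t. of_real (real n * Re t))" by (rule sum) simp
    also have "\<dots> = \<Phi> (\<lambda>t. of_real (real n) * t)"
      by (rule fc_cong[OF h fc]) (auto intro!: continuous_intros simp: real)
    also have "\<dots> = of_real (real n) *\<^sub>C y"
      by (subst fc_scaleC[OF h fc]) (auto intro!: continuous_intros simp: fc_id[OF h fc])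
    finally show ?thesis by (simp only: scaleC_of_real)
  qed
  \<comment> \<open>The second moment of the binomial distribution, obtained from the factorial
    moment by writing the square of k as k (k - 1) + k.\<close>
  have s2: "(\<Sum>k\<le>n. (real k)\<^sup>2 *\<^sub>R P k) = (real n * (real n - 1)) *\<^sub>R (y * y) + real n *\<^sub>R y"
  proof -
    have "(\<Sum>k\<le>n. (real k)\<^sup>2 *\<^sub>R P k)
        = (\<Sum>k\<le>n. (real k * (real k - 1)) *\<^sub>R P k) + (\<Sum>k\<le>n. real k *\<^sub>R P k)"
      by (simp add: sum.distrib[symmetric] power2_eq_square algebra_simps)
    also have "(\<Sum>k\<le>n. (real k * (real k - 1)) *\<^sub>R P k)
        = \<Phi> (\<lambda>t. of_real (real n * (real n - 1) * (Re t)\<^sup>2))"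
      by (rule sum) (rule sum_kk_Bernstein)
    also have "\<dots> = \<Phi> (\<lambda>t. of_real (real n * (real n - 1)) * (t * t))"
      by (rule fc_cong[OF h fc]) (auto intro!: continuous_intros simp: real power2_eq_square)
    also have "\<dots> = of_real (real n * (real n - 1)) *\<^sub>C (y * y)"
      using fc_scaleC[OF h fc, of "\<lambda>t. t * t" "of_real (real n * (real n - 1))"]
        fc_mult[OF h fc, of "\<lambda>t. t" "\<lambda>t. t"]
      by (simp add: fc_id[OF h fc] continuous_intros del: of_real_mult)
    finally show ?thesis unfolding s1 by (simp only: scaleC_of_real)
  qed
  have Ph: "hermitian (P k)" for k by (rule positive_hermitian[OF P])
  define T where "T = real n *\<^sub>R D y"
  have Th: "hermitian T" by (simp add: T_def invol_scaleR map_hermitian h)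
  have d0: "(\<Sum>k\<le>n. D (P k)) = 1"
    using map_sum[of "{..n}" P] by (simp add: Ph s0 map_one)
  have d1: "(\<Sum>k\<le>n. real k *\<^sub>R D (P k)) = T"
    using map_sum[of "{..n}" "\<lambda>k. real k *\<^sub>R P k"]
    by (simp add: Ph s1 map_scaleR h invol_scaleR T_def)
  have d2: "(\<Sum>k\<le>n. (real k)\<^sup>2 *\<^sub>R D (P k)) = (real n * (real n - 1)) *\<^sub>R D (y * y) + real n *\<^sub>R D y"
    using map_sum[of "{..n}" "\<lambda>k. (real k)\<^sup>2 *\<^sub>R P k"]
    by (simp add: Ph s2 map_scaleR map_add h h2 invol_scaleR)
  have "cstar_positive (\<Sum>k\<le>n. (real k *\<^sub>R 1 - T) * D (P k) * (real k *\<^sub>R 1 - T))"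
    by (intro positive_sum positive_congruence map_positive P) (simp add: invol_diff invol_scaleR Th)
  also have "(\<Sum>k\<le>n. (real k *\<^sub>R 1 - T) * D (P k) * (real k *\<^sub>R 1 - T))
      = (\<Sum>k\<le>n. (real k)\<^sup>2 *\<^sub>R D (P k) - T * (real k *\<^sub>R D (P k)) - (real k *\<^sub>R D (P k)) * T + T * D (P k) * T)"
    by (rule sum.cong) (simp_all add: algebra_simps power2_eq_square)
  also have "\<dots> = (\<Sum>k\<le>n. (real k)\<^sup>2 *\<^sub>R D (P k)) - T * (\<Sum>k\<le>n. real k *\<^sub>R D (P k))
      - (\<Sum>k\<le>n. real k *\<^sub>R D (P k)) * T + T * (\<Sum>k\<le>n. D (P k)) * T"
    by (simp only: sum.distrib sum_subtractf sum_distrib_left sum_distrib_right)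
  also have "\<dots> = (real n * (real n - 1)) *\<^sub>R D (y * y) + real n *\<^sub>R D y - (real n)\<^sup>2 *\<^sub>R (D y * D y)"
    unfolding d0 d1 d2 by (simp add: T_def power2_eq_square)
  finally show ?thesis by (simp add: cstar_le_def)
qed

lemma Kadison_unit_interval:
  assumes y: "cstar_positive y" "y \<preceq> 1" shows "D y * D y \<preceq> D (y * y)"
  unfolding cstar_le_def
proof (rule positive_closed)
  \<comment> \<open>The discretized inequality for \<open>Suc n\<close> divided by the square of
    \<open>Suc n\<close>; the variance of the binomial distribution leaves an error of order
    1/n.\<close>
  let ?f = "\<lambda>n. D (y * y) - D y * D y + (1 / real (Suc n)) *\<^sub>R (D y - D (y * y))"
  have 0: "(\<lambda>n. 1 / real (Suc n)) \<longlonglongrightarrow> 0" by (rule LIMSEQ_Suc) (rule lim_1_over_n)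
  have "?f \<longlonglongrightarrow> D (y * y) - D y * D y + 0 *\<^sub>R (D y - D (y * y))"
    by (intro tendsto_intros 0)
  then show "?f \<longlonglongrightarrow> D (y * y) - D y * D y" by simp
  fix n
  let ?m = "real (Suc n)"
  have "cstar_positive ((1 / ?m\<^sup>2) *\<^sub>R
      ((?m * (?m - 1)) *\<^sub>R D (y * y) + ?m *\<^sub>R D y - ?m\<^sup>2 *\<^sub>R (D y * D y)))"
    using Kadison_unit_interval_approx[OF y, of "Suc n"]
    unfolding cstar_le_def by (rule positive_scaleR) simp
  also have "(1 / ?m\<^sup>2) *\<^sub>R ((?m * (?m - 1)) *\<^sub>R D (y * y) + ?m *\<^sub>R D y - ?m\<^sup>2 *\<^sub>R (D y * D y))
      = (1 - 1 / ?m) *\<^sub>R D (y * y) + (1 / ?m) *\<^sub>R D y - D y * D y"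
  proof -
    have "(1 / ?m\<^sup>2) * (?m * (?m - 1)) = 1 - 1 / ?m" "(1 / ?m\<^sup>2) * ?m = 1 / ?m" "(1 / ?m\<^sup>2) * ?m\<^sup>2 = 1"
      using of_nat_0_less_iff[where 'a = real, of "Suc n"]
      by (simp_all add: power2_eq_square field_simps del: of_nat_Suc of_nat_0_less_iff)
    then show ?thesis by (simp only: scaleR_diff_right scaleR_add_right scaleR_scaleR scaleR_one)
  qed
  also have "\<dots> = ?f n" by (simp add: scaleR_diff_left scaleR_diff_right)
  finally show "cstar_positive (?f n)" .
qed

text \<open>The defect \<open>D (x * x) - D x * D x\<close> is unchanged by adding real multiples of
  1 to \<open>x\<close> and scales quadratically, so \<open>x\<close> can be moved affinely into the
  unit interval. The summand 1 in \<open>b\<close> keeps it positive for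
  \<open>x = 0\<close>.\<close>

lemma Kadison:
  assumes x: "hermitian x" shows "D x * D x \<preceq> D (x * x)"
proof -
  define b where "b = norm x + 1"
  have b: "b > 0" by (simp add: b_def add_nonneg_pos)
  define y where "y = (1 / (2 * b)) *\<^sub>R (x + b *\<^sub>R 1)"
  have pos: "cstar_positive (b *\<^sub>R 1 - x)" "cstar_positive (b *\<^sub>R 1 + x)"
    using hermitian_norm_le_iff[OF x, of b] by (auto simp: b_def)
  have y0: "cstar_positive y" using positive_scaleR[OF pos(2), of "1 / (2 * b)"] b by (simp add: y_def add.commute)
  have "1 - y = (1 / (2 * b)) *\<^sub>R (b *\<^sub>R 1 - x)"
  proof -
    have "(1 / (2 * b)) * b + (1 / (2 * b)) * b = 1" using b by simp
    then have "1 = ((1 / (2 * b)) * b) *\<^sub>R 1 + ((1 / (2 * b)) * b) *\<^sub>R (1::'a)"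
      by (simp only: scaleR_add_left[symmetric] scaleR_one)
    then show ?thesis unfolding y_def by (simp only: scaleR_diff_right scaleR_add_right scaleR_scaleR) (simp add: algebra_simps)
  qed
  then have y1: "y \<preceq> 1" using positive_scaleR[OF pos(1), of "1 / (2 * b)"] b by (simp add: cstar_le_def)
  have hy: "hermitian y" by (rule positive_hermitian[OF y0])
  have h: "hermitian (y * y)" by (simp add: invol_mult hy)
  have xy: "x = (2 * b) *\<^sub>R y - b *\<^sub>R 1" using b by (simp add: y_def)
  have Dx: "D x = (2 * b) *\<^sub>R D y - b *\<^sub>R 1"
    unfolding xy by (simp add: map_diff map_scaleR hy invol_scaleR map_one)
  have "x * x = (2 * b)\<^sup>2 *\<^sub>R (y * y) - (4 * b\<^sup>2) *\<^sub>R y + b\<^sup>2 *\<^sub>R 1"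
    unfolding xy by (simp add: algebra_simps power2_eq_square) (simp add: scaleR_add_left[symmetric])
  then have "D (x * x) = (2 * b)\<^sup>2 *\<^sub>R D (y * y) - (4 * b\<^sup>2) *\<^sub>R D y + b\<^sup>2 *\<^sub>R 1"
    by (simp add: map_diff map_add map_scaleR hy h invol_scaleR invol_diff map_one)
  moreover have "D x * D x = (2 * b)\<^sup>2 *\<^sub>R (D y * D y) - (4 * b\<^sup>2) *\<^sub>R D y + b\<^sup>2 *\<^sub>R 1"
    unfolding Dx by (simp add: algebra_simps power2_eq_square) (simp add: scaleR_add_left[symmetric])
  ultimately have "D (x * x) - D x * D x = (2 * b)\<^sup>2 *\<^sub>R (D (y * y) - D y * D y)"
    by (simp add: scaleR_diff_right)
  then show ?thesis
    using positive_scaleR[OF Kadison_unit_interval[OF y0 y1, unfolded cstar_le_def], of "(2 * b)\<^sup>2"]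
    by (simp add: cstar_le_def)
qed

end


subsection \<open>The logarithmic form of a preserver\<close>

lemma exp_add_real:
  fixes x :: "'a::unital_cstar_algebra"
  shows "exp (x + s *\<^sub>R 1) = exp s *\<^sub>R exp x"
  by (subst exp_add_commuting) (simp_all add: exp_of_real[unfolded of_real_def])

context seminorm_preserver
begin

definition logmap :: "'a \<Rightarrow> 'b" where
  "logmap x = clog (\<phi> (exp x))"

lemma
  assumes "hermitian x"
  shows logmap_hermitian: "hermitian (logmap x)" and exp_logmap: "exp (logmap x) = \<phi> (exp x)"
  using assms unfolding logmap_def by (auto intro!: hermitian_clog exp_clog maps_cone exp_cone)

lemma logmap_eqI: "hermitian y \<Longrightarrow> exp y = \<phi> (exp x) \<Longrightarrow> logmap x = y"
  unfolding logmap_def using clog_exp[of y] by simp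

lemma logmap_add_real:
  assumes "hermitian x" shows "logmap (x + s *\<^sub>R 1) = logmap x + s *\<^sub>R 1"
  using assms
  by (intro logmap_eqI) (simp_all add: invol_add invol_scaleR logmap_hermitian exp_add_real exp_logmap scaleR exp_cone)

lemma logmap_zero: "logmap 0 = 0"
  by (rule logmap_eqI) (simp_all add: map_one)

lemma logmap_double:
  assumes "hermitian x" shows "logmap (2 *\<^sub>R x) = 2 *\<^sub>R logmap x"
proof (rule logmap_eqI)
  have "exp (2 *\<^sub>R logmap x) = exp (logmap x) * exp (logmap x)"
    using exp_scaleR_add[of 1 "logmap x" 1] by simp
  also have "\<dots> = \<phi> (exp x * exp x)" using assms by (simp add: exp_logmap map_square exp_cone)
  also have "exp x * exp x = exp (2 *\<^sub>R x)" using exp_scaleR_add[of 1 x 1] by simp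
  finally show "exp (2 *\<^sub>R logmap x) = \<phi> (exp (2 *\<^sub>R x))" .
qed (simp add: assms invol_scaleR logmap_hermitian)

lemma logmap_dyadic:
  assumes "hermitian x" shows "logmap ((1/2) ^ n *\<^sub>R x) = (1/2) ^ n *\<^sub>R logmap x"
proof (induction n)
  case (Suc n)
  have "logmap (2 *\<^sub>R ((1/2) ^ Suc n *\<^sub>R x)) = 2 *\<^sub>R logmap ((1/2) ^ Suc n *\<^sub>R x)"
    by (rule logmap_double) (simp add: assms invol_scaleR)
  also have "2 *\<^sub>R ((1/2) ^ Suc n *\<^sub>R x) = (1/2) ^ n *\<^sub>R x" by simp
  finally have "(1/2) *\<^sub>R ((1/2) ^ n *\<^sub>R logmap x) = (1/2) *\<^sub>R (2 *\<^sub>R logmap ((1/2) ^ Suc n *\<^sub>R x))"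
    using Suc.IH by simp
  then show ?case by simp
qed simp

text \<open>\<open>\<phi>\<close> is monotone and \<open>logmap\<close> is its derivative at \<open>1\<close>, along the points
  \<open>exp (2\<^sup>-\<^sup>n x)\<close>.\<close>

lemma logmap_mono_strict:
  assumes x: "hermitian x" and y: "hermitian y" and d: "0 < d" "x + d *\<^sub>R 1 \<preceq> y"
  shows "logmap x \<preceq> logmap y"
proof -
  define t :: "nat \<Rightarrow> real" where "t n = (1/2) ^ n" for n
  have t0: "t n > 0" for n by (simp add: t_def)
  have "t \<longlonglongrightarrow> 0" unfolding t_def by (rule LIMSEQ_realpow_zero) simp_all
  then have t: "filterlim t (at_right 0) sequentially"
    by (rule tendsto_imp_filterlim_at_right) (simp add: t0)
  note quot = filterlim_compose[OF exp_scaleR_difference_quotient t]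
  define q where "q z n = (exp (t n *\<^sub>R z) - 1) /\<^sub>R t n" for z :: 'a and n
  define r where "r z n = (exp (t n *\<^sub>R z) - 1) /\<^sub>R t n" for z :: 'b and n
  have lq: "q z \<longlonglongrightarrow> z" for z unfolding q_def using quot[of z] .
  have lr: "r z \<longlonglongrightarrow> z" for z unfolding r_def using quot[of z] .
  have hq: "hermitian (q z n)" if "hermitian z" for z n
    using that by (simp add: q_def invol_scaleR invol_diff hermitian_exp)
  \<comment> \<open>Once the errors of the two difference quotients differ by less than
    \<open>d\<close>, the gap between \<open>x\<close> and \<open>y\<close> orders the quotients
    themselves.\<close>
  have "(\<lambda>n. norm ((q x n - x) - (q y n - y))) \<longlonglongrightarrow> norm ((x - x) - (y - y))"
    by (intro tendsto_intros lq)
  then have "\<forall>\<^sub>F n in sequentially. norm ((q x n - x) - (q y n - y)) < d"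
    using d(1) by (intro order_tendstoD(2)) simp
  then have "\<forall>\<^sub>F n in sequentially. r (logmap x) n \<preceq> r (logmap y) n"
  proof eventually_elim
    case (elim n)
    have "cstar_positive (d *\<^sub>R 1 - ((q x n - x) - (q y n - y)))"
      using elim hermitian_norm_le_iff[of "(q x n - x) - (q y n - y)" d] x y hq
      by (simp add: invol_diff)
    from positive_add[OF this d(2)[unfolded cstar_le_def]]
    have "q x n \<preceq> q y n" by (simp add: cstar_le_def algebra_simps)
    from cstar_le_scaleR[OF this, of "t n"] have "exp (t n *\<^sub>R x) \<preceq> exp (t n *\<^sub>R y)"
      using t0[of n] by (simp add: q_def cstar_le_def)
    then have "\<phi> (exp (t n *\<^sub>R x)) \<preceq> \<phi> (exp (t n *\<^sub>R y))"
      using x y by (subst le_iff) (auto intro: exp_cone hermitian_scaleR)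
    \<comment> \<open>This is where the dyadic scale is used: \<open>\<phi>\<close> of the small
      exponential of \<open>x\<close> is the small exponential of \<open>logmap x\<close>, so the
      order reaches the quotients \<open>r\<close>.\<close>
    then have "exp (t n *\<^sub>R logmap x) \<preceq> exp (t n *\<^sub>R logmap y)"
      using x y unfolding t_def
      by (simp add: logmap_dyadic[symmetric] exp_logmap hermitian_scaleR)
    then have "exp (t n *\<^sub>R logmap x) - 1 \<preceq> exp (t n *\<^sub>R logmap y) - 1" by (simp add: cstar_le_def)
    from cstar_le_scaleR[OF this, of "inverse (t n)"] show "r (logmap x) n \<preceq> r (logmap y) n"
      using t0[of n] by (simp add: r_def)
  qed
  then obtain N where N: "\<And>n. n \<ge> N \<Longrightarrow> r (logmap x) n \<preceq> r (logmap y) n"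
    unfolding eventually_sequentially by blast
  have "(\<lambda>n. r (logmap y) (n + N) - r (logmap x) (n + N)) \<longlonglongrightarrow> logmap y - logmap x"
    by (intro tendsto_intros LIMSEQ_ignore_initial_segment lr)
  then show ?thesis unfolding cstar_le_def
    by (rule positive_closed) (use N in \<open>simp add: cstar_le_def\<close>)
qed

text \<open>The gap is created by adding \<open>1 / real (Suc n)\<close> to \<open>y\<close>, which
  \<open>logmap\<close> passes through unchanged, and vanishes in the limit.\<close>

lemma logmap_mono:
  assumes x: "hermitian x" and y: "hermitian y" and le: "x \<preceq> y"
  shows "logmap x \<preceq> logmap y"
  unfolding cstar_le_def
proof (rule positive_closed)
  have 0: "(\<lambda>n. 1 / real (Suc n)) \<longlonglongrightarrow> 0" by (rule LIMSEQ_Suc) (rule lim_1_over_n)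
  let ?f = "\<lambda>n. logmap y + (1 / real (Suc n)) *\<^sub>R 1 - logmap x"
  have "?f \<longlonglongrightarrow> logmap y + 0 *\<^sub>R 1 - logmap x" by (intro tendsto_intros 0)
  then show "?f \<longlonglongrightarrow> logmap y - logmap x" by simp
  fix n
  have "logmap x \<preceq> logmap (y + (1 / real (Suc n)) *\<^sub>R 1)"
    using x y le by (intro logmap_mono_strict[of _ _ "1 / real (Suc n)"])
      (simp_all add: invol_add invol_scaleR cstar_le_def)
  then show "cstar_positive (?f n)" using y by (simp add: logmap_add_real cstar_le_def)
qed

lemma logmap_contraction:
  assumes x: "hermitian x" and y: "hermitian y"
  shows "norm (logmap x - logmap y) \<le> norm (x - y)"
proof -
  let ?s = "norm (x - y)"
  have "x \<preceq> y + ?s *\<^sub>R 1" "y \<preceq> x + ?s *\<^sub>R 1"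
    using hermitian_norm_dist_le_iff[OF x y, of ?s] by auto
  then have "logmap x \<preceq> logmap (y + ?s *\<^sub>R 1)" "logmap y \<preceq> logmap (x + ?s *\<^sub>R 1)"
    using x y by (auto intro!: logmap_mono simp: invol_add invol_scaleR)
  then show ?thesis
    using x y by (simp add: hermitian_norm_dist_le_iff logmap_hermitian logmap_add_real)
qed

end

section \<open>Linearity and multiplicativity of the logarithmic form\<close>

lemma (in seminorm_preserver) logmap_inverse:
  assumes x: "hermitian x"
  shows "seminorm_preserver.logmap (inv_into pos_def_cone \<phi>) (logmap x) = x"
proof -
  interpret I: seminorm_preserver "inv_into pos_def_cone \<phi>" by (rule inverse_preserver)
  show ?thesis
    using x by (intro I.logmap_eqI) (simp_all add: exp_logmap exp_cone inj_on_cone)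
qed

lemma (in seminorm_preserver) logmap_inverse':
  assumes y: "hermitian y"
  shows "logmap (seminorm_preserver.logmap (inv_into pos_def_cone \<phi>) y) = y"
proof -
  interpret I: seminorm_preserver "inv_into pos_def_cone \<phi>" by (rule inverse_preserver)
  show ?thesis
    using y by (intro logmap_eqI) (simp_all add: I.exp_logmap exp_cone f_inv_into_f image_cone)
qed

lemma midpoint_reflection:
  fixes x y :: "'a::unital_cstar_algebra"
  assumes "hermitian x" "hermitian y"
  shows "reflection {z. hermitian z} dist (\<lambda>z. x + y - z) ((1/2) *\<^sub>R (x + y))"
proof -
  have "dist (x + y - z) z = 2 * dist z ((1/2) *\<^sub>R (x + y))" for z
  proof -
    have "x + y - z - z = (- 2) *\<^sub>R (z - (1/2) *\<^sub>R (x + y))" by (simp add: algebra_simps scaleR_2)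
    then show ?thesis by (simp add: dist_norm)
  qed
  then show ?thesis
    using assms by (simp add: reflection_def invol_diff invol_add invol_scaleR)
      (simp add: dist_norm norm_minus_commute)
qed

lemma Metric_space_hermitian: "Metric_space {z :: 'a::unital_cstar_algebra. hermitian z} dist"
  by unfold_locales (auto simp: dist_commute dist_triangle)

context seminorm_preserver
begin

lemma logmap_isometry: "isometry_between {x. hermitian x} dist {y. hermitian y} dist logmap"
  unfolding isometry_between_def
proof (intro conjI ballI)
  interpret I: seminorm_preserver "inv_into pos_def_cone \<phi>" by (rule inverse_preserver)
  show "bij_betw logmap {x. hermitian x} {y. hermitian y}"
    by (intro bij_betw_byWitness[of _ I.logmap])
       (auto simp: logmap_inverse logmap_inverse' logmap_hermitian I.logmap_hermitian)
  fix x y :: 'a assume "x \<in> {x. hermitian x}" "y \<in> {x. hermitian x}"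
  then have h: "hermitian x" "hermitian y" by auto
  show "dist (logmap x) (logmap y) = dist x y"
    using logmap_contraction[OF h] I.logmap_contraction[of "logmap x" "logmap y"] h
    by (simp add: dist_norm logmap_inverse logmap_hermitian)
qed

text \<open>The midpoint rule is applied to the doubled elements, whose midpoint is
  \<open>x + y\<close>; \<open>logmap_double\<close> then cancels the factors.\<close>

lemma logmap_add:
  assumes x: "hermitian x" and y: "hermitian y" shows "logmap (x + y) = logmap x + logmap y"
proof -
  have h: "hermitian (2 *\<^sub>R x)" "hermitian (2 *\<^sub>R y)" using x y by (simp_all add: invol_scaleR)
  have "logmap ((1/2) *\<^sub>R (2 *\<^sub>R x + 2 *\<^sub>R y))
      = (1/2) *\<^sub>R (logmap (2 *\<^sub>R x) + logmap (2 *\<^sub>R y))"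
    by (rule isometry_maps_center[OF Metric_space_hermitian Metric_space_hermitian logmap_isometry
          midpoint_reflection[OF h] midpoint_reflection[OF logmap_hermitian[OF h(1)] logmap_hermitian[OF h(2)]],
          of "2 *\<^sub>R x"]) (use h in simp_all)
  then show ?thesis using x y by (simp add: logmap_double scaleR_add_right)
qed

text \<open>Additivity gives rational factors, and the Lipschitz bound from
  \<open>logmap_contraction\<close> extends them to real ones.\<close>

lemma logmap_scaleR:
  assumes x: "hermitian x" shows "logmap (r *\<^sub>R x) = r *\<^sub>R logmap x"
proof -
  define f where "f s = logmap (s *\<^sub>R x)" for s
  have f_add: "f (s + t) = f s + f t" for s t
    using x by (simp add: f_def scaleR_add_left logmap_add hermitian_scaleR)
  have f0: "f 0 = 0" by (simp add: f_def logmap_zero)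
  have f_minus: "f (- s) = - f s" for s
    using f_add[of s "- s"] f0 by (simp add: add_eq_0_iff)
  have f_nat: "f (real n * s) = real n *\<^sub>R f s" for n s
    by (induction n) (simp_all add: f0 f_add algebra_simps)
  have f_int: "f (of_int k * s) = of_int k *\<^sub>R f s" for k s
    by (cases k rule: int_cases2) (simp_all add: f_nat f_minus)
  have rat: "f s - s *\<^sub>R f 1 = 0" if "s \<in> \<rat>" for s
  proof -
    from that obtain a b :: int where ab: "b > 0" "s = of_int a / of_int b"
      using Rats_cases' by blast
    have "of_int b *\<^sub>R f s = of_int a *\<^sub>R f 1"
      using f_int[of b s] f_int[of a 1] ab by simp
    then have "(1 / of_int b) *\<^sub>R (of_int b *\<^sub>R f s) = (1 / of_int b) *\<^sub>R (of_int a *\<^sub>R f 1)" by simp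
    then show ?thesis using ab by simp
  qed
  have "continuous_on UNIV f"
  proof (rule lipschitz_on_continuous_on[where L = "norm x"], rule lipschitz_onI)
    fix s t show "dist (f s) (f t) \<le> norm x * dist s t"
      using logmap_contraction[of "s *\<^sub>R x" "t *\<^sub>R x"] x
      by (simp add: f_def dist_norm hermitian_scaleR scaleR_diff_left[symmetric] mult.commute)
  qed simp
  then have "continuous_on (closure \<rat>) (\<lambda>s. f s - s *\<^sub>R f 1)"
    by (auto intro!: continuous_intros intro: continuous_on_subset)
  moreover have "r \<in> closure \<rat>"
    unfolding closure_approachable
  proof (intro allI impI)
    fix e :: real assume "e > 0"
    then obtain s where "s \<in> \<rat>" "r < s" "s < r + e" using Rats_dense_in_real[of r "r + e"] by auto
    then show "\<exists>s\<in>\<rat>. dist s r < e" by (intro bexI[of _ s]) (auto simp: dist_real_def)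
  qed
  ultimately have "f r - r *\<^sub>R f 1 = 0" 
    using continuous_constant_on_closure[where S = \<rat> and f = "\<lambda>s. f s - s *\<^sub>R f 1" and a = 0 and x = r] rat
    by blast
  then show ?thesis by (simp add: f_def)
qed

lemma unital_positive_logmap: "unital_positive_map logmap"
proof
  show "logmap 1 = 1" using logmap_add_real[of 0 1] by (simp add: logmap_zero)
  show "cstar_positive (logmap x)" if "cstar_positive x" for x
    using logmap_mono[of 0 x] that by (simp add: logmap_zero cstar_le_def positive_hermitian)
qed (simp_all add: logmap_hermitian logmap_add logmap_scaleR)

end

lemma (in seminorm_preserver) logmap_square:
  assumes x: "hermitian x" shows "logmap (x * x) = logmap x * logmap x"
proof (rule cstar_le_antisym)
  interpret I: seminorm_preserver "inv_into pos_def_cone \<phi>" by (rule inverse_preserver)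
  interpret D: unital_positive_map logmap by (rule unital_positive_logmap)
  interpret E: unital_positive_map I.logmap by (rule I.unital_positive_logmap)
  have h: "hermitian (x * x)" "hermitian (logmap x * logmap x)"
    using x by (simp_all add: invol_mult logmap_hermitian)
  show "logmap x * logmap x \<preceq> logmap (x * x)" by (rule D.Kadison[OF x])
  \<comment> \<open>Kadison's inequality for the inverse map at \<open>logmap x\<close>; applying
    the monotone map \<open>logmap\<close> reverses the first inequality.\<close>
  have "x * x \<preceq> I.logmap (logmap x * logmap x)"
    using E.Kadison[OF logmap_hermitian[OF x]] by (simp add: logmap_inverse x)
  from D.map_mono[OF h(1) E.map_hermitian[OF h(2)] this]
  show "logmap (x * x) \<preceq> logmap x * logmap x" by (simp add: logmap_inverse' h)
qed


subsection \<open>Jordan *-isomorphisms\<close>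

definition complexify :: "('a::unital_cstar_algebra \<Rightarrow> 'b::unital_cstar_algebra) \<Rightarrow> 'a \<Rightarrow> 'b" where
  "complexify D z = D ((1/2) *\<^sub>R (z + invol z)) + \<i> *\<^sub>C D ((- \<i> / 2) *\<^sub>C (z - invol z))"

lemma hermitian_parts:
  assumes "hermitian x" "hermitian y"
  shows "(1/2) *\<^sub>R ((x + \<i> *\<^sub>C y) + invol (x + \<i> *\<^sub>C y)) = x"
    and "(- \<i> / 2) *\<^sub>C ((x + \<i> *\<^sub>C y) - invol (x + \<i> *\<^sub>C y)) = y"
proof -
  show "(1/2) *\<^sub>R ((x + \<i> *\<^sub>C y) + invol (x + \<i> *\<^sub>C y)) = x"
    using assms by (simp add: invol_add invol_scaleC scaleR_add_right[symmetric] flip: scaleR_2)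
  have "(x + \<i> *\<^sub>C y) - invol (x + \<i> *\<^sub>C y) = (2 * \<i>) *\<^sub>C y"
    using assms by (simp add: invol_add invol_scaleC flip: scaleC_add_left)
  then show "(- \<i> / 2) *\<^sub>C ((x + \<i> *\<^sub>C y) - invol (x + \<i> *\<^sub>C y)) = y"
    by (simp del: cvec.scale_minus_left)
qed

lemma cartesian_decomposition:
  fixes z :: "'a::unital_cstar_algebra"
  obtains x y where "hermitian x" "hermitian y" "z = x + \<i> *\<^sub>C y"
proof
  show "hermitian ((1/2) *\<^sub>R (z + invol z))" by (simp add: invol_scaleR invol_add invol_invol add.commute)
  show "hermitian ((- \<i> / 2) *\<^sub>C (z - invol z))"
    by (simp add: invol_scaleC invol_diff invol_invol cvec.scale_right_diff_distrib)
  have "(1/2) *\<^sub>R (z + invol z) + \<i> *\<^sub>C (- \<i> / 2) *\<^sub>C (z - invol z)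
      = (1/2) *\<^sub>R (z + invol z) + (1/2) *\<^sub>R (z - invol z)"
    by (simp add: scaleR_conv_scaleC)
  also have "\<dots> = z" by (simp only: scaleR_add_right[symmetric]) (simp flip: scaleR_2)
  finally show "z = (1/2) *\<^sub>R (z + invol z) + \<i> *\<^sub>C (- \<i> / 2) *\<^sub>C (z - invol z)" by simp
qed

lemma complexify_parts:
  "hermitian x \<Longrightarrow> hermitian y \<Longrightarrow> complexify D (x + \<i> *\<^sub>C y) = D x + \<i> *\<^sub>C D y"
  unfolding complexify_def by (simp only: hermitian_parts)

lemma complexify_hermitian:
  assumes "D 0 = 0" "hermitian x" shows "complexify D x = D x"
  using complexify_parts[of x 0 D] assms by simp

lemma scaleC_cartesian:
  fixes x y :: "'a::unital_cstar_algebra"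
  shows "c *\<^sub>C (x + \<i> *\<^sub>C y) = (Re c *\<^sub>R x - Im c *\<^sub>R y) + \<i> *\<^sub>C (Im c *\<^sub>R x + Re c *\<^sub>R y)"
proof -
  have "c *\<^sub>C (x + \<i> *\<^sub>C y)
      = (of_real (Re c) + \<i> * of_real (Im c)) *\<^sub>C x + ((of_real (Re c) + \<i> * of_real (Im c)) * \<i>) *\<^sub>C y"
    by (simp add: scaleC_add_right flip: complex_eq)
  then show ?thesis
    by (simp add: scaleR_conv_scaleC scaleC_add_left scaleC_add_right algebra_simps)
qed

text \<open>Preservation of squares polarizes to anticommutators of hermitian elements, and complex
  bilinearity extends these to the whole algebra.\<close>

lemma jordan_star_iso_complexify:
  assumes D: "unital_positive_map D"
    and bij: "bij_betw D {x. hermitian x} {y. hermitian y}"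
    and sq: "\<And>x. hermitian x \<Longrightarrow> D (x * x) = D x * D x"
  shows "jordan_star_iso (complexify D)"
proof -
  interpret D: unital_positive_map D by (rule D)
  let ?J = "complexify D"
  note J = complexify_parts
  have add: "?J (z + w) = ?J z + ?J w" for z w
  proof -
    obtain x y where z: "hermitian x" "hermitian y" "z = x + \<i> *\<^sub>C y" by (rule cartesian_decomposition)
    obtain u v where w: "hermitian u" "hermitian v" "w = u + \<i> *\<^sub>C v" by (rule cartesian_decomposition)
    have "z + w = (x + u) + \<i> *\<^sub>C (y + v)" using z w by (simp add: scaleC_add_right)
    then have "?J (z + w) = D (x + u) + \<i> *\<^sub>C D (y + v)"
      using z w by (simp only:) (rule J, simp_all add: invol_add)
    then show ?thesis using z w by (simp add: J D.map_add scaleC_add_right)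
  qed
  have scale: "?J (c *\<^sub>C z) = c *\<^sub>C ?J z" for c z
  proof -
    obtain x y where z: "hermitian x" "hermitian y" "z = x + \<i> *\<^sub>C y" by (rule cartesian_decomposition)
    have "?J (c *\<^sub>C z) = D (Re c *\<^sub>R x - Im c *\<^sub>R y) + \<i> *\<^sub>C D (Im c *\<^sub>R x + Re c *\<^sub>R y)"
      unfolding z(3) scaleC_cartesian
      by (rule J) (simp_all add: invol_diff invol_add invol_scaleR z)
    also have "\<dots> = c *\<^sub>C (D x + \<i> *\<^sub>C D y)"
      unfolding scaleC_cartesian by (simp add: D.map_diff D.map_add D.map_scaleR invol_scaleR z)
    finally show ?thesis using z by (simp add: J)
  qed
  have jordan2: "D (x * y + y * x) = D x * D y + D y * D x" if "hermitian x" "hermitian y" for x y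
  proof -
    have h: "hermitian (x * y + y * x)" "hermitian (x * x)" "hermitian (y * y)"
      using that by (simp_all add: invol_mult invol_add add.commute)
    have "(x + y) * (x + y) = x * x + (x * y + y * x) + y * y" by (simp add: algebra_simps)
    then have "D (x * x) + D (x * y + y * x) + D (y * y) = D ((x + y) * (x + y))"
      using h by (simp add: D.map_add invol_add)
    also have "\<dots> = (D x + D y) * (D x + D y)" using that by (simp add: sq D.map_add invol_add)
    finally show ?thesis using that by (simp add: sq algebra_simps)
  qed
  have jordan: "?J (z * w + w * z) = ?J z * ?J w + ?J w * ?J z" for z w
  proof -
    obtain x y where z: "hermitian x" "hermitian y" "z = x + \<i> *\<^sub>C y" by (rule cartesian_decomposition)
    obtain u v where w: "hermitian u" "hermitian v" "w = u + \<i> *\<^sub>C v" by (rule cartesian_decomposition)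
    have h: "hermitian (a * b + b * a)" if "hermitian a" "hermitian b" for a b :: 'a
      using that by (simp add: invol_mult invol_add add.commute)
    have "z * w + w * z = ((x * u + u * x) - (y * v + v * y)) + \<i> *\<^sub>C ((x * v + v * x) + (y * u + u * y))"
      using z w by (simp add: algebra_simps mult_scaleC_left mult_scaleC_right scaleC_add_right)
    then have "?J (z * w + w * z) = D ((x * u + u * x) - (y * v + v * y))
        + \<i> *\<^sub>C D ((x * v + v * x) + (y * u + u * y))"
      by (simp only:) (rule J; simp only: invol_add invol_diff h[unfolded invol_add] z w)
    also have "\<dots> = ((D x * D u + D u * D x) - (D y * D v + D v * D y))
        + \<i> *\<^sub>C ((D x * D v + D v * D x) + (D y * D u + D u * D y))"
      using z w by (subst D.map_diff) (auto simp: D.map_add h jordan2)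
    also have "\<dots> = ?J z * ?J w + ?J w * ?J z"
      using z w by (simp add: J algebra_simps mult_scaleC_left mult_scaleC_right scaleC_add_right)
    finally show ?thesis .
  qed
  have star: "?J (invol z) = invol (?J z)" for z
  proof -
    obtain x y where z: "hermitian x" "hermitian y" "z = x + \<i> *\<^sub>C y" by (rule cartesian_decomposition)
    have "invol z = x + \<i> *\<^sub>C (- y)" using z by (simp add: invol_add invol_scaleC)
    then have "?J (invol z) = D x + \<i> *\<^sub>C D (- y)" 
      using z by (simp only:) (rule J, simp_all add: invol_minus)
    also have "D (- y) = - D y" using D.map_scaleR[OF z(2), of "- 1"] by simp
    finally show ?thesis using z by (simp add: J invol_add invol_scaleC D.map_hermitian)
  qed
  have "bij ?J"
  proof (rule bijI)
    show "inj ?J"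
    proof (rule injI)
      fix z w assume eq: "?J z = ?J w"
      obtain x y where z: "hermitian x" "hermitian y" "z = x + \<i> *\<^sub>C y" by (rule cartesian_decomposition)
      obtain u v where w: "hermitian u" "hermitian v" "w = u + \<i> *\<^sub>C v" by (rule cartesian_decomposition)
      have e: "D x + \<i> *\<^sub>C D y = D u + \<i> *\<^sub>C D v" using eq z w by (simp add: J)
      have "D x = D u" "D y = D v"
        using hermitian_parts[of "D x" "D y"] hermitian_parts[of "D u" "D v"] z w
        unfolding e by (simp_all add: D.map_hermitian)
      then have "x = u" "y = v" using bij_betw_imp_inj_on[OF bij] z w by (auto simp: inj_on_def)
      then show "z = w" using z w by simp
    qed
    show "surj ?J"
    proof (rule surjI)
      let ?E = "inv_into {x. hermitian x} D"
      fix w :: 'b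
      obtain u v where w: "hermitian u" "hermitian v" "w = u + \<i> *\<^sub>C v" by (rule cartesian_decomposition)
      have "hermitian (?E u)" "hermitian (?E v)" "D (?E u) = u" "D (?E v) = v"
        using w bij_betw_inv_into_right[OF bij] bij_betwE[OF bij_betw_inv_into[OF bij]] by auto
      then show "?J (complexify ?E w) = w" using w by (simp add: J)
    qed
  qed
  then show ?thesis
    unfolding jordan_star_iso_def jordan_prod_def using add scale jordan star by simp
qed

text \<open>Expresses \<open>x * y * x\<close> by anticommutators and a square, all of which a
  Jordan homomorphism respects; it is the substitute for multiplicativity below.\<close>

lemma triple_product_anticommutator:
  fixes x y :: "'a::real_algebra"
  shows "2 *\<^sub>R (x * y * x) = (x * (x * y + y * x) + (x * y + y * x) * x) - (x * x * y + y * (x * x))"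
  by (simp add: algebra_simps scaleR_2)

section \<open>Jordan *-isomorphisms: invertibility, spectra, norms and powers\<close>

context
  fixes J :: "'a::unital_cstar_algebra \<Rightarrow> 'b::unital_cstar_algebra"
  assumes J: "jordan_star_iso J"
begin

lemma jordan_bij: "bij J"
  and jordan_add: "J (a + b) = J a + J b"
  and jordan_scaleC: "J (c *\<^sub>C a) = c *\<^sub>C J a"
  and jordan_invol: "J (invol a) = invol (J a)"
  using J unfolding jordan_star_iso_def by auto

lemma jordan_scaleR: "J (r *\<^sub>R a) = r *\<^sub>R J a"
  by (simp add: scaleR_conv_scaleC jordan_scaleC)

lemma jordan_diff: "J (a - b) = J a - J b"
  using jordan_add[of a "(- 1) *\<^sub>R b"] jordan_scaleR[of "- 1" b] by simp

lemma jordan_anticommutator: "J (a * b + b * a) = J a * J b + J b * J a"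
proof -
  have "J (jordan_prod a b) = jordan_prod (J a) (J b)" using J unfolding jordan_star_iso_def by blast
  then have "2 *\<^sub>C J (jordan_prod a b) = 2 *\<^sub>C jordan_prod (J a) (J b)" by simp
  then show ?thesis by (simp add: jordan_prod_def jordan_scaleC)
qed

lemma jordan_square: "J (a * a) = J a * J a"
proof -
  have "2 *\<^sub>R J (a * a) = 2 *\<^sub>R (J a * J a)"
    using jordan_anticommutator[of a a] by (simp add: jordan_scaleR flip: scaleR_2)
  then show ?thesis by simp
qed

lemma jordan_triple: "J (a * b * a) = J a * J b * J a"
proof -
  have "2 *\<^sub>R J (a * b * a) = 2 *\<^sub>R (J a * J b * J a)"
    unfolding jordan_scaleR[symmetric] triple_product_anticommutator
    by (simp only: jordan_diff jordan_anticommutator jordan_square)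
  then show ?thesis by simp
qed

text \<open>Surjectivity supplies a preimage \<open>e\<close> of 1, and the anticommutator of 1 and
  \<open>e\<close> is mapped both to twice \<open>J e\<close> and to twice
  \<open>J 1\<close>.\<close>

lemma jordan_one: "J 1 = 1"
proof -
  obtain e where e: "J e = 1" using jordan_bij by (metis bij_pointE)
  have "2 *\<^sub>R (1::'b) = 2 *\<^sub>R J 1"
    using jordan_anticommutator[of 1 e] e by (simp add: jordan_scaleR flip: scaleR_2)
  then show ?thesis by simp
qed

lemma jordan_power: "J (a ^ n) = J a ^ n"
proof (induction n)
  case (Suc n)
  have "2 *\<^sub>R J (a ^ Suc n) = J (a * a ^ n + a ^ n * a)"
    by (simp add: power_commutes jordan_add scaleR_2)
  also have "\<dots> = 2 *\<^sub>R J a ^ Suc n"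
    unfolding jordan_anticommutator Suc by (simp add: power_commutes scaleR_2)
  finally show ?case by simp
qed (simp add: jordan_one)

text \<open>Writing 1 as a triple product with outer factors \<open>a\<close> gives, after applying
  \<open>J\<close>, a right and a left inverse of \<open>J a\<close> at once.\<close>

lemma jordan_invertible:
  assumes "cstar_invertible a" shows "cstar_invertible (J a)"
proof -
  let ?b = "cinv a"
  have "a * (?b * ?b) * a = 1"
    using assms by (simp add: mult.assoc[symmetric] cinv_props)
  then have "J a * J (?b * ?b) * J a = 1" using jordan_triple[of a "?b * ?b"] by (simp add: jordan_one)
  then show ?thesis
    by (intro cstar_invertible_left_right[of "J a" "J (?b * ?b) * J a" "J a * J (?b * ?b)"])
       (simp_all add: mult.assoc)
qed

end

lemma jordan_star_iso_inv:
  assumes J: "jordan_star_iso J" shows "jordan_star_iso (inv J)"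
proof -
  have b: "bij J" by (rule jordan_bij[OF J])
  have s: "J (inv J x) = x" for x using b by (simp add: bij_is_surj surj_f_inv_f)
  have eqI: "inv J x = y" if "J y = x" for x y using b that by (metis bij_inv_eq_iff)
  have p: "J (jordan_prod a b) = jordan_prod (J a) (J b)" for a b
    using J unfolding jordan_star_iso_def by blast
  show ?thesis
    unfolding jordan_star_iso_def
    by (auto intro!: bij_imp_bij_inv b eqI simp: jordan_add[OF J] jordan_scaleC[OF J] jordan_invol[OF J] p s)
qed

context
  fixes J :: "'a::unital_cstar_algebra \<Rightarrow> 'b::unital_cstar_algebra"
  assumes J: "jordan_star_iso J"
begin

lemma jordan_spectrum: "cstar_spectrum (J a) = cstar_spectrum a"
proof -
  have "cstar_invertible (J b) \<longleftrightarrow> cstar_invertible b" for b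
    using jordan_invertible[OF J, of b] jordan_invertible[OF jordan_star_iso_inv[OF J], of "J b"]
      bij_is_inj[OF jordan_bij[OF J]] by auto
  moreover have "J a - t *\<^sub>C 1 = J (a - t *\<^sub>C 1)" for t
    by (simp add: jordan_diff[OF J] jordan_scaleC[OF J] jordan_one[OF J])
  ultimately show ?thesis unfolding cstar_spectrum_def by simp
qed

lemma jordan_hermitian: "hermitian a \<Longrightarrow> hermitian (J a)"
  by (simp add: jordan_invol[OF J, symmetric])

lemma jordan_norm_hermitian:
  assumes a: "hermitian a" shows "norm (J a) = norm a"
proof (rule antisym)
  obtain r where r: "of_real r \<in> cstar_spectrum (J a)" "\<bar>r\<bar> = norm (J a)"
    by (rule hermitian_norm_in_spectrum[OF jordan_hermitian[OF a]])
  then show "norm (J a) \<le> norm a" using spectrum_norm_bound[of "of_real r" a] by (simp add: jordan_spectrum)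
  obtain s where s: "of_real s \<in> cstar_spectrum a" "\<bar>s\<bar> = norm a"
    by (rule hermitian_norm_in_spectrum[OF a])
  then show "norm a \<le> norm (J a)" using spectrum_norm_bound[of "of_real s" "J a"] by (simp add: jordan_spectrum)
qed

text \<open>On hermitian elements \<open>J\<close> is isometric; real and imaginary part contribute
  one norm each, whence the constant 2. This suffices to apply \<open>J\<close> termwise to the
  exponential series.\<close>

lemma jordan_bounded_linear: "bounded_linear J"
proof (rule bounded_linear_intro[of _ 2])
  fix z :: 'a
  let ?x = "(1/2) *\<^sub>R (z + invol z)" and ?y = "(1/2) *\<^sub>R (\<i> *\<^sub>C (z - invol z))"
  have h: "hermitian ?x" "hermitian ?y"
    by (simp_all add: invol_scaleR invol_scaleC invol_add invol_diff invol_invol add.commute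
        cvec.scale_right_diff_distrib)
  have n: "norm ?x \<le> norm z" "norm ?y \<le> norm z"
    using norm_triangle_ineq[of z "invol z"] norm_triangle_ineq4[of z "invol z"]
    by (simp_all add: norm_scaleC norm_invol)
  have z: "z = ?x - \<i> *\<^sub>C ?y"
  proof -
    have "?x - \<i> *\<^sub>C ?y = (1/2) *\<^sub>R (z + invol z) + (1/2) *\<^sub>R (z - invol z)"
      by (simp add: scaleC_scaleR algebra_simps)
    also have "\<dots> = z" by (simp only: scaleR_add_right[symmetric]) (simp flip: scaleR_2)
    finally show ?thesis by simp
  qed
  have "norm (J z) = norm (J ?x - \<i> *\<^sub>C J ?y)"
    by (subst z) (simp only: jordan_diff[OF J] jordan_scaleC[OF J])
  also have "\<dots> \<le> norm (J ?x) + norm (\<i> *\<^sub>C J ?y)" by (rule norm_triangle_ineq4)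
  also have "\<dots> = norm ?x + norm ?y" by (simp only: norm_scaleC jordan_norm_hermitian h) simp
  finally show "norm (J z) \<le> norm z * 2" using n by linarith
qed (simp_all add: jordan_add[OF J] jordan_scaleR[OF J])

lemma jordan_exp: "J (exp x) = exp (J x)"
  by (rule bounded_linear_exp[OF jordan_bounded_linear jordan_power[OF J]])

lemma jordan_powr: "x \<in> pos_def_cone \<Longrightarrow> J (cstar_powr x r) = cstar_powr (J x) r"
proof -
  assume x: "x \<in> pos_def_cone"
  have "J x = exp (J (clog x))" using jordan_exp[of "clog x"] by (simp add: exp_clog x)
  then show ?thesis
    by (simp add: cone_powr_exp[OF x] jordan_exp jordan_scaleR[OF J] cstar_powr_exp
        jordan_hermitian hermitian_clog x)
qed

lemma jordan_cone: 
  assumes "x \<in> pos_def_cone" shows "J x \<in> pos_def_cone"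
  using exp_cone[OF jordan_hermitian[OF hermitian_clog[OF assms]]] jordan_exp[of "clog x"]
  by (simp add: exp_clog assms)

text \<open>\<open>J\<close> may fail to respect \<open>x * y\<close>, but
  \<open>spectrum_mult_cone\<close> replaces this product by a triple product, which
  \<open>J\<close> respects.\<close>

lemma jordan_spectrum_mult:
  assumes "x \<in> pos_def_cone" "y \<in> pos_def_cone"
  shows "cstar_spectrum (J x * J y) = cstar_spectrum (x * y)"
  using assms
  by (simp add: spectrum_mult_cone jordan_cone jordan_powr[symmetric] jordan_triple[OF J, symmetric] jordan_spectrum)

lemma jordan_seminorm_powr:
  assumes "x \<in> pos_def_cone" "y \<in> pos_def_cone"
  shows "spectral_seminorm (cstar_powr (J x) q * cstar_powr (J y) q)
    = spectral_seminorm (cstar_powr x q * cstar_powr y q)"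
  using assms
  by (simp add: spectral_seminorm_def jordan_powr[symmetric] jordan_spectrum_mult powr_cone)

end


section \<open>The equivalence of the conditions\<close>

lemma (in seminorm_preserver) extends_to_jordan_star_iso:
  "\<exists>J. jordan_star_iso J \<and> (\<forall>x \<in> pos_def_cone. \<phi> x = J x)"
proof (intro exI conjI ballI)
  let ?J = "complexify logmap"
  show J: "jordan_star_iso ?J"
    using logmap_isometry
    by (intro jordan_star_iso_complexify unital_positive_logmap logmap_square)
       (simp_all add: isometry_between_def)
  fix x :: 'a assume x: "x \<in> pos_def_cone"
  have "?J x = exp (?J (clog x))" using jordan_exp[OF J, of "clog x"] by (simp add: exp_clog x)
  also have "?J (clog x) = logmap (clog x)"
    by (rule complexify_hermitian) (simp_all add: logmap_zero hermitian_clog x)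
  also have "exp \<dots> = \<phi> x" by (simp add: exp_logmap hermitian_clog exp_clog x)
  finally show "\<phi> x = ?J x" by simp
qed

text \<open>Conjugation by powers turns \<open>\<phi>\<close> into a map \<open>\<psi>\<close> with
  exponent 1. The Jordan isomorphism extending \<open>\<psi>\<close> commutes with powers, so
  undoing the conjugation leaves it unchanged and it extends \<open>\<phi>\<close> itself.\<close>

lemma jordan_star_iso_if_seminorm_powr:
  fixes \<phi> :: "'a::unital_cstar_algebra \<Rightarrow> 'b::unital_cstar_algebra"
  assumes q: "q \<noteq> 0" and im: "\<phi> ` pos_def_cone = pos_def_cone"
    and pres: "\<And>x y. x \<in> pos_def_cone \<Longrightarrow> y \<in> pos_def_cone \<Longrightarrow>
      spectral_seminorm (cstar_powr (\<phi> x) q * cstar_powr (\<phi> y) q)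
      = spectral_seminorm (cstar_powr x q * cstar_powr y q)"
  shows "\<exists>J. jordan_star_iso J \<and> (\<forall>x \<in> pos_def_cone. \<phi> x = J x)"
proof -
  define \<psi> where "\<psi> x = cstar_powr (\<phi> (cstar_powr x (1/q))) q" for x
  have \<phi>: "x \<in> pos_def_cone \<Longrightarrow> \<phi> x \<in> pos_def_cone" for x using im by blast
  have \<psi>\<phi>: "cstar_powr (\<psi> (cstar_powr x q)) (1/q) = \<phi> x" if "x \<in> pos_def_cone" for x
    using that q by (simp add: \<psi>_def powr_powr_cone powr_one_cone \<phi> powr_cone)
  have "seminorm_preserver \<psi>"
  proof
    fix x y :: 'a assume xy: "x \<in> pos_def_cone" "y \<in> pos_def_cone"
    then show "spectral_seminorm (\<psi> x * \<psi> y) = spectral_seminorm (x * y)"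
      using q by (simp add: \<psi>_def pres powr_cone powr_powr_cone powr_one_cone)
  next
    show "\<psi> ` pos_def_cone = pos_def_cone"
    proof (intro equalityI subsetI)
      fix v :: 'b assume v: "v \<in> pos_def_cone"
      then have "cstar_powr v (1/q) \<in> \<phi> ` pos_def_cone" by (simp only: im powr_cone)
      then obtain u where u: "u \<in> pos_def_cone" "cstar_powr v (1/q) = \<phi> u" by (elim imageE)
      then have "\<psi> (cstar_powr u q) = cstar_powr (cstar_powr v (1/q)) q"
        using q by (simp add: \<psi>_def powr_powr_cone powr_one_cone)
      also have "\<dots> = v" using v q by (simp add: powr_powr_cone powr_one_cone)
      finally show "v \<in> \<psi> ` pos_def_cone" using powr_cone[OF u(1), of q] by (metis imageI)
    qed (auto simp: \<psi>_def intro: powr_cone \<phi>)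
  qed
  then obtain J where J: "jordan_star_iso J" "\<forall>x \<in> pos_def_cone. \<psi> x = J x"
    using seminorm_preserver.extends_to_jordan_star_iso by blast
  have "\<phi> x = J x" if x: "x \<in> pos_def_cone" for x
  proof -
    have "\<phi> x = cstar_powr (J (cstar_powr x q)) (1/q)" using \<psi>\<phi>[OF x] J(2) powr_cone[OF x] by metis
    also have "\<dots> = J x"
      using jordan_powr[OF J(1) powr_cone[OF x], of q "1/q"] x q by (simp add: powr_powr_cone powr_one_cone)
    finally show ?thesis .
  qed
  with J(1) show ?thesis by blast
qed

text \<open>By the C*-identity the squared norm is that of \<open>y * (x * x) * y\<close>, and
  \<open>y\<close> is the square root of its own square; this accounts for the exchanged
  order.\<close>

lemma norm_mult_cone:
  assumes x: "x \<in> pos_def_cone" and y: "y \<in> pos_def_cone"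
  shows "(norm (x * y))\<^sup>2 = spectral_seminorm (cstar_powr y 2 * cstar_powr x 2)"
proof -
  have h: "hermitian x" "hermitian y" using x y by (auto intro: cone_hermitian)
  have "(norm (x * y))\<^sup>2 = norm (invol (x * y) * (x * y))" by (simp add: cstar_identity)
  also have "invol (x * y) * (x * y) = csqrt_cone (cstar_powr y 2) * cstar_powr x 2 * csqrt_cone (cstar_powr y 2)"
  proof -
    have "csqrt_cone (cstar_powr y 2) = y" using y by (simp add: powr_powr_cone powr_one_cone)
    then show ?thesis by (simp only: invol_mult h powr_two_cone[OF x] mult.assoc)
  qed
  also have "norm \<dots> = spectral_seminorm (cstar_powr y 2 * cstar_powr x 2)"
    using x y by (simp add: spectral_seminorm_mult_cone powr_cone)
  finally show ?thesis .
qed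

lemma norm_powr_mean:
  assumes x: "x \<in> pos_def_cone" and y: "y \<in> pos_def_cone" and p: "0 < p"
  shows "norm (cstar_powr (cstar_powr x (p/2) * cstar_powr y p * cstar_powr x (p/2)) (1/p))
    = spectral_seminorm (cstar_powr x p * cstar_powr y p) powr (1/p)"
proof -
  let ?w = "cstar_powr x (p/2) * cstar_powr y p * cstar_powr x (p/2)"
  have w: "?w \<in> pos_def_cone"
    using x y by (intro cone_congruence powr_cone cone_hermitian cone_invertible)
  have "spectral_seminorm (cstar_powr x p * cstar_powr y p) = norm ?w"
    using x y by (simp add: spectral_seminorm_mult_cone powr_cone powr_powr_cone)
  then show ?thesis using norm_powr_cone[OF w, of "1/p"] p by simp
qed

theorem theorem3p6:
  fixes \<phi> :: "'a::unital_cstar_algebra \<Rightarrow> 'b::unital_cstar_algebra"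
    and p :: real
  assumes "0 < p"
    and "\<phi> ` pos_def_cone = pos_def_cone"
  shows "all_equivalent
    [\<exists>J :: 'a \<Rightarrow> 'b. jordan_star_iso J \<and> (\<forall>x \<in> pos_def_cone. \<phi> x = J x),
     \<forall>x \<in> pos_def_cone. \<forall>y \<in> pos_def_cone. norm (\<phi> x * \<phi> y) = norm (x * y),
     \<forall>x \<in> pos_def_cone. \<forall>y \<in> pos_def_cone.
       spectral_seminorm (\<phi> x * \<phi> y) = spectral_seminorm (x * y),
     \<forall>x \<in> pos_def_cone. \<forall>y \<in> pos_def_cone.
       cstar_spectrum (\<phi> x * \<phi> y) = cstar_spectrum (x * y),
     \<forall>x \<in> pos_def_cone. \<forall>y \<in> pos_def_cone.
       norm (cstar_powr (cstar_powr (\<phi> x) (p/2) * cstar_powr (\<phi> y) p * cstar_powr (\<phi> x) (p/2)) (1/p))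
       = norm (cstar_powr (cstar_powr x (p/2) * cstar_powr y p * cstar_powr x (p/2)) (1/p))]"
    (is "all_equivalent [?i, ?ii, ?iii, ?iv, ?v]")
proof -
  have \<phi>: "x \<in> pos_def_cone \<Longrightarrow> \<phi> x \<in> pos_def_cone" for x using assms(2) by blast
  \<comment> \<open>Conditions (ii), (iii) and (v) are \<open>S\<close> at the exponents 2, 1 and p,
    each equivalent to (i); condition (iv) lies between (i) and (iii).\<close>
  define S where "S q \<longleftrightarrow> (\<forall>x \<in> pos_def_cone. \<forall>y \<in> pos_def_cone.
      spectral_seminorm (cstar_powr (\<phi> x) q * cstar_powr (\<phi> y) q)
      = spectral_seminorm (cstar_powr x q * cstar_powr y q))" for q
  have S: "S q \<longleftrightarrow> ?i" if "q \<noteq> 0" for q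
  proof
    assume "S q"
    then show ?i using jordan_star_iso_if_seminorm_powr[OF that assms(2)] unfolding S_def by blast
  next
    assume ?i
    then show "S q" unfolding S_def using jordan_seminorm_powr by fastforce
  qed
  have "?ii \<longleftrightarrow> S 2"
  proof -
    have "norm (\<phi> x * \<phi> y) = norm (x * y) \<longleftrightarrow>
        spectral_seminorm (cstar_powr (\<phi> y) 2 * cstar_powr (\<phi> x) 2)
        = spectral_seminorm (cstar_powr y 2 * cstar_powr x 2)"
      if "x \<in> pos_def_cone" "y \<in> pos_def_cone" for x y
      using that by (simp add: norm_mult_cone[symmetric] \<phi> power2_eq_iff_nonneg)
    then show ?thesis unfolding S_def by blast
  qed
  moreover have "?iii \<longleftrightarrow> S 1" unfolding S_def by (simp add: powr_one_cone \<phi>)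
  moreover have "?i \<Longrightarrow> ?iv" using jordan_spectrum_mult by fastforce
  moreover have "?iv \<Longrightarrow> ?iii" by (simp add: spectral_seminorm_def)
  moreover have "?v \<longleftrightarrow> S p"
  proof -
    have inj: "s powr (1/p) = t powr (1/p) \<longleftrightarrow> s = t" if "0 \<le> s" "0 \<le> t" for s t :: real
      by (metis powr_powr powr_one that nonzero_eq_divide_eq assms(1) less_irrefl)
    show ?thesis
      unfolding S_def
      by (intro ball_cong refl)
         (simp only: norm_powr_mean \<phi> assms(1) inj spectral_seminorm_nonneg powr_cone)
  qed
  ultimately show ?thesis
    using S[of 1] S[of 2] S[of p] assms(1) unfolding all_equivalent_def by auto
qed

end
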